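(* Let $D\subset\mathbb{C}$ be a domain bounded by a real-analytic simple closed curve $bD$, let $D^\ast=\{\overline\zeta:\ \zeta\in D\}$ (the image of $D$ under complex conjugation), and let $\alpha<\beta$ be the real numbers such that $$\bigcup\{\,bD+it:\ t\in\mathbb{R}\,\}=\{\zeta\in\mathbb{C}:\ \alpha\le\mathrm{Re}\,\zeta\le\beta\}.$$ Let $\lambda:[\alpha,\beta]\to\mathbb{R}$ be a continuous function and let $a,b,c,d$ be real numbers such that $\mathrm{cl}(D)+ia$ and $\mathrm{cl}(D^\ast)+ic$ are both contained in $\{t+is:\ s<\lambda(t),\ \alpha\le t\le\beta\}$ and such that $\mathrm{cl}(D)+ib$ and $\mathrm{cl}(D^\ast)+id$ are both contained in $\{t+is:\ s>\lambda(t),\ \alpha\le t\le\beta\}$. Let $$Q_1=\bigcup\{\,bD+it:\ a\le t\le b\,\},\qquad Q_2=\bigcup\{\,bD^\ast+is:\ c\le s\le d\,\},$$ and let $f$ be a continuous complex-valued function on $Q_1\cup Q_2$ such that (i) for each $t$, $a\le t\le b$, the function $f|(bD+it)$ has a continuous extension to $\mathrm{cl}(D)+it$ which is holomorphic on $D+it$; and (ii) for each $s$, $c\le s\le d$, the function $f|(bD^\ast+is)$ has a continuous extension to $\mathrm{cl}(D^\ast)+is$ which is holomorphic on $D^\ast+is$. Then $f$ is holomorphic on $\mathrm{Int}\,Q_1\cup\mathrm{Int}\,Q_2$.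
   Context: $bA$ denotes the (topological) boundary of a domain $A$, $\mathrm{cl}(A)$ its closure, and $\mathrm{Int}\,A$ the interior of a set $A$ in $\mathbb{C}$. For $A\subset\mathbb{C}$ and $c\in\mathbb{C}$, $A+c=\{z+c:z\in A\}$. "Domain bounded by a simple closed curve" means the bounded domain whose boundary is that curve. *)

theory Defs
  imports "HOL-Complex_Analysis.Complex_Analysis"
begin

definition real_analytic :: "(real \<Rightarrow> complex) \<Rightarrow> bool" where
  "real_analytic g \<longleftrightarrow>
     (\<forall>t0. \<exists>c :: nat \<Rightarrow> complex. \<exists>r>0. \<forall>t. \<bar>t - t0\<bar> < r \<longrightarrow>
        (\<lambda>n. c n * complex_of_real (t - t0) ^ n) sums g t)"

text \<open>
  A real-analytic simple closed curve is an embedded real-analytic circle, so the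
  parametrization is regular. It is given on the whole real line with period 1, so that
  analyticity and regularity also hold at the point where the loop on [0,1] closes up.
\<close>

definition real_analytic_simple_closed_curve :: "complex set \<Rightarrow> bool" where
  "real_analytic_simple_closed_curve C \<longleftrightarrow>
     (\<exists>g :: real \<Rightarrow> complex.
        real_analytic g \<and> (\<forall>t. g (t + 1) = g t) \<and>
        (\<forall>t. vector_derivative g (at t) \<noteq> 0) \<and>
        simple_path g \<and> pathfinish g = pathstart g \<and> path_image g = C)"

abbreviation vshift :: "real \<Rightarrow> complex set \<Rightarrow> complex set" where
  "vshift t A \<equiv> (\<lambda>z. z + \<i> * complex_of_real t) ` A"

definition holomorphic_extension_to :: "(complex \<Rightarrow> complex) \<Rightarrow> real \<Rightarrow> complex set \<Rightarrow> bool" where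
  "holomorphic_extension_to f t D \<longleftrightarrow>
     (\<exists>g. continuous_on (vshift t (closure D)) g \<and> g holomorphic_on vshift t D \<and>
          (\<forall>z \<in> vshift t (frontier D). g z = f z))"

end

theory Submission
  imports Defs
begin

text \<open>
  Write \<open>G t\<close> for the holomorphic extension of \<open>f\<close> from \<open>bD + it\<close>, transported to \<open>D\<close>, and let \<open>N\<close> be a
  thin band around the graph of \<open>\<lambda>\<close>.

  Near the graph: for a kernel \<open>p\<close> holomorphic in the strip, \<open>I z = \<integral> G t z p (z + it) dt\<close> is
  holomorphic on \<open>D\<close>, and the analogous integral over the translates of \<open>D*\<close>, read at the conjugate
  point, is antiholomorphic on \<open>D\<close>. On \<open>bD\<close> both are vertical integrals of \<open>f p\<close> over segments that cross \<open>N\<close>,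
  so they differ only by integrals off \<open>N\<close>. By the maximum principle the oscillation of \<open>I\<close> is
  bounded by the supremum of \<open>p\<close> off \<open>N\<close>. Pole pushing along \<open>N\<close> then makes
  \<open>I z1 - I z0\<close> for the Cauchy kernel \<open>p = 1 / (\<cdot> - w)\<close> a holomorphic function of \<open>w \<in> N\<close>, although it
  is originally given by one formula to the left and right of the two integration lines and not
  between them. The jumps of the Cauchy transforms show that \<open>G t z\<close> is a
  holomorphic function of \<open>z + it \<in> N\<close>.

  Away from the graph: \<open>G t (w - it)\<close> is locally constant in \<open>t\<close> when \<open>D + it\<close> meets \<open>N\<close>. This spreads to
  all \<open>t\<close>, because \<open>f = G t\<close> on one translate forces \<open>f = G s\<close> on an arc of the boundary of a nearby one.
  Hence \<open>f\<close> is holomorphic on every \<open>D + it\<close>. The remaining interior points lie on the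
  finitely many vertical lines tangent to \<open>bD\<close>, which are removable for continuous functions.
\<close>

section \<open>Holomorphic functions of bounded real part and parameter integrals\<close>

text \<open>Why two families are needed: \<open>z\<close> and \<open>cnj z\<close> lie on one
  vertical line, so for \<open>z\<close> on the boundary both integrals run over segments of that
  line, and the conditions on \<open>a\<close>, \<open>b\<close>, \<open>c\<close>, \<open>d\<close>
  force both segments to contain its part in the band. There the kernel may be large, but that part
  cancels. A holomorphic and an antiholomorphic function that nearly agree on the boundary both vary
  little inside; their values stay free, so only differences \<open>I z1 - I z0\<close> can be
  controlled. The obstacle is that an admissible kernel has no pole in the open strip. Poles
  therefore start outside it; since the estimate sees a kernel only off the band, they can then be
  moved through the band, which crosses the whole strip. Away from the graph a translate may miss
  the band altogether, and what is left is that neighbouring translates share boundary values.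
  Passing from one translate to the next therefore needs a uniqueness theorem for functions
  vanishing on a boundary arc. Analyticity of the curve enters through the finiteness of its
  vertical tangents; at other boundary points the curve is locally a graph over the real axis with
  \<open>D\<close> on exactly one side.\<close>

lemma contour_integral_linepath_integral_swap:
  fixes F :: "real \<Rightarrow> complex \<Rightarrow> complex"
  assumes "continuous_on (closed_segment p q \<times> {a..b}) (\<lambda>(z,t). F t z)"
  shows "contour_integral (linepath p q) (\<lambda>z. integral {a..b} (\<lambda>t. F t z))
         = integral {a..b} (\<lambda>t. contour_integral (linepath p q) (F t))"
proof -
  have seg: "linepath p q x \<in> closed_segment p q" if "x \<in> {0..1}" for x
    using that by (auto simp: linepath_in_path)
  have c: "continuous_on (cbox (0,a) (1,b)) (\<lambda>(x,t). F t (linepath p q x) * (q - p))"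
  proof -
    have "continuous_on (cbox (0,a) (1,b)) (\<lambda>xt. (\<lambda>(z,t). F t z) (linepath p q (fst xt), snd xt))"
      by (rule continuous_on_compose2[OF assms])
         (auto intro!: continuous_intros continuous_on_compose2[OF continuous_on_linepath] seg
               simp: cbox_Pair_eq)
    then show ?thesis
      by (auto intro!: continuous_intros simp: split_beta)
  qed
  have "contour_integral (linepath p q) (\<lambda>z. integral {a..b} (\<lambda>t. F t z))
      = integral {0..1} (\<lambda>x. integral {a..b} (\<lambda>t. F t (linepath p q x) * (q - p)))"
    by (simp add: contour_integral_integral mult.commute)
  also have "\<dots> = integral {a..b} (\<lambda>t. integral {0..1} (\<lambda>x. F t (linepath p q x) * (q - p)))"
    using integral_swap_continuous[OF c] by simp
  also have "\<dots> = integral {a..b} (\<lambda>t. contour_integral (linepath p q) (F t))"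
    by (simp add: contour_integral_integral mult.commute)
  finally show ?thesis .
qed

text \<open>Morera: integration over a triangle may be exchanged with integration over
  \<open>t\<close>, and each inner triangle integral vanishes by Cauchy's theorem.\<close>

lemma holomorphic_on_integral_param:
  fixes F :: "real \<Rightarrow> complex \<Rightarrow> complex"
  assumes "open D"
    and cont: "continuous_on (D \<times> {a..b}) (\<lambda>(z,t). F t z)"
    and hol: "\<And>t. t \<in> {a..b} \<Longrightarrow> F t holomorphic_on D"
  shows "(\<lambda>z. integral {a..b} (\<lambda>t. F t z)) holomorphic_on D"
proof -
  have contI: "continuous_on D (\<lambda>z. integral {a..b} (\<lambda>t. F t z))"
    using integral_continuous_on_param[of D a b "\<lambda>z t. F t z"] cont by simp
  have "(\<lambda>z. integral {a..b} (\<lambda>t. F t z)) analytic_on D"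
  proof (rule Morera_triangle[OF contI \<open>open D\<close>, rule_format])
    fix p q r :: complex
    assume sub: "convex hull {p,q,r} \<subseteq> D"
    have segs: "closed_segment p q \<subseteq> D" "closed_segment q r \<subseteq> D" "closed_segment r p \<subseteq> D"
      using sub by (auto simp: segment_convex_hull intro: subsetD[OF hull_mono, rotated])
    have sw: "contour_integral (linepath x y) (\<lambda>z. integral {a..b} (\<lambda>t. F t z))
         = integral {a..b} (\<lambda>t. contour_integral (linepath x y) (F t))"
      if "closed_segment x y \<subseteq> D" for x y
      by (rule contour_integral_linepath_integral_swap, rule continuous_on_subset[OF cont])
         (use that in auto)
    have int: "(\<lambda>t. contour_integral (linepath x y) (F t)) integrable_on {a..b}"
      if "closed_segment x y \<subseteq> D" for x y
    proof -
      have lp: "linepath x y u \<in> D" if "u \<in> {0..1}" for u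
        using that \<open>closed_segment x y \<subseteq> D\<close> linepath_in_path by blast
      have "continuous_on ({a..b} \<times> cbox 0 1) (\<lambda>tx. (\<lambda>(z,t). F t z) (linepath x y (snd tx), fst tx))"
        by (rule continuous_on_compose2[OF cont])
           (auto intro!: continuous_intros continuous_on_compose2[OF continuous_on_linepath] lp)
      then have "continuous_on ({a..b} \<times> cbox 0 1) (\<lambda>(t,u). F t (linepath x y u) * (y - x))"
        by (auto intro!: continuous_intros simp: split_beta)
      from integral_continuous_on_param[OF this]
      have "continuous_on {a..b} (\<lambda>t. contour_integral (linepath x y) (F t))"
        by (simp add: contour_integral_integral mult.commute)
      then show ?thesis by (rule integrable_continuous_real)
    qed
    have zero: "contour_integral (linepath p q) (F t) + contour_integral (linepath q r) (F t)
              + contour_integral (linepath r p) (F t) = 0" if t: "t \<in> {a..b}" for t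
    proof -
      have "(F t has_contour_integral 0) (linepath p q +++ linepath q r +++ linepath r p)"
        by (rule Cauchy_theorem_triangle) (rule holomorphic_on_subset[OF hol[OF t] sub])
      then show ?thesis by (rule has_chain_integral_chain_integral3)
    qed
    have "contour_integral (linepath p q) (\<lambda>z. integral {a..b} (\<lambda>t. F t z)) +
          contour_integral (linepath q r) (\<lambda>z. integral {a..b} (\<lambda>t. F t z)) +
          contour_integral (linepath r p) (\<lambda>z. integral {a..b} (\<lambda>t. F t z))
        = integral {a..b} (\<lambda>t. contour_integral (linepath p q) (F t)
             + contour_integral (linepath q r) (F t) + contour_integral (linepath r p) (F t))"
      using segs by (simp add: sw int integral_add integrable_add)
    also have "\<dots> = integral {a..b} (\<lambda>t. 0)"
      by (rule integral_cong) (use zero in auto)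
    finally show "contour_integral (linepath p q) (\<lambda>z. integral {a..b} (\<lambda>t. F t z)) +
          contour_integral (linepath q r) (\<lambda>z. integral {a..b} (\<lambda>t. F t z)) +
          contour_integral (linepath r p) (\<lambda>z. integral {a..b} (\<lambda>t. F t z)) = 0" by simp
  qed
  then show ?thesis by (rule analytic_imp_holomorphic)
qed

text \<open>Apply Cauchy's estimate to \<open>exp (h / \<epsilon>)\<close>, whose modulus lies between \<open>exp (-1)\<close> and \<open>exp 1\<close>.\<close>

lemma deriv_bound_of_bounded_Re:
  assumes "h holomorphic_on S" "open S" "cball z r \<subseteq> S" "r > 0" "\<epsilon> > 0"
    and Re: "\<And>z. z \<in> S \<Longrightarrow> \<bar>Re (h z)\<bar> \<le> \<epsilon>"
  shows "norm (deriv h z) \<le> exp 2 * \<epsilon> / r"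
proof -
  define k where "k = (\<lambda>z. exp (h z / of_real \<epsilon>))"
  have zS: "z \<in> S" using assms by auto
  have hz: "(h has_field_derivative deriv h z) (at z)"
    using assms(1,2) zS by (rule holomorphic_derivI)
  have dk: "deriv k z = exp (h z / of_real \<epsilon>) * (deriv h z / of_real \<epsilon>)"
    unfolding k_def using \<open>\<epsilon> > 0\<close>
    by (intro DERIV_imp_deriv) (auto intro!: derivative_eq_intros hz)
  have hk: "k holomorphic_on S"
    unfolding k_def by (intro holomorphic_intros assms(1)) (use \<open>\<epsilon> > 0\<close> in auto)
  have "norm ((deriv ^^ 1) k z) \<le> fact 1 * exp 1 / r ^ 1"
  proof (rule Cauchy_inequality)
    show "k holomorphic_on ball z r"
      by (rule holomorphic_on_subset[OF hk]) (use assms(3) ball_subset_cball in blast)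
    show "continuous_on (cball z r) k"
      by (rule continuous_on_subset[OF holomorphic_on_imp_continuous_on[OF hk] assms(3)])
    fix x assume "norm (z - x) = r"
    then have "x \<in> S" using assms(3) by (auto simp: dist_norm)
    with Re[of x] \<open>\<epsilon> > 0\<close> show "norm (k x) \<le> exp 1"
      by (auto simp: k_def divide_simps)
  qed (use assms in auto)
  then have "norm (deriv k z) \<le> exp 1 / r" by simp
  then have "exp (Re (h z) / \<epsilon>) * (norm (deriv h z) / \<epsilon>) \<le> exp 1 / r"
    using \<open>\<epsilon> > 0\<close> by (simp add: dk norm_mult norm_divide)
  moreover have "exp (-1) \<le> exp (Re (h z) / \<epsilon>)"
    using Re[OF zS] \<open>\<epsilon> > 0\<close> by (auto simp: divide_simps abs_if split: if_splits)
  ultimately have "exp (-1) * (norm (deriv h z) / \<epsilon>) \<le> exp 1 / r"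
    using \<open>\<epsilon> > 0\<close> by (smt (verit) mult_right_mono divide_nonneg_pos norm_ge_zero)
  then have "exp 1 * (exp (-1) * (norm (deriv h z) / \<epsilon>)) \<le> exp 1 * (exp 1 / r)"
    by (intro mult_left_mono) auto
  then have "norm (deriv h z) / \<epsilon> \<le> exp 2 / r"
    by (simp add: mult.assoc[symmetric] exp_add[symmetric])
  then show ?thesis using \<open>\<epsilon> > 0\<close> by (simp add: field_simps)
qed

text \<open>\<open>C\<close> depends on \<open>D\<close> and the two points but not on
  \<open>h\<close>: the derivative bound gives a Lipschitz estimate proportional to
  \<open>\<epsilon>\<close> on small discs, and such estimates add up along a chain of discs. A
  difference is the right quantity because \<open>h\<close> may be changed by an imaginary
  constant.\<close>

lemma oscillation_bound_of_bounded_Re: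
  assumes "open D" "connected D" "z0 \<in> D" "z1 \<in> D"
  obtains C where "C \<ge> 0"
    "\<And>h \<epsilon>. \<lbrakk>h holomorphic_on D; \<epsilon> > 0; \<And>z. z \<in> D \<Longrightarrow> \<bar>Re (h z)\<bar> \<le> \<epsilon>\<rbrakk>
       \<Longrightarrow> norm (h z1 - h z0) \<le> C * \<epsilon>"
proof -
  define R where "R x y \<longleftrightarrow> (\<exists>C\<ge>0. \<forall>h \<epsilon>. h holomorphic_on D \<longrightarrow> \<epsilon> > 0 \<longrightarrow> (\<forall>z\<in>D. \<bar>Re (h z)\<bar> \<le> \<epsilon>)
       \<longrightarrow> norm (h y - h x) \<le> C * \<epsilon>)" for x y
  have "R z0 z1"
  proof (rule connected_equivalence_relation[OF assms(2-4)])
    show "R y x" if "R x y" for x y using that by (simp add: R_def norm_minus_commute)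
    show "R x z" if xy: "R x y" and yz: "R y z" for x y z
    proof -
      obtain C1 where C1: "C1 \<ge> 0" "\<And>h \<epsilon>. h holomorphic_on D \<Longrightarrow> \<epsilon> > 0 \<Longrightarrow> (\<forall>z\<in>D. \<bar>Re (h z)\<bar> \<le> \<epsilon>)
            \<Longrightarrow> norm (h y - h x) \<le> C1 * \<epsilon>" using xy unfolding R_def by blast
      obtain C2 where C2: "C2 \<ge> 0" "\<And>h \<epsilon>. h holomorphic_on D \<Longrightarrow> \<epsilon> > 0 \<Longrightarrow> (\<forall>z\<in>D. \<bar>Re (h z)\<bar> \<le> \<epsilon>)
            \<Longrightarrow> norm (h z - h y) \<le> C2 * \<epsilon>" using yz unfolding R_def by blast
      have "norm (h z - h x) \<le> (C1 + C2) * \<epsilon>"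
        if "h holomorphic_on D" "\<epsilon> > 0" "\<forall>z\<in>D. \<bar>Re (h z)\<bar> \<le> \<epsilon>" for h \<epsilon>
        using norm_triangle_ineq[of "h z - h y" "h y - h x"] C1(2)[OF that] C2(2)[OF that]
        by (simp add: algebra_simps)
      then show ?thesis unfolding R_def using C1(1) C2(1) by (intro exI[of _ "C1 + C2"]) auto
    qed
    fix x assume "x \<in> D"
    then obtain r where r: "r > 0" "cball x r \<subseteq> D"
      using \<open>open D\<close> open_contains_cball by blast
    have cb: "cball y (r/2) \<subseteq> D" if "y \<in> ball x (r/2)" for y
    proof
      fix u assume "u \<in> cball y (r/2)"
      with that have "dist x u \<le> r" using dist_triangle[of x u y] by simp
      then show "u \<in> D" using r by auto
    qed
    have "R x y" if y: "y \<in> ball x (r/2)" for y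
    proof -
      have "norm (h y - h x) \<le> (exp 2 * 2 / r * norm (y - x)) * \<epsilon>"
        if h: "h holomorphic_on D" "\<epsilon> > 0" "\<forall>z\<in>D. \<bar>Re (h z)\<bar> \<le> \<epsilon>" for h \<epsilon>
      proof -
        have "norm (h y - h x) \<le> (exp 2 * \<epsilon> / (r/2)) * norm (y - x)"
        proof (rule field_differentiable_bound[of "ball x (r/2)" h "deriv h"])
          fix z assume z: "z \<in> ball x (r/2)"
          then have "z \<in> D" using cb[OF z] r by auto
          then show "(h has_field_derivative deriv h z) (at z within ball x (r/2))"
            using holomorphic_derivI[OF h(1) \<open>open D\<close>] by (meson has_field_derivative_at_within)
          show "norm (deriv h z) \<le> exp 2 * \<epsilon> / (r/2)"
            by (rule deriv_bound_of_bounded_Re[OF h(1) \<open>open D\<close> cb[OF z]]) (use r h in auto)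
        qed (use y r in auto)
        then show ?thesis by (simp add: mult_ac)
      qed
      then show ?thesis unfolding R_def using r by (intro exI[of _ "exp 2 * 2 / r * norm (y - x)"]) auto
    qed
    then show "\<exists>T. openin (top_of_set D) T \<and> x \<in> T \<and> (\<forall>y\<in>T. R x y)"
      using r by (intro exI[of _ "ball x (r/2)"])
        (auto intro!: open_subset subsetD[OF cb])
  qed
  then show ?thesis using that unfolding R_def by blast
qed

section \<open>Pole pushing and the Poisson kernel\<close>

text \<open>Expansion of the Cauchy kernel with pole \<open>w\<close> about a nearby pole
  \<open>u\<close>, with exact remainder. Large \<open>n\<close> serves to push poles,
  \<open>n = 2\<close> to differentiate the continued functional.\<close>

lemma geometric_remainder:
  fixes z w u :: "'a::field"
  assumes "z \<noteq> u" "z \<noteq> w"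
  shows "1 / (z - w) - (\<Sum>j<n. (w - u) ^ j / (z - u) ^ Suc j) = ((w - u) / (z - u)) ^ n / (z - w)"
proof (induction n)
  case (Suc n)
  have "(w - u) ^ n / (z - u) ^ Suc n = ((w - u) / (z - u)) ^ n * (1 / (z - u))"
    by (simp only: power_divide power_Suc2 times_divide_times_eq mult_1_right)
  then have "((w - u) / (z - u)) ^ n / (z - w) - (w - u) ^ n / (z - u) ^ Suc n
      = ((w - u) / (z - u)) ^ n * (1 / (z - w) - 1 / (z - u))"
    by (simp only: right_diff_distrib times_divide_eq_right mult_1_right)
  also have "1 / (z - w) - 1 / (z - u) = (w - u) / (z - u) / (z - w)"
    using assms by (simp add: divide_simps)
  finally show ?case using Suc by (simp add: algebra_simps)
qed simp

text \<open>Pole pushing: the set of \<open>w\<close> for which division by \<open>z - w\<close> preserves the uniform closure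
  of \<open>A\<close> on \<open>E\<close> is open and closed in \<open>B\<close>. Hence the functional, extended to that closure,
  can be evaluated at the Cauchy kernel with any pole in \<open>B\<close>.\<close>

lemma Cauchy_kernel_continuation:
  fixes A :: "(complex \<Rightarrow> complex) set" and \<Phi> :: "(complex \<Rightarrow> complex) \<Rightarrow> complex"
  assumes A_lin: "\<And>p q c. \<lbrakk>p \<in> A; q \<in> A\<rbrakk> \<Longrightarrow> (\<lambda>z. p z + c * q z) \<in> A"
    and \<Phi>_lin: "\<And>p q c. \<lbrakk>p \<in> A; q \<in> A\<rbrakk> \<Longrightarrow> \<Phi> (\<lambda>z. p z + c * q z) = \<Phi> p + c * \<Phi> q"
    and C: "C \<ge> 0"
    and bound: "\<And>p m. \<lbrakk>p \<in> A; m > 0; \<And>z. z \<in> E \<Longrightarrow> norm (p z) \<le> m\<rbrakk> \<Longrightarrow> norm (\<Phi> p) \<le> C * m"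
    and A_one: "(\<lambda>_. 1) \<in> A"
    and A_div: "\<And>p w. \<lbrakk>p \<in> A; w \<in> W\<rbrakk> \<Longrightarrow> (\<lambda>z. p z / (z - w)) \<in> A"
    and E: "closed E" "E \<noteq> {}" and B: "open B" "connected B" "B \<inter> E = {}" "W \<inter> B \<noteq> {}"
  obtains X where "X holomorphic_on B" "\<And>w. w \<in> W \<inter> B \<Longrightarrow> X w = \<Phi> (\<lambda>z. 1 / (z - w))"
proof -
  \<comment> \<open>The uniform closure of \<open>A\<close> on \<open>E\<close>. Boundedness is part
    of it because the geometric tail is estimated by a bound for \<open>q\<close>.\<close>
  define \<G> where "\<G> = {q. (\<exists>m. \<forall>z\<in>E. norm (q z) \<le> m) \<and> (\<forall>\<epsilon>>0. \<exists>p\<in>A. \<forall>z\<in>E. norm (p z - q z) \<le> \<epsilon>)}"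
  define d where "d w = infdist w E" for w
  have d_pos: "d w > 0" if "w \<in> B" for w
    unfolding d_def by (intro infdist_pos_not_in_closed E) (use that B(3) in blast)
  have d_le: "d w \<le> norm (z - w)" if "z \<in> E" for z w
    using infdist_le[OF that, of w] by (simp add: d_def dist_norm norm_minus_commute)
  have d_tri: "d w \<le> d u + norm (w - u)" for w u
    using infdist_triangle[of w E u] by (simp add: d_def dist_norm)

  have G_approx: "\<exists>p\<in>A. \<forall>z\<in>E. norm (p z - q z) \<le> \<epsilon>" if "q \<in> \<G>" "\<epsilon> > 0" for q \<epsilon>
    using that unfolding \<G>_def by simp
  have G_bounded: "\<exists>m. \<forall>z\<in>E. norm (q z) \<le> m" if "q \<in> \<G>" for q
    using that unfolding \<G>_def by simp

  have one_G: "(\<lambda>_. 1) \<in> \<G>"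
    unfolding \<G>_def using A_one by (auto intro!: exI[of _ 1] bexI[of _ "\<lambda>_. 1"])
  have G_lin: "(\<lambda>z. q z + c * r z) \<in> \<G>" if q: "q \<in> \<G>" and r: "r \<in> \<G>" for q r c
  proof -
    obtain m1 where m1: "\<And>z. z \<in> E \<Longrightarrow> norm (q z) \<le> m1" using G_bounded[OF q] by blast
    obtain m2 where m2: "\<And>z. z \<in> E \<Longrightarrow> norm (r z) \<le> m2" using G_bounded[OF r] by blast
    have "norm (q z + c * r z) \<le> m1 + norm c * m2" if "z \<in> E" for z
      by (rule norm_triangle_le) (use m1[OF that] m2[OF that] in \<open>simp add: norm_mult add_mono mult_left_mono\<close>)
    moreover have "\<exists>p\<in>A. \<forall>z\<in>E. norm (p z - (q z + c * r z)) \<le> \<epsilon>" if "\<epsilon> > 0" for \<epsilon>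
    proof -
      have "\<epsilon>/2 > 0" "\<epsilon> / (2 * (1 + norm c)) > 0" using that by (auto intro!: divide_pos_pos add_pos_nonneg)
      from G_approx[OF q this(1)] G_approx[OF r this(2)] obtain p1 p2
        where p: "p1 \<in> A" "p2 \<in> A" "\<And>z. z \<in> E \<Longrightarrow> norm (p1 z - q z) \<le> \<epsilon>/2"
          "\<And>z. z \<in> E \<Longrightarrow> norm (p2 z - r z) \<le> \<epsilon> / (2 * (1 + norm c))"
        by blast
      have "norm ((p1 z + c * p2 z) - (q z + c * r z)) \<le> \<epsilon>" if z: "z \<in> E" for z
      proof -
        have "norm c * norm (p2 z - r z) \<le> (1 + norm c) * (\<epsilon> / (2 * (1 + norm c)))"
          by (rule mult_mono) (use p(4)[OF z] in auto)
        also have "\<dots> = \<epsilon>/2" by (simp add: field_simps add_nonneg_eq_0_iff)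
        finally have "norm (c * (p2 z - r z)) \<le> \<epsilon>/2" by (simp add: norm_mult)
        then have "norm ((p1 z - q z) + c * (p2 z - r z)) \<le> \<epsilon>"
          using p(3)[OF z] norm_triangle_le[of "p1 z - q z" "c * (p2 z - r z)" \<epsilon>] by linarith
        then show ?thesis by (simp add: algebra_simps)
      qed
      then show ?thesis by (intro bexI[OF _ A_lin[OF p(1,2), of c]] ballI)
    qed
    ultimately show ?thesis unfolding \<G>_def by blast
  qed
  have G_closed: "q \<in> \<G>" if lim: "\<And>\<epsilon>. \<epsilon> > 0 \<Longrightarrow> \<exists>r\<in>\<G>. \<forall>z\<in>E. norm (r z - q z) \<le> \<epsilon>" for q
  proof -
    obtain r m where "\<And>z. z \<in> E \<Longrightarrow> norm (r z - q z) \<le> 1" "\<And>z. z \<in> E \<Longrightarrow> norm (r z) \<le> m"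
      using lim[of 1] G_bounded by force
    then have "norm (q z) \<le> m + 1" if "z \<in> E" for z
      using that norm_triangle_ineq3[of "q z" "r z"] by (smt (verit) norm_minus_commute)
    moreover have "\<exists>p\<in>A. \<forall>z\<in>E. norm (p z - q z) \<le> \<epsilon>" if "\<epsilon> > 0" for \<epsilon>
    proof -
      obtain r where r: "r \<in> \<G>" "\<And>z. z \<in> E \<Longrightarrow> norm (r z - q z) \<le> \<epsilon>/2"
        using \<open>\<epsilon> > 0\<close> lim[of "\<epsilon>/2"] by auto
      then obtain p where p: "p \<in> A" "\<And>z. z \<in> E \<Longrightarrow> norm (p z - r z) \<le> \<epsilon>/2"
        using G_approx[OF r(1), of "\<epsilon>/2"] \<open>\<epsilon> > 0\<close> by auto
      have "norm (p z - q z) \<le> \<epsilon>" if "z \<in> E" for z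
        using norm_triangle_ineq[of "p z - r z" "r z - q z"] p(2)[OF that] r(2)[OF that] by simp
      then show ?thesis by (intro bexI[OF _ p(1)] ballI)
    qed
    ultimately show ?thesis unfolding \<G>_def by blast
  qed
  \<comment> \<open>Quantifying over all \<open>q\<close> in the closure makes the division
    repeatable, so that all powers of \<open>1 / (z - u)\<close> become available.\<close>
  define U where "U = {w\<in>B. \<forall>q\<in>\<G>. (\<lambda>z. q z / (z - w)) \<in> \<G>}"
  have U_div: "(\<lambda>z. q z / (z - w)) \<in> \<G>" if "w \<in> U" "q \<in> \<G>" for w q
    using that unfolding U_def by simp
  have U_W: "w \<in> U" if w: "w \<in> W" "w \<in> B" for w
  proof -
    have "(\<lambda>z. q z / (z - w)) \<in> \<G>" if q: "q \<in> \<G>" for q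
    proof -
      obtain m where m: "\<And>z. z \<in> E \<Longrightarrow> norm (q z) \<le> m" using G_bounded[OF q] by blast
      have "norm (q z / (z - w)) \<le> m / d w" if "z \<in> E" for z
        unfolding norm_divide by (rule frac_le) (use order_trans[OF norm_ge_zero m[OF that]] m[OF that] d_le[OF that] d_pos[OF w(2)] in auto)
      moreover have "\<exists>p\<in>A. \<forall>z\<in>E. norm (p z - q z / (z - w)) \<le> \<epsilon>" if "\<epsilon> > 0" for \<epsilon>
      proof -
        obtain p where p: "p \<in> A" "\<And>z. z \<in> E \<Longrightarrow> norm (p z - q z) \<le> \<epsilon> * d w"
          using G_approx[OF q, of "\<epsilon> * d w"] d_pos[OF w(2)] \<open>\<epsilon> > 0\<close> by auto
        have "norm (p z / (z - w) - q z / (z - w)) \<le> \<epsilon>" if "z \<in> E" for z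
        proof -
          have "norm ((p z - q z) / (z - w)) \<le> (\<epsilon> * d w) / d w"
            unfolding norm_divide
            by (rule frac_le) (use p(2)[OF that] d_le[OF that] d_pos[OF w(2)] \<open>\<epsilon> > 0\<close> in auto)
          then show ?thesis using d_pos[OF w(2)] by (simp add: diff_divide_distrib)
        qed
        then show ?thesis by (intro bexI[OF _ A_div[OF p(1) w(1)]] ballI)
      qed
      ultimately show ?thesis unfolding \<G>_def by blast
    qed
    then show ?thesis using w unfolding U_def by blast
  qed
  \<comment> \<open>On \<open>E\<close> one has \<open>norm (z - u) \<ge> d u\<close>, so the ratio
    of the expansion about \<open>u\<close> is at most 1/2, while
    \<open>norm (z - w) \<ge> d u / 2\<close> controls the remainder.\<close>
  have U_step: "w \<in> U" if u: "u \<in> U" and w: "w \<in> B" and wu: "norm (w - u) \<le> d u / 2" for u w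
  proof -
    have uB: "u \<in> B" using u U_def by simp
    note du = d_pos[OF uB]
    have "(\<lambda>z. q z / (z - w)) \<in> \<G>" if q: "q \<in> \<G>" for q
    proof -
      obtain m where m: "\<And>z. z \<in> E \<Longrightarrow> norm (q z) \<le> m" using G_bounded[OF q] by blast
      have pow: "(\<lambda>z. q z / (z - u) ^ j) \<in> \<G>" for j
      proof (induction j)
        case (Suc j)
        have "(\<lambda>z. q z / (z - u) ^ j / (z - u)) \<in> \<G>" by (rule U_div[OF u Suc])
        then show ?case by (simp add: mult.commute)
      qed (use q in simp)
      have sums: "(\<lambda>z. \<Sum>j<n. (w - u) ^ j * (q z / (z - u) ^ Suc j)) \<in> \<G>" for n
      proof (induction n)
        case 0
        have "(\<lambda>z. q z + (-1) * q z) \<in> \<G>" by (rule G_lin[OF q q])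
        then show ?case by simp
      next
        case (Suc n)
        from G_lin[OF Suc pow[of "Suc n"], of "(w - u) ^ n"] show ?case by simp
      qed
      show ?thesis
      proof (rule G_closed)
        fix \<epsilon> :: real assume "\<epsilon> > 0"
        define M where "M = max m 1 * (2 / d u)"
        have M: "M > 0" using du by (simp add: M_def)
        obtain n where n: "(1/2) ^ n < \<epsilon> / M"
          using real_arch_pow_inv[of "\<epsilon> / M" "1/2"] \<open>\<epsilon> > 0\<close> M by auto
        have "norm ((\<Sum>j<n. (w - u) ^ j * (q z / (z - u) ^ Suc j)) - q z / (z - w)) \<le> \<epsilon>" if z: "z \<in> E" for z
        proof -
          have zu: "norm (z - u) \<ge> d u" by (rule d_le[OF z])
          have "norm (z - u) \<le> norm (z - w) + norm (w - u)"
            using norm_triangle_ineq[of "z - w" "w - u"] by simp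
          then have zw: "norm (z - w) \<ge> d u / 2" using zu wu by linarith
          have ne: "z \<noteq> u" "z \<noteq> w" using zu zw du by auto
          have "(\<Sum>j<n. (w - u) ^ j * (q z / (z - u) ^ Suc j)) - q z / (z - w)
               = - q z * (1 / (z - w) - (\<Sum>j<n. (w - u) ^ j / (z - u) ^ Suc j))"
            by (simp add: right_diff_distrib sum_distrib_left sum_negf mult_ac)
          also have "\<dots> = - q z * (((w - u) / (z - u)) ^ n / (z - w))"
            by (simp only: geometric_remainder[OF ne])
          finally have "norm ((\<Sum>j<n. (w - u) ^ j * (q z / (z - u) ^ Suc j)) - q z / (z - w))
               = norm (q z) * ((norm (w - u) / norm (z - u)) ^ n / norm (z - w))"
            by (simp add: norm_mult norm_divide norm_power)
          also have "\<dots> \<le> max m 1 * ((1/2) ^ n / (d u / 2))"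
          proof -
            have "norm (w - u) / norm (z - u) \<le> 1/2"
              using wu zu du by (simp add: divide_simps)
            then have "(norm (w - u) / norm (z - u)) ^ n \<le> (1/2) ^ n"
              by (rule power_mono) simp
            then have "(norm (w - u) / norm (z - u)) ^ n / norm (z - w) \<le> (1/2) ^ n / (d u / 2)"
              by (rule frac_le[rotated]) (use zw du in auto)
            then show ?thesis
              by (rule mult_mono[rotated]) (use m[OF z] in auto)
          qed
          also have "\<dots> = (1/2) ^ n * M" by (simp add: M_def mult_ac)
          also have "\<dots> \<le> \<epsilon>" using n M by (simp add: field_simps)
          finally show ?thesis .
        qed
        then show "\<exists>r\<in>\<G>. \<forall>z\<in>E. norm (r z - q z / (z - w)) \<le> \<epsilon>" by (intro bexI[OF _ sums[of n]] ballI)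
      qed
    qed
    then show ?thesis using w unfolding U_def by blast
  qed
  have U_B: "w \<in> U" if w: "w \<in> B" for w
  proof -
    obtain w0 where w0: "w0 \<in> W" "w0 \<in> B" using B(4) by auto
    have "w0 \<in> U \<longleftrightarrow> w \<in> U"
    proof (rule connected_equivalence_relation[OF B(2) w0(2) w])
      fix u assume u: "u \<in> B"
      \<comment> \<open>The radius \<open>d u / 4\<close> makes the step reversible:
        \<open>d v\<close> is then at least three quarters of \<open>d u\<close>, so
        \<open>u\<close> is within \<open>d v / 2\<close> of \<open>v\<close>.\<close>
      define T where "T = B \<inter> ball u (d u / 4)"
      have "u \<in> U \<longleftrightarrow> v \<in> U" if "v \<in> T" for v
      proof -
        have v: "v \<in> B" "norm (u - v) < d u / 4" using that by (auto simp: T_def dist_norm)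
        have "d u \<le> d v + norm (u - v)" by (rule d_tri)
        then have "norm (u - v) \<le> d v / 2" using v norm_ge_zero[of "u - v"] by linarith
        moreover have "norm (v - u) \<le> d u / 2" using v d_pos[OF u] by (simp add: norm_minus_commute)
        ultimately show ?thesis using U_step u v by blast
      qed
      moreover have "openin (top_of_set B) T" unfolding T_def by (simp add: openin_open_Int)
      moreover have "u \<in> T" using u d_pos[OF u] by (simp add: T_def)
      ultimately show "\<exists>T. openin (top_of_set B) T \<and> u \<in> T \<and> (\<forall>x\<in>T. (u \<in> U) = (x \<in> U))" by blast
    qed auto
    then show ?thesis using U_W w0 by blast
  qed

  \<comment> \<open>Approximants with error \<open>1 / (n + 1)\<close> on \<open>E\<close>. By
    \<open>bound\<close> their images under \<open>\<Phi>\<close> form a Cauchy sequence, whose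
    limit extends \<open>\<Phi>\<close> to the closure.\<close>
  define P where "P q n = (SOME p. p \<in> A \<and> (\<forall>z\<in>E. norm (p z - q z) \<le> 1 / real (Suc n)))" for q n
  have P: "P q n \<in> A" "\<And>z. z \<in> E \<Longrightarrow> norm (P q n z - q z) \<le> 1 / real (Suc n)" if "q \<in> \<G>" for q n
  proof -
    have "\<exists>p. p \<in> A \<and> (\<forall>z\<in>E. norm (p z - q z) \<le> 1 / real (Suc n))"
      using G_approx[OF that, of "1 / real (Suc n)"] by auto
    from someI_ex[OF this] show "P q n \<in> A" "\<And>z. z \<in> E \<Longrightarrow> norm (P q n z - q z) \<le> 1 / real (Suc n)"
      unfolding P_def by blast+
  qed
  define \<Lambda> where "\<Lambda> q = lim (\<lambda>n. \<Phi> (P q n))" for q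
  have \<Phi>_diff: "norm (\<Phi> p - \<Phi> q) \<le> C * m"
    if "p \<in> A" "q \<in> A" "m > 0" "\<And>z. z \<in> E \<Longrightarrow> norm (p z - q z) \<le> m" for p q m
  proof -
    have "norm (\<Phi> (\<lambda>z. p z + (-1) * q z)) \<le> C * m"
      by (rule bound[OF A_lin]) (use that in auto)
    then show ?thesis using \<Phi>_lin[OF that(1,2), of "-1"] by simp
  qed
  have inv0: "(\<lambda>n. K * (1 / real (Suc n))) \<longlonglongrightarrow> 0" for K
    using tendsto_mult_right_zero[OF LIMSEQ_inverse_real_of_nat, of K] by (simp add: divide_inverse)
  have \<Lambda>: "(\<lambda>n. \<Phi> (P q n)) \<longlonglongrightarrow> \<Lambda> q" if q: "q \<in> \<G>" for q
  proof -
    have "Cauchy (\<lambda>n. \<Phi> (P q n))"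
    proof (rule metric_CauchyI)
      fix e :: real assume "e > 0"
      then obtain N where N: "C * 2 * (1 / real (Suc N)) < e"
        using order_tendstoD(2)[OF inv0[of "C * 2"]] unfolding eventually_sequentially by blast
      have "dist (\<Phi> (P q n)) (\<Phi> (P q k)) < e" if nk: "n \<ge> N" "k \<ge> N" for n k
      proof -
        have "1 / real (Suc n) \<le> 1 / real (Suc N)" "1 / real (Suc k) \<le> 1 / real (Suc N)"
          using nk by (auto intro!: divide_left_mono)
        then have "norm (P q n z - P q k z) \<le> 2 * (1 / real (Suc N))" if "z \<in> E" for z
          using P(2)[OF q that, of n] P(2)[OF q that, of k]
            norm_triangle_ineq4[of "P q n z - q z" "P q k z - q z"] by simp
        then have "norm (\<Phi> (P q n) - \<Phi> (P q k)) \<le> C * (2 * (1 / real (Suc N)))"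
          by (intro \<Phi>_diff P(1) q) auto
        then show ?thesis using N by (simp add: dist_norm mult.assoc)
      qed
      then show "\<exists>M. \<forall>m\<ge>M. \<forall>n\<ge>M. dist (\<Phi> (P q m)) (\<Phi> (P q n)) < e" by blast
    qed
    then show ?thesis unfolding \<Lambda>_def by (simp add: Cauchy_convergent_iff convergent_LIMSEQ_iff)
  qed
  have \<Lambda>_A: "\<Lambda> q = \<Phi> q" if q: "q \<in> \<G>" "q \<in> A" for q
  proof -
    have "norm (\<Phi> (P q n) - \<Phi> q) \<le> C * (1 / real (Suc n))" for n
      by (rule \<Phi>_diff) (use P[OF q(1)] q in auto)
    then have "(\<lambda>n. \<Phi> (P q n) - \<Phi> q) \<longlonglongrightarrow> 0"
      by (intro Lim_null_comparison[OF _ inv0[of C]]) auto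
    then have "(\<lambda>n. \<Phi> (P q n)) \<longlonglongrightarrow> \<Phi> q" by (simp add: LIM_zero_iff)
    then show ?thesis using \<Lambda>[OF q(1)] LIMSEQ_unique by blast
  qed
  \<comment> \<open>Three terms at once, because the use is the second-order remainder of the
    kernel: the kernel at \<open>w\<close>, the kernel at \<open>u\<close> and the squared kernel at
    \<open>u\<close>. The bound \<open>m\<close> may be 0, as happens for
    \<open>w = u\<close>.\<close>
  have \<Lambda>_bound: "norm (\<Lambda> q1 + c2 * \<Lambda> q2 + c3 * \<Lambda> q3) \<le> C * m"
    if q: "q1 \<in> \<G>" "q2 \<in> \<G>" "q3 \<in> \<G>" and m: "m \<ge> 0" "\<And>z. z \<in> E \<Longrightarrow> norm (q1 z + c2 * q2 z + c3 * q3 z) \<le> m"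
    for q1 q2 q3 c2 c3 m
  proof -
    define K where "K = 1 + norm c2 + norm c3"
    have K: "K > 0" by (simp add: K_def add_pos_nonneg)
    have "norm (\<Phi> (P q1 n) + c2 * \<Phi> (P q2 n) + c3 * \<Phi> (P q3 n)) \<le> C * (m + K * (1 / real (Suc n)))" for n
    proof -
      let ?r = "1 / real (Suc n)"
      have A2: "(\<lambda>z. P q1 n z + c2 * P q2 n z) \<in> A" by (intro A_lin P(1) q)
      have "norm (\<Phi> (\<lambda>z. (P q1 n z + c2 * P q2 n z) + c3 * P q3 n z)) \<le> C * (m + K * ?r)"
      proof (rule bound)
        show "(\<lambda>z. (P q1 n z + c2 * P q2 n z) + c3 * P q3 n z) \<in> A" by (intro A_lin P(1) q)
        show "m + K * ?r > 0" using m K by (intro add_nonneg_pos) auto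
        fix z assume z: "z \<in> E"
        have a: "norm (P q1 n z - q1 z) \<le> ?r" by (rule P(2)[OF q(1) z])
        have b: "norm (c2 * (P q2 n z - q2 z)) \<le> norm c2 * ?r"
          unfolding norm_mult by (rule mult_left_mono[OF P(2)[OF q(2) z]]) simp
        have c: "norm (c3 * (P q3 n z - q3 z)) \<le> norm c3 * ?r"
          unfolding norm_mult by (rule mult_left_mono[OF P(2)[OF q(3) z]]) simp
        have "P q1 n z + c2 * P q2 n z + c3 * P q3 n z
            = (q1 z + c2 * q2 z + c3 * q3 z) + ((P q1 n z - q1 z) + (c2 * (P q2 n z - q2 z) + c3 * (P q3 n z - q3 z)))"
          by (simp add: algebra_simps)
        also have "norm \<dots> \<le> m + (?r + (norm c2 * ?r + norm c3 * ?r))"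
          by (intro norm_triangle_mono m(2)[OF z] a b c)
        finally show "norm (P q1 n z + c2 * P q2 n z + c3 * P q3 n z) \<le> m + K * ?r"
          by (simp add: K_def algebra_simps add_divide_distrib)
      qed
      then show ?thesis by (simp add: \<Phi>_lin[OF A2 P(1)[OF q(3)]] \<Phi>_lin[OF P(1)[OF q(1)] P(1)[OF q(2)]])
    qed
    moreover have "(\<lambda>n. norm (\<Phi> (P q1 n) + c2 * \<Phi> (P q2 n) + c3 * \<Phi> (P q3 n)))
        \<longlonglongrightarrow> norm (\<Lambda> q1 + c2 * \<Lambda> q2 + c3 * \<Lambda> q3)"
      by (intro tendsto_intros \<Lambda> q)
    moreover have "(\<lambda>n. C * (m + K * (1 / real (Suc n)))) \<longlonglongrightarrow> C * (m + 0)"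
      by (intro tendsto_intros inv0)
    ultimately show ?thesis by (intro LIMSEQ_le[of _ _ _ "C * m"]) auto
  qed

  define X where "X w = \<Lambda> (\<lambda>z. 1 / (z - w))" for w
  have k1: "(\<lambda>z. 1 / (z - w)) \<in> \<G>" if "w \<in> B" for w
    by (rule U_div[OF U_B[OF that] one_G])
  have k2: "(\<lambda>z. 1 / (z - w) / (z - w)) \<in> \<G>" if "w \<in> B" for w
    by (rule U_div[OF U_B[OF that] k1[OF that]])
  have "X holomorphic_on B"
    unfolding holomorphic_on_open[OF B(1)]
  proof
    fix u assume u: "u \<in> B"
    \<comment> \<open>The derivative of \<open>1 / (z - w)\<close> in \<open>w\<close> is the
      squared kernel, so this is the expected derivative of \<open>X\<close>.\<close>
    let ?L = "\<Lambda> (\<lambda>z. 1 / (z - u) / (z - u))"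
    obtain r where r: "r > 0" "ball u r \<subseteq> B" using B(1) u openE by blast
    define \<rho> where "\<rho> = min r (d u / 2)"
    have \<rho>: "\<rho> > 0" using r d_pos[OF u] by (simp add: \<rho>_def)
    \<comment> \<open>From the remainder for \<open>n = 2\<close>: a factor \<open>1 / d u\<close>
      squared from \<open>z - u\<close>, and \<open>2 / d u\<close> from
      \<open>z - w\<close>.\<close>
    define K where "K = 2 / (d u) ^ 3"
    have K: "K \<ge> 0" using d_pos[OF u] by (simp add: K_def)
    have est: "norm (X w - X u - (w - u) * ?L) \<le> C * (K * norm (w - u) ^ 2)" if w: "w \<in> ball u \<rho>" for w
    proof -
      have wB: "w \<in> B" and wu: "norm (w - u) \<le> d u / 2"
        using w r by (auto simp: \<rho>_def dist_norm norm_minus_commute)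
      have "norm (\<Lambda> (\<lambda>z. 1 / (z - w)) + (-1) * \<Lambda> (\<lambda>z. 1 / (z - u)) + (-(w - u)) * ?L) \<le> C * (K * norm (w - u) ^ 2)"
      proof (rule \<Lambda>_bound[OF k1[OF wB] k1[OF u] k2[OF u]])
        fix z assume z: "z \<in> E"
        have zu: "norm (z - u) \<ge> d u" by (rule d_le[OF z])
        have "norm (z - u) \<le> norm (z - w) + norm (w - u)"
          using norm_triangle_ineq[of "z - w" "w - u"] by simp
        then have zw: "norm (z - w) \<ge> d u / 2" using zu wu by linarith
        have ne: "z \<noteq> u" "z \<noteq> w" using zu zw d_pos[OF u] by auto
        have "1 / (z - w) + -1 * (1 / (z - u)) + - (w - u) * (1 / (z - u) / (z - u))
            = ((w - u) / (z - u)) ^ 2 / (z - w)"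
        proof -
          have alg: "x + -1 * y + - v * t = x - (y + v * t)" for x y v t :: complex by simp
          have "1 / (z - w) - (1 / (z - u) + (w - u) * (1 / (z - u) / (z - u))) = ((w - u) / (z - u)) ^ 2 / (z - w)"
            using geometric_remainder[OF ne, of 2] by (simp add: numeral_2_eq_2)
          then show ?thesis unfolding alg .
        qed
        then have "norm (1 / (z - w) + -1 * (1 / (z - u)) + - (w - u) * (1 / (z - u) / (z - u)))
            = (norm (w - u) / norm (z - u)) ^ 2 / norm (z - w)"
          by (simp only: norm_divide norm_power)
        also have "\<dots> \<le> (norm (w - u) / d u) ^ 2 / (d u / 2)"
          by (intro frac_le power_mono divide_left_mono) (use zu zw d_pos[OF u] in \<open>auto intro!: mult_pos_pos\<close>)
        also have "\<dots> = K * norm (w - u) ^ 2"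
          by (simp add: K_def power_divide power3_eq_cube power2_eq_square)
        finally show "norm (1 / (z - w) + -1 * (1 / (z - u)) + - (w - u) * (1 / (z - u) / (z - u))) \<le> K * norm (w - u) ^ 2" .
      qed (use K in auto)
      then show ?thesis by (simp only: X_def mult_minus_left mult_1_left diff_conv_add_uminus)
    qed
    have "((\<lambda>w. (X w - X u) / (w - u) - ?L) \<longlongrightarrow> 0) (at u)"
    proof (rule Lim_null_comparison[where g = "\<lambda>w. C * K * norm (w - u)"])
      show "\<forall>\<^sub>F w in at u. norm ((X w - X u) / (w - u) - ?L) \<le> C * K * norm (w - u)"
        unfolding eventually_at
      proof (intro exI[of _ \<rho>] conjI ballI impI \<rho>)
        fix w assume "w \<noteq> u \<and> dist w u < \<rho>"
        then have w: "w \<noteq> u" "w \<in> ball u \<rho>" by (auto simp: dist_commute)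
        have "(X w - X u) / (w - u) - ?L = (X w - X u - (w - u) * ?L) / (w - u)"
          using w by (simp add: field_simps)
        then have "norm ((X w - X u) / (w - u) - ?L) = norm (X w - X u - (w - u) * ?L) / norm (w - u)"
          by (simp only: norm_divide)
        also have "\<dots> \<le> C * (K * norm (w - u) ^ 2) / norm (w - u)"
          by (rule divide_right_mono[OF est[OF w(2)]]) simp
        also have "\<dots> = C * K * norm (w - u)" using w by (simp add: power2_eq_square)
        finally show "norm ((X w - X u) / (w - u) - ?L) \<le> C * K * norm (w - u)" .
      qed
      show "((\<lambda>w. C * K * norm (w - u)) \<longlongrightarrow> 0) (at u)"
        by (rule tendsto_eq_intros refl | simp)+
    qed
    then have "(X has_field_derivative ?L) (at u)"
      by (simp add: has_field_derivative_iff LIM_zero_iff)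
    then show "\<exists>f'. (X has_field_derivative f') (at u)" by blast
  qed
  moreover have "X w = \<Phi> (\<lambda>z. 1 / (z - w))" if "w \<in> W \<inter> B" for w
    unfolding X_def using that by (intro \<Lambda>_A k1 A_div[OF A_one]) auto
  ultimately show ?thesis using that by blast
qed

section \<open>Boundary behaviour of Cauchy integrals on a segment\<close>

text \<open>The kernel is \<open>2 * pi\<close> times the Poisson kernel of the half-plane at height
  \<open>\<epsilon>\<close>. Its mass, found from the primitive
  \<open>2 * arctan ((t - \<tau>) / \<epsilon>)\<close>, tends to \<open>2 * pi\<close> because
  \<open>\<tau>\<close> is interior, and it concentrates at \<open>\<tau>\<close>.\<close>

lemma Poisson_kernel_limit:
  fixes g :: "real \<Rightarrow> complex"
  assumes g: "continuous_on {a..b} g" and \<tau>: "a < \<tau>" "\<tau> < b"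
  shows "((\<lambda>\<epsilon>. integral {a..b} (\<lambda>t. g t * of_real (2 * \<epsilon> / ((t - \<tau>)\<^sup>2 + \<epsilon>\<^sup>2)))) \<longlongrightarrow> 2 * pi * g \<tau>) (at_right 0)"
proof -
  define K where "K \<epsilon> t = 2 * \<epsilon> / ((t - \<tau>)\<^sup>2 + \<epsilon>\<^sup>2)" for \<epsilon> t :: real
  have Kpos: "K \<epsilon> t \<ge> 0" if "\<epsilon> > 0" for \<epsilon> t using that by (simp add: K_def)
  have contK: "continuous_on S (K \<epsilon>)" if "\<epsilon> > 0" for \<epsilon> S
    unfolding K_def using that
    by (intro continuous_intros ballI) (auto simp: add_nonneg_eq_0_iff)
  have intK: "(K \<epsilon> has_integral 2 * arctan ((b - \<tau>) / \<epsilon>) - 2 * arctan ((a - \<tau>) / \<epsilon>)) {a..b}" if "\<epsilon> > 0" for \<epsilon>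
  proof (rule fundamental_theorem_of_calculus)
    fix t
    have "((\<lambda>t. 2 * arctan ((t - \<tau>) / \<epsilon>)) has_real_derivative K \<epsilon> t) (at t within {a..b})"
      using that by (auto intro!: derivative_eq_intros simp: K_def field_simps power2_eq_square add_nonneg_eq_0_iff)
    then show "((\<lambda>t. 2 * arctan ((t - \<tau>) / \<epsilon>)) has_vector_derivative K \<epsilon> t) (at t within {a..b})"
      by (simp add: has_real_derivative_iff_has_vector_derivative)
  qed (use \<tau> in simp)
  have lim1: "((\<lambda>\<epsilon>. 2 * arctan ((b - \<tau>) / \<epsilon>) - 2 * arctan ((a - \<tau>) / \<epsilon>)) \<longlongrightarrow> 2 * (pi/2) - 2 * (- pi/2)) (at_right 0)"
  proof (intro tendsto_intros)
    have inf: "filterlim (\<lambda>\<epsilon>::real. inverse \<epsilon>) at_top (at_right 0)" by (rule filterlim_inverse_at_top_right)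
    have "filterlim (\<lambda>\<epsilon>. (b - \<tau>) * inverse \<epsilon>) at_top (at_right 0)"
      by (rule filterlim_tendsto_pos_mult_at_top[OF tendsto_const _ inf]) (use \<tau> in simp)
    then show "((\<lambda>\<epsilon>. arctan ((b - \<tau>) / \<epsilon>)) \<longlongrightarrow> pi/2) (at_right 0)"
      unfolding divide_inverse by (rule filterlim_compose[OF tendsto_arctan_at_top[unfolded divide_inverse]])
    have "filterlim (\<lambda>\<epsilon>. (a - \<tau>) * inverse \<epsilon>) at_bot (at_right 0)"
      by (rule filterlim_tendsto_neg_mult_at_bot[OF tendsto_const _ inf]) (use \<tau> in simp)
    then show "((\<lambda>\<epsilon>. arctan ((a - \<tau>) / \<epsilon>)) \<longlongrightarrow> - pi/2) (at_right 0)"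
      using filterlim_compose[OF tendsto_arctan_at_bot] unfolding divide_inverse by fastforce
  qed
  have main: "((\<lambda>\<epsilon>. integral {a..b} (\<lambda>t. g \<tau> * of_real (K \<epsilon> t))) \<longlongrightarrow> g \<tau> * (2 * pi)) (at_right 0)"
  proof -
    have ev: "\<forall>\<^sub>F \<epsilon> in at_right 0. g \<tau> * of_real (2 * arctan ((b - \<tau>) / \<epsilon>) - 2 * arctan ((a - \<tau>) / \<epsilon>))
        = integral {a..b} (\<lambda>t. g \<tau> * of_real (K \<epsilon> t))"
      using eventually_at_right_less[of 0]
    proof eventually_elim
      case (elim \<epsilon>)
      have "((\<lambda>t. g \<tau> * of_real (K \<epsilon> t)) has_integral
           g \<tau> * of_real (2 * arctan ((b - \<tau>) / \<epsilon>) - 2 * arctan ((a - \<tau>) / \<epsilon>))) {a..b}"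
        by (intro has_integral_mult_right has_integral_of_real intK elim)
      then show ?case by (rule integral_unique[symmetric])
    qed
    have "((\<lambda>\<epsilon>. g \<tau> * of_real (2 * arctan ((b - \<tau>) / \<epsilon>) - 2 * arctan ((a - \<tau>) / \<epsilon>)))
        \<longlongrightarrow> g \<tau> * of_real (2 * (pi/2) - 2 * (- pi/2))) (at_right 0)"
      by (intro tendsto_intros lim1)
    from Lim_transform_eventually[OF this ev] show ?thesis by simp
  qed
  have diff: "((\<lambda>\<epsilon>. integral {a..b} (\<lambda>t. (g t - g \<tau>) * of_real (K \<epsilon> t))) \<longlongrightarrow> 0) (at_right 0)"
  proof (rule tendstoI)
    fix e :: real assume e: "e > 0"
    have "\<tau> \<in> {a..b}" using \<tau> by simp
    \<comment> \<open>The kernel has mass at most \<open>2 * pi\<close>, so the part near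
      \<open>\<tau>\<close> contributes at most \<open>e / 2\<close>. At distance at least
      \<open>r\<close> the kernel is of order \<open>\<epsilon>\<close>, which gives the term
      \<open>L * \<epsilon>\<close> below.\<close>
    define \<eta> where "\<eta> = e / (4 * pi)"
    have "\<eta> > 0" using e by (simp add: \<eta>_def)
    then obtain r where r: "r > 0" "\<And>t. t \<in> {a..b} \<Longrightarrow> \<bar>t - \<tau>\<bar> < r \<Longrightarrow> norm (g t - g \<tau>) < \<eta>"
      using g \<open>\<tau> \<in> {a..b}\<close> unfolding continuous_on_iff dist_norm real_norm_def by blast
    have "bounded (g ` {a..b})" using g compact_Icc compact_continuous_image compact_imp_bounded by blast
    then obtain M where M: "\<And>t. t \<in> {a..b} \<Longrightarrow> norm (g t) \<le> M" unfolding bounded_iff by blast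
    have M0: "M \<ge> 0" using M[OF \<open>\<tau> \<in> {a..b}\<close>] norm_ge_zero order_trans by blast
    define L where "L = 2 * M * (2 / r\<^sup>2) * (b - a)"
    have est: "norm (integral {a..b} (\<lambda>t. (g t - g \<tau>) * of_real (K \<epsilon> t))) \<le> e/2 + L * \<epsilon>" if "\<epsilon> > 0" for \<epsilon>
    proof -
      have "norm (integral {a..b} (\<lambda>t. (g t - g \<tau>) * of_real (K \<epsilon> t)))
          \<le> integral {a..b} (\<lambda>t. \<eta> * K \<epsilon> t + 2 * M * (2 * \<epsilon> / r\<^sup>2))"
      proof (rule integral_norm_bound_integral)
        show "(\<lambda>t. (g t - g \<tau>) * of_real (K \<epsilon> t)) integrable_on {a..b}"
          by (intro integrable_continuous_real continuous_intros g contK that)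
        show "(\<lambda>t. \<eta> * K \<epsilon> t + 2 * M * (2 * \<epsilon> / r\<^sup>2)) integrable_on {a..b}"
          by (intro integrable_continuous_real continuous_intros contK that)
        fix t assume t: "t \<in> {a..b}"
        have n: "norm ((g t - g \<tau>) * of_real (K \<epsilon> t)) = norm (g t - g \<tau>) * K \<epsilon> t"
          using Kpos[OF that, of t] by (simp add: norm_mult)
        show "norm ((g t - g \<tau>) * of_real (K \<epsilon> t)) \<le> \<eta> * K \<epsilon> t + 2 * M * (2 * \<epsilon> / r\<^sup>2)"
        proof (cases "\<bar>t - \<tau>\<bar> < r")
          case True
          have "norm (g t - g \<tau>) * K \<epsilon> t \<le> \<eta> * K \<epsilon> t"
            using r(2)[OF t True] Kpos[OF that] by (intro mult_right_mono) auto
          moreover have "0 \<le> 2 * M * (2 * \<epsilon> / r\<^sup>2)" using M0 that by simp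
          ultimately show ?thesis using n by linarith
        next
          case False
          have "norm (g t - g \<tau>) \<le> 2 * M"
            using norm_triangle_ineq4[of "g t" "g \<tau>"] M[OF t] M[OF \<open>\<tau> \<in> {a..b}\<close>] by linarith
          moreover have "r\<^sup>2 \<le> (t - \<tau>)\<^sup>2" using False r(1) by (simp add: abs_le_square_iff[symmetric])
          then have "K \<epsilon> t \<le> 2 * \<epsilon> / r\<^sup>2"
            unfolding K_def using that r(1) by (intro divide_left_mono) (auto intro!: mult_pos_pos add_pos_nonneg simp: add_nonneg_pos add_increasing2)
          ultimately have "norm (g t - g \<tau>) * K \<epsilon> t \<le> 2 * M * (2 * \<epsilon> / r\<^sup>2)"
            using Kpos[OF that, of t] M0 by (intro mult_mono) auto
          moreover have "0 \<le> \<eta> * K \<epsilon> t" using \<open>\<eta> > 0\<close> Kpos[OF that] by simp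
          ultimately show ?thesis using n by linarith
        qed
      qed
      also have "\<dots> = \<eta> * (2 * arctan ((b - \<tau>) / \<epsilon>) - 2 * arctan ((a - \<tau>) / \<epsilon>)) + 2 * M * (2 * \<epsilon> / r\<^sup>2) * (b - a)"
      proof (rule integral_unique, rule has_integral_add)
        show "((\<lambda>t. \<eta> * K \<epsilon> t) has_integral \<eta> * (2 * arctan ((b - \<tau>) / \<epsilon>) - 2 * arctan ((a - \<tau>) / \<epsilon>))) {a..b}"
          by (intro has_integral_mult_right intK that)
        show "((\<lambda>t. 2 * M * (2 * \<epsilon> / r\<^sup>2)) has_integral 2 * M * (2 * \<epsilon> / r\<^sup>2) * (b - a)) {a..b}"
          using has_integral_const_real[of "2 * M * (2 * \<epsilon> / r\<^sup>2)" a b] \<tau> by (simp add: mult.commute)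
      qed
      also have "\<dots> \<le> \<eta> * (2 * pi) + L * \<epsilon>"
        using arctan_bounded[of "(b - \<tau>) / \<epsilon>"] arctan_bounded[of "(a - \<tau>) / \<epsilon>"] \<open>\<eta> > 0\<close>
        by (auto simp: L_def mult_ac intro!: add_mono mult_left_mono)
      also have "\<dots> = e/2 + L * \<epsilon>" by (simp add: \<eta>_def)
      finally show ?thesis .
    qed
    have "((\<lambda>\<epsilon>. L * \<epsilon>) \<longlongrightarrow> 0) (at_right 0)"
      by (rule tendsto_eq_intros refl | simp)+
    then have "\<forall>\<^sub>F \<epsilon> in at_right 0. L * \<epsilon> < e/2" by (rule order_tendstoD) (use e in simp)
    then show "\<forall>\<^sub>F \<epsilon> in at_right 0. dist (integral {a..b} (\<lambda>t. (g t - g \<tau>) * of_real (K \<epsilon> t))) 0 < e"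
      using eventually_at_right_less[of 0]
    proof eventually_elim
      case (elim \<epsilon>)
      then show ?case using est[of \<epsilon>] by (simp add: dist_norm)
    qed
  qed
  have ev: "\<forall>\<^sub>F \<epsilon> in at_right 0. integral {a..b} (\<lambda>t. (g t - g \<tau>) * of_real (K \<epsilon> t)) + integral {a..b} (\<lambda>t. g \<tau> * of_real (K \<epsilon> t))
     = integral {a..b} (\<lambda>t. g t * of_real (K \<epsilon> t))"
    using eventually_at_right_less[of 0]
  proof eventually_elim
    case (elim \<epsilon>)
    have "integral {a..b} (\<lambda>t. (g t - g \<tau>) * of_real (K \<epsilon> t)) + integral {a..b} (\<lambda>t. g \<tau> * of_real (K \<epsilon> t))
       = integral {a..b} (\<lambda>t. (g t - g \<tau>) * of_real (K \<epsilon> t) + g \<tau> * of_real (K \<epsilon> t))"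
      by (rule integral_add[symmetric])
         (intro integrable_continuous_real continuous_intros g contK elim)+
    then show ?case by (simp add: algebra_simps)
  qed
  from Lim_transform_eventually[OF tendsto_add[OF diff main] ev] show ?thesis
    by (simp add: K_def mult_ac)
qed

section \<open>Extensions from the translates of a domain\<close>

lemma vshift_mem_iff: "w \<in> vshift t S \<longleftrightarrow> w - \<i> * of_real t \<in> S"
  by (force simp: image_iff)

lemma uniformly_close_on_closure:
  assumes "open D" "bounded D" "continuous_on (closure D) g" "continuous_on (closure D) h"
    "g holomorphic_on D" "h holomorphic_on D" "\<And>z. z \<in> frontier D \<Longrightarrow> norm (g z - h z) \<le> \<epsilon>" "z \<in> closure D"
  shows "norm (g z - h z) \<le> \<epsilon>"
proof (cases "z \<in> D")
  case True
  show ?thesis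
    by (rule maximum_modulus_frontier[of "\<lambda>z. g z - h z" D])
       (use assms True in \<open>auto intro!: holomorphic_intros continuous_intros simp: interior_open\<close>)
next
  case False
  then have "z \<in> frontier D" using assms by (simp add: frontier_def interior_open)
  then show ?thesis by (rule assms)
qed

text \<open>The extensions are given for one \<open>t\<close> at a time. Joint continuity comes from
  the maximum principle: on the closure \<open>G s - G t\<close> is bounded by the change in
  boundary values, which is uniformly small by compactness.\<close>

lemma exists_extension_family:
  assumes "open D" "bounded D"
    and ext: "\<And>t. t \<in> {a..b} \<Longrightarrow> holomorphic_extension_to f t D"
    and cont: "continuous_on (\<Union>t\<in>{a..b}. vshift t (frontier D)) f"
  obtains G where "continuous_on ({a..b} \<times> closure D) (\<lambda>(t,z). G t z)"
    "\<And>t. t \<in> {a..b} \<Longrightarrow> G t holomorphic_on D"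
    "\<And>t z. t \<in> {a..b} \<Longrightarrow> z \<in> frontier D \<Longrightarrow> G t z = f (z + \<i> * of_real t)"
proof -
  obtain g where g: "\<And>t. t \<in> {a..b} \<Longrightarrow> continuous_on (vshift t (closure D)) (g t)"
    "\<And>t. t \<in> {a..b} \<Longrightarrow> g t holomorphic_on vshift t D"
    "\<And>t z. t \<in> {a..b} \<Longrightarrow> z \<in> vshift t (frontier D) \<Longrightarrow> g t z = f z"
    using ext unfolding holomorphic_extension_to_def by metis
  define G where "G t z = g t (z + \<i> * of_real t)" for t z
  have cG: "continuous_on (closure D) (G t)" if "t \<in> {a..b}" for t
    unfolding G_def by (rule continuous_on_compose2[OF g(1)[OF that]]) (auto intro!: continuous_intros)
  have hG: "G t holomorphic_on D" if "t \<in> {a..b}" for t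
  proof -
    have "(g t \<circ> (\<lambda>z. z + \<i> * of_real t)) holomorphic_on D"
      by (rule holomorphic_on_compose_gen[OF _ g(2)[OF that]]) (auto intro!: holomorphic_intros)
    then show ?thesis by (simp add: G_def[abs_def] o_def)
  qed
  have bG: "G t z = f (z + \<i> * of_real t)" if "t \<in> {a..b}" "z \<in> frontier D" for t z
    unfolding G_def by (rule g(3)) (use that in auto)
  have "compact ({a..b} \<times> frontier D)"
    using assms(2) by (simp add: compact_Times compact_frontier_bounded)
  moreover have "continuous_on ({a..b} \<times> frontier D) (\<lambda>tz. f (snd tz + \<i> * of_real (fst tz)))"
    by (rule continuous_on_compose2[OF cont]) (auto intro!: continuous_intros)
  ultimately have uc: "uniformly_continuous_on ({a..b} \<times> frontier D) (\<lambda>tz. f (snd tz + \<i> * of_real (fst tz)))"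
    by (rule compact_uniformly_continuous[rotated])
  have "continuous_on ({a..b} \<times> closure D) (\<lambda>tz. G (fst tz) (snd tz))"
    unfolding continuous_on_iff
  proof (intro ballI allI impI)
    fix tz and e :: real assume tz: "tz \<in> {a..b} \<times> closure D" and e: "e > 0"
    obtain t z where [simp]: "tz = (t,z)" and t: "t \<in> {a..b}" and z: "z \<in> closure D" using tz by auto
    obtain d1 where d1: "d1 > 0" "\<And>s u. s \<in> {a..b} \<Longrightarrow> u \<in> frontier D \<Longrightarrow> dist s t < d1
        \<Longrightarrow> norm (f (u + \<i> * of_real s) - f (u + \<i> * of_real t)) < e/2"
    proof -
      obtain d where d: "d > 0" "\<And>x x'. \<lbrakk>x \<in> {a..b} \<times> frontier D; x' \<in> {a..b} \<times> frontier D; dist x' x < d\<rbrakk>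
         \<Longrightarrow> dist (f (snd x' + \<i> * of_real (fst x'))) (f (snd x + \<i> * of_real (fst x))) < e/2"
        using uc[unfolded uniformly_continuous_on_def, rule_format, OF half_gt_zero[OF e]] by blast
      have "norm (f (u + \<i> * of_real s) - f (u + \<i> * of_real t)) < e/2"
        if "s \<in> {a..b}" "u \<in> frontier D" "dist s t < d" for s u
        using d(2)[of "(t,u)" "(s,u)"] that t by (auto simp: dist_Pair_Pair dist_norm)
      then show ?thesis using d(1) that by blast
    qed
    obtain d2 where d2: "d2 > 0" "\<And>u. u \<in> closure D \<Longrightarrow> dist u z < d2 \<Longrightarrow> dist (G t u) (G t z) < e/2"
      using cG[OF t, unfolded continuous_on_iff, rule_format, OF z half_gt_zero[OF e]] by blast
    show "\<exists>d>0. \<forall>x'\<in>{a..b} \<times> closure D. dist x' tz < d \<longrightarrow> dist (G (fst x') (snd x')) (G (fst tz) (snd tz)) < e"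
    proof (intro exI[of _ "min d1 d2"] conjI ballI impI)
      fix x' assume x': "x' \<in> {a..b} \<times> closure D" "dist x' tz < min d1 d2"
      obtain s u where [simp]: "x' = (s,u)" and s: "s \<in> {a..b}" and u: "u \<in> closure D" using x' by auto
      have "dist s t < d1" "dist u z < d2"
        using x'(2) dist_fst_le[of x' tz] dist_snd_le[of x' tz] by auto
      moreover have "norm (G s u - G t u) \<le> e/2"
        by (rule uniformly_close_on_closure[OF assms(1,2) cG cG hG hG _ u])
           (use s t bG d1(2) \<open>dist s t < d1\<close> in \<open>auto intro: less_imp_le\<close>)
      ultimately show "dist (G (fst x') (snd x')) (G (fst tz) (snd tz)) < e"
        using d2(2)[OF u] dist_triangle[of "G s u" "G t z" "G t u"] by (simp add: dist_norm)
    qed (use d1 d2 in auto)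
  qed
  then show ?thesis using that[of G] hG bG by (simp add: split_beta)
qed

locale vertical_family =
  fixes D :: "complex set" and a b :: real and f :: "complex \<Rightarrow> complex" and G :: "real \<Rightarrow> complex \<Rightarrow> complex"
  assumes D: "open D" "connected D" "bounded D"
    and cont_G: "continuous_on ({a..b} \<times> closure D) (\<lambda>(t,z). G t z)"
    and hol_G: "\<And>t. t \<in> {a..b} \<Longrightarrow> G t holomorphic_on D"
    and bd_G: "\<And>t z. t \<in> {a..b} \<Longrightarrow> z \<in> frontier D \<Longrightarrow> G t z = f (z + \<i> * of_real t)"
begin

lemma cont_G': "continuous_on (closure D) (G t)" if "t \<in> {a..b}"
proof -
  have "continuous_on (closure D) (\<lambda>z. (\<lambda>(t,z). G t z) (t,z))"
    by (rule continuous_on_compose2[OF cont_G])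
       (use that in \<open>auto intro!: continuous_on_Pair continuous_on_const continuous_on_id\<close>)
  then show ?thesis by simp
qed

lemma cont_G'': "continuous_on {a..b} (\<lambda>t. G t z)" if "z \<in> closure D"
proof -
  have "continuous_on {a..b} (\<lambda>t. (\<lambda>(t,z). G t z) (t,z))"
    by (rule continuous_on_compose2[OF cont_G])
       (use that in \<open>auto intro!: continuous_on_Pair continuous_on_const continuous_on_id\<close>)
  then show ?thesis by simp
qed

definition fibre_integral :: "(complex \<Rightarrow> complex) \<Rightarrow> complex \<Rightarrow> complex" where
  "fibre_integral p z = integral {a..b} (\<lambda>t. G t z * p (z + \<i> * of_real t))"

lemma continuous_on_fibre_integrand:
  assumes "continuous_on S p" "\<And>z t. z \<in> T \<Longrightarrow> t \<in> {a..b} \<Longrightarrow> z + \<i> * of_real t \<in> S" "T \<subseteq> closure D"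
  shows "continuous_on (T \<times> {a..b}) (\<lambda>(z,t). G t z * p (z + \<i> * of_real t))"
proof -
  have "continuous_on (T \<times> {a..b}) (\<lambda>zt. (\<lambda>(t,z). G t z) (snd zt, fst zt))"
    by (rule continuous_on_compose2[OF cont_G]) (use assms(3) in \<open>auto intro!: continuous_intros\<close>)
  moreover have "continuous_on (T \<times> {a..b}) (\<lambda>zt. p (fst zt + \<i> * of_real (snd zt)))"
    by (rule continuous_on_compose2[OF assms(1)]) (use assms(2) in \<open>auto intro!: continuous_intros\<close>)
  ultimately show ?thesis by (auto intro!: continuous_intros simp: split_beta)
qed

lemma continuous_on_fibre_integral:
  assumes "continuous_on S p" "\<And>z t. z \<in> closure D \<Longrightarrow> t \<in> {a..b} \<Longrightarrow> z + \<i> * of_real t \<in> S"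
  shows "continuous_on (closure D) (fibre_integral p)"
  using integral_continuous_on_param[of "closure D" a b "\<lambda>z t. G t z * p (z + \<i> * of_real t)"]
    continuous_on_fibre_integrand[OF assms] unfolding fibre_integral_def by simp

lemma holomorphic_on_fibre_integral:
  assumes "p holomorphic_on S" "\<And>z t. z \<in> D \<Longrightarrow> t \<in> {a..b} \<Longrightarrow> z + \<i> * of_real t \<in> S"
  shows "fibre_integral p holomorphic_on D"
  unfolding fibre_integral_def
proof (rule holomorphic_on_integral_param[OF D(1)])
  show "continuous_on (D \<times> {a..b}) (\<lambda>(z,t). G t z * p (z + \<i> * of_real t))"
    by (rule continuous_on_fibre_integrand[OF holomorphic_on_imp_continuous_on[OF assms(1)] assms(2)])
       (auto simp: closure_subset subsetD)
  fix t assume t: "t \<in> {a..b}"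
  have "(p \<circ> (\<lambda>z. z + \<i> * of_real t)) holomorphic_on D"
    by (rule holomorphic_on_compose_gen[OF _ assms(1)]) (use assms(2) t in \<open>auto intro!: holomorphic_intros\<close>)
  then show "(\<lambda>z. G t z * p (z + \<i> * of_real t)) holomorphic_on D"
    by (intro holomorphic_on_mult hol_G t) (simp add: o_def)
qed

lemma fibre_integral_lin:
  assumes "continuous_on S p" "continuous_on S q" "z \<in> closure D" "\<And>t. t \<in> {a..b} \<Longrightarrow> z + \<i> * of_real t \<in> S"
  shows "fibre_integral (\<lambda>z. p z + c * q z) z = fibre_integral p z + c * fibre_integral q z"
proof -
  have int: "(\<lambda>t. G t z * r (z + \<i> * of_real t)) integrable_on {a..b}" if "continuous_on S r" for r
  proof (intro integrable_continuous_real continuous_intros)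
    show "continuous_on {a..b} (\<lambda>t. G t z)" by (rule cont_G''[OF assms(3)])
    show "continuous_on {a..b} (\<lambda>t. r (z + \<i> * of_real t))"
      by (rule continuous_on_compose2[OF that]) (use assms(4) in \<open>auto intro!: continuous_intros\<close>)
  qed
  have "fibre_integral (\<lambda>z. p z + c * q z) z
     = integral {a..b} (\<lambda>t. G t z * p (z + \<i> * of_real t) + c * (G t z * q (z + \<i> * of_real t)))"
    unfolding fibre_integral_def by (simp add: algebra_simps)
  also have "\<dots> = fibre_integral p z + integral {a..b} (\<lambda>t. c * (G t z * q (z + \<i> * of_real t)))"
    unfolding fibre_integral_def by (intro integral_add int integrable_on_mult_right assms)
  finally show ?thesis by (simp add: fibre_integral_def)
qed

text \<open>The Cauchy transform along the vertical segment over \<open>z\<close>. It equals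
  \<open>fibre_integral\<close> of a Cauchy kernel, but is also needed for \<open>w\<close> inside
  the strip, where that kernel is not in the class of kernels used later.\<close>

definition fibre_Cauchy :: "complex \<Rightarrow> complex \<Rightarrow> complex" where
  "fibre_Cauchy z w = integral {a..b} (\<lambda>t. G t z / (z + \<i> * of_real t - w))"

lemma holomorphic_on_fibre_Cauchy:
  assumes "z \<in> closure D"
  shows "fibre_Cauchy z holomorphic_on {w. Re w \<noteq> Re z}"
  unfolding fibre_Cauchy_def
proof (rule holomorphic_on_integral_param)
  have ne: "z + \<i> * of_real t - w \<noteq> 0" if "Re w \<noteq> Re z" for t w
    using that by (auto simp: complex_eq_iff)
  have "{w. Re w \<noteq> Re z} = {w. Re w < Re z} \<union> {w. Re z < Re w}" by auto
  then show "open {w. Re w \<noteq> Re z}"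
    using open_halfspace_Re_lt[of "Re z"] open_halfspace_Re_gt[of "Re z"] by auto
  have "continuous_on ({w. Re w \<noteq> Re z} \<times> {a..b}) (\<lambda>wt. (\<lambda>t. G t z) (snd wt))"
    by (rule continuous_on_compose2[OF cont_G''[OF assms]]) (auto intro!: continuous_intros)
  then show "continuous_on ({w. Re w \<noteq> Re z} \<times> {a..b}) (\<lambda>(w,t). G t z / (z + \<i> * of_real t - w))"
    using ne by (auto intro!: continuous_intros simp: split_beta)
  show "(\<lambda>w. G t z / (z + \<i> * of_real t - w)) holomorphic_on {w. Re w \<noteq> Re z}" for t
    using ne by (intro holomorphic_intros) auto
qed

text \<open>At horizontal distance \<open>\<epsilon>\<close> on the two sides of the segment the
  Cauchy kernels differ by minus the kernel of \<open>Poisson_kernel_limit\<close>. There is no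
  factor \<open>\<i>\<close> in the jump because the integration is with respect to \<open>t\<close>
  and not \<open>\<i> * t\<close>.\<close>

lemma fibre_Cauchy_jump:
  assumes z: "z \<in> closure D" and \<tau>: "a < \<tau>" "\<tau> < b"
  shows "((\<lambda>\<epsilon>. fibre_Cauchy z (z + \<i> * of_real \<tau> + of_real \<epsilon>) - fibre_Cauchy z (z + \<i> * of_real \<tau> - of_real \<epsilon>))
          \<longlongrightarrow> - 2 * pi * G \<tau> z) (at_right 0)"
proof -
  have "((\<lambda>\<epsilon>. - integral {a..b} (\<lambda>t. G t z * of_real (2 * \<epsilon> / ((t - \<tau>)\<^sup>2 + \<epsilon>\<^sup>2)))) \<longlongrightarrow> - (2 * pi * G \<tau> z)) (at_right 0)"
    by (intro tendsto_minus Poisson_kernel_limit[OF cont_G''[OF z] \<tau>])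
  moreover have "\<forall>\<^sub>F \<epsilon> in at_right 0. - integral {a..b} (\<lambda>t. G t z * of_real (2 * \<epsilon> / ((t - \<tau>)\<^sup>2 + \<epsilon>\<^sup>2)))
      = fibre_Cauchy z (z + \<i> * of_real \<tau> + of_real \<epsilon>) - fibre_Cauchy z (z + \<i> * of_real \<tau> - of_real \<epsilon>)"
    using eventually_at_right_less[of 0]
  proof eventually_elim
    case (elim \<epsilon>)
    define w1 w2 where "w1 = z + \<i> * of_real \<tau> + of_real \<epsilon>" and "w2 = z + \<i> * of_real \<tau> - of_real \<epsilon>"
    have ne: "z + \<i> * of_real t - w1 \<noteq> 0" "z + \<i> * of_real t - w2 \<noteq> 0" for t
      using elim by (auto simp: complex_eq_iff w1_def w2_def)
    have int: "(\<lambda>t. G t z / (z + \<i> * of_real t - w)) integrable_on {a..b}"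
      if "\<And>t. z + \<i> * of_real t - w \<noteq> 0" for w
      using that by (intro integrable_continuous_real continuous_intros cont_G''[OF z]) auto
    have "fibre_Cauchy z w1 - fibre_Cauchy z w2
       = integral {a..b} (\<lambda>t. G t z / (z + \<i> * of_real t - w1) - G t z / (z + \<i> * of_real t - w2))"
      unfolding fibre_Cauchy_def using ne by (intro integral_diff[symmetric] int) auto
    also have "\<dots> = integral {a..b} (\<lambda>t. - (G t z * of_real (2 * \<epsilon> / ((t - \<tau>)\<^sup>2 + \<epsilon>\<^sup>2))))"
    proof (rule integral_cong)
      fix t
      have "1 / (z + \<i> * of_real t - w1) - 1 / (z + \<i> * of_real t - w2) = (w1 - w2) / ((z + \<i> * of_real t - w1) * (z + \<i> * of_real t - w2))"
        using ne[of t] by (simp add: field_simps)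
      also have "(z + \<i> * of_real t - w1) * (z + \<i> * of_real t - w2) = - of_real ((t - \<tau>)\<^sup>2 + \<epsilon>\<^sup>2)"
        by (simp add: w1_def w2_def complex_eq_iff power2_eq_square algebra_simps)
      also have "w1 - w2 = of_real (2 * \<epsilon>)" by (simp add: w1_def w2_def)
      finally have "1 / (z + \<i> * of_real t - w1) - 1 / (z + \<i> * of_real t - w2) = - of_real (2 * \<epsilon> / ((t - \<tau>)\<^sup>2 + \<epsilon>\<^sup>2))"
        by (simp only: divide_minus_right of_real_divide)
      then have "G t z * (1 / (z + \<i> * of_real t - w1) - 1 / (z + \<i> * of_real t - w2)) = G t z * (- of_real (2 * \<epsilon> / ((t - \<tau>)\<^sup>2 + \<epsilon>\<^sup>2)))"
        by (rule arg_cong)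
      then show "G t z / (z + \<i> * of_real t - w1) - G t z / (z + \<i> * of_real t - w2)
          = - (G t z * of_real (2 * \<epsilon> / ((t - \<tau>)\<^sup>2 + \<epsilon>\<^sup>2)))"
        by (simp add: right_diff_distrib)
    qed
    finally show ?case by (simp add: w1_def w2_def)
  qed
  ultimately have "((\<lambda>\<epsilon>. fibre_Cauchy z (z + \<i> * of_real \<tau> + of_real \<epsilon>) - fibre_Cauchy z (z + \<i> * of_real \<tau> - of_real \<epsilon>))
          \<longlongrightarrow> - (2 * pi * G \<tau> z)) (at_right 0)"
    by (rule Lim_transform_eventually)
  then show ?thesis by simp
qed

end

section \<open>The band around the graph\<close>

lemma closure_cnj_image: "closure (cnj ` S) = cnj ` closure S"
proof (rule closure_injective_linear_image[symmetric])
  show "linear cnj" by (rule bounded_linear.linear[OF bounded_linear_cnj])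
  show "inj cnj" by (simp add: inj_on_def)
qed

lemma open_cnj_image: "open S \<Longrightarrow> open (cnj ` S)"
  by (simp add: image_cnj_conv_vimage_cnj open_vimage continuous_on_cnj continuous_on_id)

lemma frontier_cnj_image: "open S \<Longrightarrow> frontier (cnj ` S) = cnj ` frontier S"
  by (simp add: frontier_def interior_open open_cnj_image closure_cnj_image image_set_diff[symmetric] inj_on_def)

text \<open>The middle piece \<open>{l..r}\<close>, on which nothing is assumed about the size of
  \<open>\<psi>\<close>, cancels; the four outer pieces are estimated trivially.\<close>

lemma norm_integral_diff_le_of_common_part:
  fixes \<psi> :: "real \<Rightarrow> complex"
  assumes cont: "continuous_on {u1..v1} \<psi>" "continuous_on {u2..v2} \<psi>"
    and ord: "u1 \<le> l" "u2 \<le> l" "l \<le> r" "r \<le> v1" "r \<le> v2" and K: "K \<ge> 0"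
    and bd: "\<And>t. t \<in> {u1..v1} \<union> {u2..v2} \<Longrightarrow> t \<le> l \<or> r \<le> t \<Longrightarrow> norm (\<psi> t) \<le> K"
  shows "norm (integral {u1..v1} \<psi> - integral {u2..v2} \<psi>) \<le> K * ((v1 - u1) + (v2 - u2))"
proof -
  have split: "integral {u..v} \<psi> = integral {u..l} \<psi> + integral {l..r} \<psi> + integral {r..v} \<psi>"
    if c: "continuous_on {u..v} \<psi>" and o: "u \<le> l" "r \<le> v" for u v
  proof -
    have "\<psi> integrable_on {u..v}" "\<psi> integrable_on {l..v}"
      using o ord(3) by (auto intro!: integrable_continuous_real continuous_on_subset[OF c])
    moreover from this have "integral {u..l} \<psi> + integral {l..v} \<psi> = integral {u..v} \<psi>"
      using o ord(3) by (intro Henstock_Kurzweil_Integration.integral_combine) auto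
    moreover have "integral {l..r} \<psi> + integral {r..v} \<psi> = integral {l..v} \<psi>"
      using o ord(3) calculation by (intro Henstock_Kurzweil_Integration.integral_combine) auto
    ultimately show ?thesis by (simp add: add.assoc)
  qed
  have est: "norm (integral {u..v} \<psi>) \<le> K * (v - u)"
    if "u \<le> v" "continuous_on {u..v} \<psi>" "\<And>t. t \<in> {u..v} \<Longrightarrow> norm (\<psi> t) \<le> K" for u v
    using integral_bound[OF that(1,2)] that(3) by auto
  have e1: "norm (integral {u1..l} \<psi>) \<le> K * (l - u1)"
    by (intro est bd continuous_on_subset[OF cont(1)]) (use ord in auto)
  have e2: "norm (integral {u2..l} \<psi>) \<le> K * (l - u2)"
    by (intro est bd continuous_on_subset[OF cont(2)]) (use ord in auto)
  have e3: "norm (integral {r..v1} \<psi>) \<le> K * (v1 - r)"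
    by (intro est bd continuous_on_subset[OF cont(1)]) (use ord in auto)
  have e4: "norm (integral {r..v2} \<psi>) \<le> K * (v2 - r)"
    by (intro est bd continuous_on_subset[OF cont(2)]) (use ord in auto)
  have "integral {u1..v1} \<psi> - integral {u2..v2} \<psi>
     = (integral {u1..l} \<psi> - integral {u2..l} \<psi>) + (integral {r..v1} \<psi> - integral {r..v2} \<psi>)"
    using split[OF cont(1)] split[OF cont(2)] ord by simp
  also have "norm \<dots> \<le> (K * (l - u1) + K * (l - u2)) + (K * (v1 - r) + K * (v2 - r))"
    by (intro norm_triangle_mono order_trans[OF norm_triangle_ineq4] add_mono e1 e2 e3 e4)
  also have "\<dots> \<le> K * ((v1 - u1) + (v2 - u2))"
  proof -
    have "K * l \<le> K * r" using ord(3) K by (rule mult_left_mono)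
    then show ?thesis by (simp add: algebra_simps)
  qed
  finally show ?thesis .
qed

section \<open>Comparison of the integrals over the two families\<close>

text \<open>\<open>lam\<close> lives on the whole line, although \<open>D\<close> lies over
  \<open>\<alpha>\<close> to \<open>\<beta>\<close>, because the band must reach outside the strip,
  where the poles start. \<open>\<delta>\<close> is a margin by which all four extreme translates
  clear the graph, and also the half-width of the band; \<open>F\<close> bounds \<open>f\<close> on
  all boundary translates of both families.\<close>

locale reflected_families =
  V: vertical_family D a b f G + W: vertical_family "cnj ` D" c d f Gs
  for D a b c d f G Gs +
  fixes \<alpha> \<beta> \<delta> F :: real and lam :: "real \<Rightarrow> real"
  assumes lam: "continuous_on UNIV lam" and \<delta>: "\<delta> > 0"
    and D_strip: "\<And>z. z \<in> D \<Longrightarrow> \<alpha> < Re z \<and> Re z < \<beta>"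
    and D_proj: "\<And>x. \<alpha> < x \<Longrightarrow> x < \<beta> \<Longrightarrow> \<exists>z\<in>D. Re z = x"
    and \<alpha>\<beta>: "\<alpha> < \<beta>"
    and below: "\<And>z. z \<in> closure D \<Longrightarrow> a + Im z < lam (Re z) - \<delta>"
    and above: "\<And>z. z \<in> closure D \<Longrightarrow> lam (Re z) + \<delta> < b + Im z"
    and below': "\<And>z. z \<in> closure D \<Longrightarrow> c - Im z < lam (Re z) - \<delta>"
    and above': "\<And>z. z \<in> closure D \<Longrightarrow> lam (Re z) + \<delta> < d - Im z"
    and F: "\<And>z t. z \<in> frontier D \<Longrightarrow> t \<in> {a..b} \<Longrightarrow> norm (f (z + \<i> * of_real t)) \<le> F"
    and F': "\<And>z t. z \<in> frontier D \<Longrightarrow> t \<in> {c..d} \<Longrightarrow> norm (f (cnj z + \<i> * of_real t)) \<le> F"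
begin

lemma D_strip_closed: "z \<in> closure D \<Longrightarrow> \<alpha> \<le> Re z \<and> Re z \<le> \<beta>"
proof -
  have "closure D \<subseteq> {z. \<alpha> \<le> Re z} \<inter> {z. Re z \<le> \<beta>}"
    by (rule closure_minimal)
       (use D_strip in \<open>auto intro: less_imp_le closed_halfspace_Re_ge closed_halfspace_Re_le closed_Int\<close>)
  then show "z \<in> closure D \<Longrightarrow> \<alpha> \<le> Re z \<and> Re z \<le> \<beta>" by auto
qed

text \<open>The part of the closed strip where the size of a kernel is measured.\<close>

definition ends :: "complex set" where
  "ends = {z. \<alpha> \<le> Re z \<and> Re z \<le> \<beta> \<and> \<delta> \<le> \<bar>Im z - lam (Re z)\<bar>}"

definition band :: "complex set" where
  "band = {z. \<bar>Im z - lam (Re z)\<bar> < \<delta>}"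

text \<open>Holomorphy in the open strip makes the fibre integrals holomorphic on \<open>D\<close>;
  continuity on the closed strip is needed where \<open>closure D\<close> touches its edges.\<close>

definition kernels :: "(complex \<Rightarrow> complex) set" where
  "kernels = {p. continuous_on {z. \<alpha> \<le> Re z \<and> Re z \<le> \<beta>} p \<and> p holomorphic_on {z. \<alpha> < Re z \<and> Re z < \<beta>}}"

lemma D_nonempty: "D \<noteq> {}"
  using D_proj[of "(\<alpha> + \<beta>) / 2"] \<alpha>\<beta> by auto

lemma ab: "a < b" "c < d"
proof -
  obtain z where "z \<in> closure D" using D_nonempty closure_subset by fastforce
  then show "a < b" "c < d" using below above below' above' \<delta> by fastforce+
qed

lemma F_nonneg: "F \<ge> 0"
proof -
  have "frontier D \<noteq> {}" using D_nonempty V.D(3) frontier_eq_empty not_bounded_UNIV by metis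
  then obtain z where "z \<in> frontier D" by blast
  then have "norm (f (z + \<i> * of_real a)) \<le> F" using ab by (intro F) auto
  then show ?thesis using norm_ge_zero order_trans by blast
qed

text \<open>After a shift of the variable, both are integrals of one function \<open>\<psi>\<close>
  of the height over intervals of the line through \<open>z\<close>. Both intervals contain the
  section of the band, and at other heights the point lies in \<open>ends\<close>.\<close>

lemma fibre_integrals_close_on_frontier:
  assumes p: "p \<in> kernels" and m: "m \<ge> 0" "\<And>z. z \<in> ends \<Longrightarrow> norm (p z) \<le> m" and z: "z \<in> frontier D"
  shows "norm (V.fibre_integral p z - W.fibre_integral p (cnj z)) \<le> F * m * ((b - a) + (d - c))"
proof -
  define \<psi> where "\<psi> y = f (Complex (Re z) y) * p (Complex (Re z) y)" for y
  have zc: "z \<in> closure D" using z by (auto simp: frontier_def)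
  have fr': "cnj z \<in> frontier (cnj ` D)" using z V.D(1) by (simp add: frontier_cnj_image)
  then have zc': "cnj z \<in> closure (cnj ` D)" by (auto simp: frontier_def)
  have "continuous_on {z. \<alpha> \<le> Re z \<and> Re z \<le> \<beta>} p" using p by (simp add: kernels_def)
  then have cp: "continuous_on S (\<lambda>y. p (Complex (Re z) y))" for S
    by (rule continuous_on_compose2)
       (use D_strip_closed[OF zc] in \<open>auto intro!: continuous_intros simp: Complex_eq\<close>)
  have eq: "z + \<i> * of_real t = Complex (Re z) (t + Im z)" for t by (simp add: complex_eq_iff)
  have eq': "cnj z + \<i> * of_real t = Complex (Re z) (t - Im z)" for t by (simp add: complex_eq_iff)
  have cf: "continuous_on {a..b} (\<lambda>t. f (Complex (Re z) (t + Im z)))"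
    using V.cont_G''[OF zc] by (rule continuous_on_eq) (use V.bd_G[OF _ z] eq in auto)
  have cf': "continuous_on {c..d} (\<lambda>t. f (Complex (Re z) (t - Im z)))"
    using W.cont_G''[OF zc'] by (rule continuous_on_eq) (use W.bd_G[OF _ fr'] eq' in auto)
  have c1: "continuous_on {a + Im z..b + Im z} \<psi>"
    unfolding \<psi>_def
  proof (intro continuous_intros cp)
    have "continuous_on {a + Im z..b + Im z} (\<lambda>y. f (Complex (Re z) (y - Im z + Im z)))"
      by (rule continuous_on_compose2[OF cf]) (auto intro!: continuous_intros)
    then show "continuous_on {a + Im z..b + Im z} (\<lambda>y. f (Complex (Re z) y))" by simp
  qed
  have c2: "continuous_on {c - Im z..d - Im z} \<psi>"
    unfolding \<psi>_def
  proof (intro continuous_intros cp)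
    have "continuous_on {c - Im z..d - Im z} (\<lambda>y. f (Complex (Re z) (y + Im z - Im z)))"
      by (rule continuous_on_compose2[OF cf']) (auto intro!: continuous_intros)
    then show "continuous_on {c - Im z..d - Im z} (\<lambda>y. f (Complex (Re z) y))" by simp
  qed
  have "V.fibre_integral p z = integral {a..b} (\<psi> \<circ> (+) (Im z))"
    unfolding V.fibre_integral_def
    by (rule integral_cong) (use V.bd_G[OF _ z] in \<open>simp add: \<psi>_def eq add.commute\<close>)
  also have "\<dots> = integral {a + Im z..b + Im z} \<psi>"
    by (rule integral_shift_Icc_real)
  finally have I1: "V.fibre_integral p z = integral {a + Im z..b + Im z} \<psi>" .
  have "W.fibre_integral p (cnj z) = integral {c..d} (\<psi> \<circ> (+) (- Im z))"
    unfolding W.fibre_integral_def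
    by (rule integral_cong) (use W.bd_G[OF _ fr'] in \<open>simp add: \<psi>_def eq'\<close>)
  also have "\<dots> = integral {c - Im z..d - Im z} \<psi>"
    using integral_shift_Icc_real[of c d \<psi> "- Im z"] by simp
  finally have I2: "W.fibre_integral p (cnj z) = integral {c - Im z..d - Im z} \<psi>" .
  have "norm (integral {a + Im z..b + Im z} \<psi> - integral {c - Im z..d - Im z} \<psi>)
      \<le> F * m * ((b + Im z - (a + Im z)) + (d - Im z - (c - Im z)))"
  proof (rule norm_integral_diff_le_of_common_part[OF c1 c2, of "lam (Re z) - \<delta>" "lam (Re z) + \<delta>"])
    fix t assume t: "t \<in> {a + Im z..b + Im z} \<union> {c - Im z..d - Im z}" "t \<le> lam (Re z) - \<delta> \<or> lam (Re z) + \<delta> \<le> t"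
    have g: "z + \<i> * of_real (t - Im z) = Complex (Re z) t" "cnj z + \<i> * of_real (t + Im z) = Complex (Re z) t"
      by (simp_all add: complex_eq_iff)
    have "t - Im z \<in> {a..b} \<or> t + Im z \<in> {c..d}" using t(1) by auto
    then have "norm (f (Complex (Re z) t)) \<le> F"
      using F[OF z, of "t - Im z"] F'[OF z, of "t + Im z"] unfolding g by blast
    moreover have "norm (p (Complex (Re z) t)) \<le> m"
      using t(2) D_strip_closed[OF zc] by (intro m(2)) (auto simp: ends_def)
    ultimately show "norm (\<psi> t) \<le> F * m"
      unfolding \<psi>_def norm_mult using F_nonneg by (intro mult_mono) auto
  qed (use below above below' above' zc \<delta> F_nonneg m(1) in \<open>auto intro: less_imp_le\<close>)
  then show ?thesis by (simp add: I1 I2)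
qed

lemma holomorphic_fibre_integrals:
  assumes p: "p \<in> kernels"
  shows "V.fibre_integral p holomorphic_on D" "continuous_on (closure D) (V.fibre_integral p)"
    "(\<lambda>z. cnj (W.fibre_integral p (cnj z))) holomorphic_on D"
    "continuous_on (closure D) (\<lambda>z. cnj (W.fibre_integral p (cnj z)))"
proof -
  have p': "continuous_on {z. \<alpha> \<le> Re z \<and> Re z \<le> \<beta>} p" "p holomorphic_on {z. \<alpha> < Re z \<and> Re z < \<beta>}"
    using p by (auto simp: kernels_def)
  show "V.fibre_integral p holomorphic_on D"
    by (rule V.holomorphic_on_fibre_integral[OF p'(2)]) (use D_strip in auto)
  show "continuous_on (closure D) (V.fibre_integral p)"
    by (rule V.continuous_on_fibre_integral[OF p'(1)]) (use D_strip_closed in auto)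
  have "W.fibre_integral p holomorphic_on (cnj ` D)"
    by (rule W.holomorphic_on_fibre_integral[OF p'(2)]) (use D_strip in auto)
  from holomorphic_on_compose_cnj_cnj[OF this V.D(1)]
  show "(\<lambda>z. cnj (W.fibre_integral p (cnj z))) holomorphic_on D" by (simp add: o_def)
  have "continuous_on (closure (cnj ` D)) (W.fibre_integral p)"
    by (rule W.continuous_on_fibre_integral[OF p'(1)]) (use D_strip_closed in \<open>auto simp: closure_cnj_image\<close>)
  then have "continuous_on (closure D) (\<lambda>z. W.fibre_integral p (cnj z))"
    by (rule continuous_on_compose2) (auto simp: closure_cnj_image intro!: continuous_on_cnj continuous_on_id)
  then show "continuous_on (closure D) (\<lambda>z. cnj (W.fibre_integral p (cnj z)))"
    by (rule continuous_on_cnj)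
qed

lemma abs_Re_le_of_frontier:
  assumes "h holomorphic_on D" "continuous_on (closure D) h" "\<And>z. z \<in> frontier D \<Longrightarrow> \<bar>Re (h z)\<bar> \<le> \<epsilon>" "z \<in> D"
  shows "\<bar>Re (h z)\<bar> \<le> \<epsilon>"
proof -
  have "Re (h z) \<le> \<epsilon>"
    by (rule maximum_real_frontier[of h D]) (use assms V.D abs_le_D1 in \<open>auto simp: interior_open\<close>)
  moreover have "Re (- h z) \<le> \<epsilon>"
    by (rule maximum_real_frontier[of "\<lambda>z. - h z" D])
       (use assms V.D abs_le_D2 in \<open>auto simp: interior_open intro!: holomorphic_intros continuous_intros\<close>)
  ultimately show ?thesis by simp
qed

text \<open>The holomorphic functions \<open>I = fibre_integral p\<close> and \<open>K = cnj \<circ> fibre_integral p \<circ> cnj\<close> on \<open>D\<close>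
  satisfy \<open>I - cnj K \<approx> 0\<close> on the boundary, hence \<open>Re (I - K) \<approx> 0 \<approx> Im (I + K)\<close> on \<open>D\<close>.\<close>

lemma fibre_integral_oscillation:
  assumes z: "z0 \<in> D" "z1 \<in> D"
  obtains C where "C \<ge> 0"
    "\<And>p m. \<lbrakk>p \<in> kernels; m > 0; \<And>z. z \<in> ends \<Longrightarrow> norm (p z) \<le> m\<rbrakk>
       \<Longrightarrow> norm (V.fibre_integral p z1 - V.fibre_integral p z0) \<le> C * m"
proof -
  obtain C where C: "C \<ge> 0" "\<And>h \<epsilon>. \<lbrakk>h holomorphic_on D; \<epsilon> > 0; \<And>z. z \<in> D \<Longrightarrow> \<bar>Re (h z)\<bar> \<le> \<epsilon>\<rbrakk>
       \<Longrightarrow> norm (h z1 - h z0) \<le> C * \<epsilon>"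
    using oscillation_bound_of_bounded_Re[OF V.D(1,2) z] by metis
  \<comment> \<open>The summand 1 keeps \<open>L\<close> positive even for \<open>F = 0\<close>,
    since the oscillation bound asks for a positive \<open>\<epsilon>\<close>.\<close>
  define L where "L = F * ((b - a) + (d - c)) + 1"
  have "0 \<le> F * ((b - a) + (d - c))" using F_nonneg ab by (intro mult_nonneg_nonneg) auto
  then have L: "L > 0" "F * ((b - a) + (d - c)) \<le> L" by (auto simp: L_def)
  have "norm (V.fibre_integral p z1 - V.fibre_integral p z0) \<le> (C * L) * m"
    if p: "p \<in> kernels" and m: "m > 0" and pm: "\<And>z. z \<in> ends \<Longrightarrow> norm (p z) \<le> m" for p m
  proof -
    define I where "I = V.fibre_integral p"
    define K where "K = (\<lambda>z. cnj (W.fibre_integral p (cnj z)))"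
    note hol = holomorphic_fibre_integrals[OF p, folded I_def K_def]
    have fr: "norm (I z - cnj (K z)) \<le> L * m" if "z \<in> frontier D" for z
    proof -
      have "norm (I z - cnj (K z)) \<le> F * m * ((b - a) + (d - c))"
        using fibre_integrals_close_on_frontier[OF p _ pm that] m by (simp add: I_def K_def)
      also have "\<dots> = F * ((b - a) + (d - c)) * m" by simp
      also have "\<dots> \<le> L * m" using L m by (intro mult_right_mono) auto
      finally show ?thesis .
    qed
    have "\<bar>Re (I z - K z)\<bar> \<le> L * m" if "z \<in> D" for z
    proof (rule abs_Re_le_of_frontier[OF _ _ _ that])
      show "\<bar>Re (I z - K z)\<bar> \<le> L * m" if "z \<in> frontier D" for z
        using abs_Re_le_cmod[of "I z - cnj (K z)"] fr[OF that] by simp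
    qed (intro holomorphic_intros continuous_intros hol)+
    then have 1: "norm ((I z1 - K z1) - (I z0 - K z0)) \<le> C * (L * m)"
      using L m by (intro C(2)) (auto intro!: holomorphic_intros hol)
    \<comment> \<open>The factor \<open>\<i>\<close> turns the imaginary part of
      \<open>I + K\<close> into a real part, up to sign.\<close>
    have "\<bar>Re (\<i> * (I z + K z))\<bar> \<le> L * m" if "z \<in> D" for z
    proof (rule abs_Re_le_of_frontier[OF _ _ _ that])
      show "\<bar>Re (\<i> * (I z + K z))\<bar> \<le> L * m" if "z \<in> frontier D" for z
        using abs_Im_le_cmod[of "I z - cnj (K z)"] fr[OF that] by simp
    qed (intro holomorphic_intros continuous_intros hol)+
    then have "norm (\<i> * (I z1 + K z1) - \<i> * (I z0 + K z0)) \<le> C * (L * m)"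
      using L m by (intro C(2)) (auto intro!: holomorphic_intros hol)
    then have 2: "norm ((I z1 + K z1) - (I z0 + K z0)) \<le> C * (L * m)"
      by (simp add: right_diff_distrib[symmetric] norm_mult)
    have "norm (2 * (I z1 - I z0)) = norm (((I z1 - K z1) - (I z0 - K z0)) + ((I z1 + K z1) - (I z0 + K z0)))"
      by (simp add: algebra_simps)
    also have "\<dots> \<le> C * (L * m) + C * (L * m)" by (intro norm_triangle_mono 1 2)
    finally have "2 * norm (I z1 - I z0) \<le> 2 * (C * (L * m))"
      unfolding norm_mult by simp
    then show ?thesis by (simp add: I_def mult.assoc)
  qed
  then show ?thesis using that[of "C * L"] C(1) L by simp
qed

section \<open>Topology of the band and continuation of Cauchy transforms in it\<close>

lemma open_band: "open band"
proof -
  have "open {z. \<bar>Im z - lam (Re z)\<bar> < \<delta>}"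
    by (intro open_Collect_less continuous_intros continuous_on_compose2[OF lam]) auto
  then show ?thesis by (simp add: band_def)
qed

text \<open>A vertical shear by \<open>lam\<close> straightens the section to the product of
  \<open>S\<close> with an interval.\<close>

lemma connected_band_section:
  assumes "convex S"
  shows "connected (band \<inter> {w. Re w \<in> S})"
proof -
  have "band \<inter> {w. Re w \<in> S} = (\<lambda>(x,s). Complex x (lam x + s)) ` (S \<times> {-\<delta><..<\<delta>})"
  proof (intro equalityI subsetI)
    fix w assume "w \<in> band \<inter> {w. Re w \<in> S}"
    then show "w \<in> (\<lambda>(x,s). Complex x (lam x + s)) ` (S \<times> {-\<delta><..<\<delta>})"
      by (intro image_eqI[of _ _ "(Re w, Im w - lam (Re w))"]) (auto simp: band_def abs_less_iff)
  qed (auto simp: band_def abs_less_iff)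
  moreover have "connected (S \<times> {-\<delta><..<\<delta>})"
    by (intro convex_connected convex_Times assms) auto
  moreover have "continuous_on (S \<times> {-\<delta><..<\<delta>}) (\<lambda>(x,s). Complex x (lam x + s))"
    unfolding Complex_eq split_beta
    by (intro continuous_intros continuous_on_compose2[OF lam]) auto
  ultimately show ?thesis by (simp only: connected_continuous_image)
qed

lemma Cauchy_kernel_in_kernels:
  assumes "p \<in> kernels" "Re w < \<alpha> \<or> \<beta> < Re w"
  shows "(\<lambda>z. p z / (z - w)) \<in> kernels"
proof -
  have "z - w \<noteq> 0" if "\<alpha> \<le> Re z" "Re z \<le> \<beta>" for z using assms(2) that by auto
  then show ?thesis using assms(1) unfolding kernels_def
    by (auto intro!: continuous_intros holomorphic_intros)
qed

text \<open>Pole pushing yields the formula only for poles outside the strip. The part of the band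
  left of both integration lines, and likewise the part right of both, is connected and reaches
  outside the strip, so the formula spreads over it. Between the lines it is not claimed; the defect
  there is what \<open>local_band_function\<close> studies.\<close>

lemma fibre_Cauchy_difference_extends:
  assumes z: "z0 \<in> D" "z1 \<in> D"
  obtains X where "X holomorphic_on band"
    "\<And>w. \<lbrakk>w \<in> band; Re w < min (Re z0) (Re z1) \<or> max (Re z0) (Re z1) < Re w\<rbrakk>
       \<Longrightarrow> X w = V.fibre_Cauchy z1 w - V.fibre_Cauchy z0 w"
proof -
  obtain C where C: "C \<ge> 0" "\<And>p m. \<lbrakk>p \<in> kernels; m > 0; \<And>z. z \<in> ends \<Longrightarrow> norm (p z) \<le> m\<rbrakk>
       \<Longrightarrow> norm (V.fibre_integral p z1 - V.fibre_integral p z0) \<le> C * m"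
    using fibre_integral_oscillation[OF z] by metis
  define W where "W = {w. Re w < \<alpha> \<or> \<beta> < Re w}"
  have lin: "V.fibre_integral (\<lambda>z. p z + k * q z) z = V.fibre_integral p z + k * V.fibre_integral q z"
    if "p \<in> kernels" "q \<in> kernels" "z \<in> D" for p q k z
    by (rule V.fibre_integral_lin[where S = "{z. \<alpha> \<le> Re z \<and> Re z \<le> \<beta>}"])
       (use that D_strip[OF that(3)] closure_subset in \<open>auto simp: kernels_def less_imp_le\<close>)
  have inW: "Complex x (lam x) \<in> W \<inter> band" if "x < \<alpha> \<or> \<beta> < x" for x
    using that \<delta> by (auto simp: W_def band_def)
  obtain X where X: "X holomorphic_on band"
    "\<And>w. w \<in> W \<inter> band \<Longrightarrow> X w = V.fibre_integral (\<lambda>z. 1 / (z - w)) z1 - V.fibre_integral (\<lambda>z. 1 / (z - w)) z0"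
  proof (rule Cauchy_kernel_continuation[of kernels "\<lambda>p. V.fibre_integral p z1 - V.fibre_integral p z0" C ends W band])
    show "(\<lambda>z. p z + k * q z) \<in> kernels" if "p \<in> kernels" "q \<in> kernels" for p q k
      using that by (auto simp: kernels_def intro!: continuous_intros holomorphic_intros)
    show "V.fibre_integral (\<lambda>z. p z + k * q z) z1 - V.fibre_integral (\<lambda>z. p z + k * q z) z0
       = V.fibre_integral p z1 - V.fibre_integral p z0 + k * (V.fibre_integral q z1 - V.fibre_integral q z0)"
      if "p \<in> kernels" "q \<in> kernels" for p q k
      using lin that z by (simp add: algebra_simps)
    show "(\<lambda>_. 1) \<in> kernels" by (auto simp: kernels_def)
    show "(\<lambda>z. p z / (z - w)) \<in> kernels" if "p \<in> kernels" "w \<in> W" for p w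
      using that by (intro Cauchy_kernel_in_kernels) (auto simp: W_def)
    have "closed {z. \<delta> \<le> \<bar>Im z - lam (Re z)\<bar>}"
      by (intro closed_Collect_le continuous_intros continuous_on_compose2[OF lam]) auto
    then have "closed ({z. \<alpha> \<le> Re z} \<inter> {z. Re z \<le> \<beta>} \<inter> {z. \<delta> \<le> \<bar>Im z - lam (Re z)\<bar>})"
      by (intro closed_Int closed_halfspace_Re_ge closed_halfspace_Re_le)
    then show "closed ends" by (simp add: ends_def Int_def conj_assoc)
    have "Complex \<alpha> (lam \<alpha> + \<delta>) \<in> ends" using \<alpha>\<beta> \<delta> by (auto simp: ends_def)
    then show "ends \<noteq> {}" by blast
    show "band \<inter> ends = {}" by (auto simp: band_def ends_def)
    show "connected band" using connected_band_section[of UNIV] by simp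
    show "W \<inter> band \<noteq> {}" using inW[of "\<alpha> - 1"] by auto
  qed (use C open_band in auto)
  define T where "T w = V.fibre_Cauchy z1 w - V.fibre_Cauchy z0 w" for w
  have XT: "X w = T w" if "w \<in> W \<inter> band" for w
    using X(2)[OF that] by (simp add: T_def V.fibre_integral_def V.fibre_Cauchy_def)
  have zc: "z0 \<in> closure D" "z1 \<in> closure D" using z closure_subset by auto
  have T_hol: "T holomorphic_on {w. Re w \<noteq> Re z0 \<and> Re w \<noteq> Re z1}"
    unfolding T_def
    by (intro holomorphic_on_diff holomorphic_on_subset[OF V.holomorphic_on_fibre_Cauchy[OF zc(1)]]
        holomorphic_on_subset[OF V.holomorphic_on_fibre_Cauchy[OF zc(2)]]) auto
  \<comment> \<open>\<open>S\<close> is a half-line avoiding both integration lines and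
    \<open>U\<close> is its part outside the strip, where the formula is already known.\<close>
  have sec: "X w = T w" if w: "w \<in> band \<inter> {w. Re w \<in> S}" and S: "convex S" "open S" "U \<subseteq> S" "open U" "U \<noteq> {}"
      "Re z0 \<notin> S" "Re z1 \<notin> S" "\<And>x. x \<in> U \<Longrightarrow> x < \<alpha> \<or> \<beta> < x" for w S U
  proof (rule analytic_continuation_open[of "band \<inter> {w. Re w \<in> U}" "band \<inter> {w. Re w \<in> S}" X T])
    have o: "open {w. Re w \<in> S'}" if "open S'" for S'
      using open_vimage[OF that, of Re] by (simp add: vimage_def continuous_on_Re continuous_on_id)
    show "open (band \<inter> {w. Re w \<in> U})" "open (band \<inter> {w. Re w \<in> S})"
      using S o open_band by auto
    obtain x where "x \<in> U" using S by auto
    then show "band \<inter> {w. Re w \<in> U} \<noteq> {}" using inW S(8) by (auto simp: set_eq_iff intro!: exI[of _ "Complex x (lam x)"])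
    show "connected (band \<inter> {w. Re w \<in> S})" by (rule connected_band_section[OF S(1)])
    show "X holomorphic_on band \<inter> {w. Re w \<in> S}" using X(1) by (rule holomorphic_on_subset) auto
    show "T holomorphic_on band \<inter> {w. Re w \<in> S}" using T_hol by (rule holomorphic_on_subset) (use S in auto)
    show "X w = T w" if "w \<in> band \<inter> {w. Re w \<in> U}" for w
      using that S(8) by (intro XT) (auto simp: W_def)
  qed (use w S in auto)
  have "X w = T w" if "w \<in> band" "Re w < min (Re z0) (Re z1)" for w
    by (rule sec[of _ "{..<min (Re z0) (Re z1)}" "{..<\<alpha>}"]) (use that D_strip[OF z(1)] D_strip[OF z(2)] in auto)
  moreover have "X w = T w" if "w \<in> band" "max (Re z0) (Re z1) < Re w" for w
    by (rule sec[of _ "{max (Re z0) (Re z1)<..}" "{\<beta><..}"]) (use that D_strip[OF z(1)] D_strip[OF z(2)] in auto)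
  ultimately show ?thesis using that[OF X(1)] unfolding T_def by blast
qed

end

context reflected_families
begin

lemma open_band_section: "open (band \<inter> {w. x0 < Re w \<and> Re w < x1})"
proof -
  have "{w. x0 < Re w \<and> Re w < x1} = {w. x0 < Re w} \<inter> {w. Re w < x1}" by auto
  then show ?thesis by (simp add: open_Int open_band open_halfspace_Re_gt open_halfspace_Re_lt)
qed

text \<open>Across the line \<open>Re w = Re z\<close>, the Cauchy transform \<open>fibre_Cauchy z\<close> continues from the right as
  \<open>X' + fibre_Cauchy z0\<close> and from the left as \<open>X' + fibre_Cauchy z0 - Y\<close>, so \<open>Y\<close> is its jump.\<close>

lemma local_band_function:
  assumes z: "z0 \<in> D" "z1 \<in> D" "Re z0 < Re z1"
  obtains Y where "Y holomorphic_on band \<inter> {w. Re z0 < Re w \<and> Re w < Re z1}"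
    "\<And>z t. \<lbrakk>z \<in> D; t \<in> {a..b}; z + \<i> * of_real t \<in> band; Re z0 < Re z; Re z < Re z1\<rbrakk>
       \<Longrightarrow> Y (z + \<i> * of_real t) = - 2 * pi * G t z"
proof -
  obtain X where X: "X holomorphic_on band"
    "\<And>w. \<lbrakk>w \<in> band; Re w < min (Re z0) (Re z1) \<or> max (Re z0) (Re z1) < Re w\<rbrakk>
       \<Longrightarrow> X w = V.fibre_Cauchy z1 w - V.fibre_Cauchy z0 w"
    using fibre_Cauchy_difference_extends[OF z(1,2)] by metis
  define Y where "Y w = X w - V.fibre_Cauchy z1 w + V.fibre_Cauchy z0 w" for w
  define S where "S = band \<inter> {w. Re z0 < Re w \<and> Re w < Re z1}"
  have S: "open S" unfolding S_def by (rule open_band_section)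
  have zc: "z0 \<in> closure D" "z1 \<in> closure D" using z closure_subset by auto
  have J0: "V.fibre_Cauchy z0 holomorphic_on S"
    by (rule holomorphic_on_subset[OF V.holomorphic_on_fibre_Cauchy[OF zc(1)]]) (auto simp: S_def)
  have J1: "V.fibre_Cauchy z1 holomorphic_on S"
    by (rule holomorphic_on_subset[OF V.holomorphic_on_fibre_Cauchy[OF zc(2)]]) (auto simp: S_def)
  have XS: "X holomorphic_on S" by (rule holomorphic_on_subset[OF X(1)]) (auto simp: S_def)
  have Y: "Y holomorphic_on S"
    unfolding Y_def by (intro holomorphic_intros XS J0 J1)
  have "Y (z + \<i> * of_real t) = - 2 * pi * G t z"
    if zD: "z \<in> D" and t: "t \<in> {a..b}" and wB: "z + \<i> * of_real t \<in> band" and zz: "Re z0 < Re z" "Re z < Re z1"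
    for z t
  proof -
    define w where "w = z + \<i> * of_real t"
    have Rew: "Re w = Re z" by (simp add: w_def)
    have wS: "w \<in> S" using wB zz by (simp add: S_def w_def)
    have zcl: "z \<in> closure D" using zD closure_subset by auto
    have tt: "a < t" "t < b"
      using wB below[OF zcl] above[OF zcl] by (auto simp: band_def)
    obtain X' where X': "X' holomorphic_on band"
      "\<And>w. \<lbrakk>w \<in> band; Re w < min (Re z0) (Re z) \<or> max (Re z0) (Re z) < Re w\<rbrakk>
         \<Longrightarrow> X' w = V.fibre_Cauchy z w - V.fibre_Cauchy z0 w"
      using fibre_Cauchy_difference_extends[OF z(1) zD] by metis
    obtain X'' where X'': "X'' holomorphic_on band"
      "\<And>w. \<lbrakk>w \<in> band; Re w < min (Re z) (Re z1) \<or> max (Re z) (Re z1) < Re w\<rbrakk>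
         \<Longrightarrow> X'' w = V.fibre_Cauchy z1 w - V.fibre_Cauchy z w"
      using fibre_Cauchy_difference_extends[OF zD z(2)] by metis
    \<comment> \<open>To the right of all three lines each function is given by its formula and the
      identity is telescoping; connectedness of the band extends it.\<close>
    have add: "X u = X' u + X'' u" if "u \<in> band" for u
    proof (rule analytic_continuation_open[of "band \<inter> {w. Re w \<in> {Re z1<..}}" band X "\<lambda>u. X' u + X'' u"])
      show "open (band \<inter> {w. Re w \<in> {Re z1<..}})"
        by (simp add: open_Int open_band open_halfspace_Re_gt)
      have "Complex (Re z1 + 1) (lam (Re z1 + 1)) \<in> band \<inter> {w. Re w \<in> {Re z1<..}}"
        using \<delta> by (simp add: band_def)
      then show "band \<inter> {w. Re w \<in> {Re z1<..}} \<noteq> {}" by blast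
      show "connected band" using connected_band_section[of UNIV] by simp
      show "X u = X' u + X'' u" if "u \<in> band \<inter> {w. Re w \<in> {Re z1<..}}" for u
        using that zz by (simp add: X(2) X'(2) X''(2))
    qed (use that in \<open>auto intro!: open_band X(1) holomorphic_on_add X'(1) X''(1)\<close>)
    define R where "R u = X' u + V.fibre_Cauchy z0 u" for u
    have R: "R holomorphic_on S"
      unfolding R_def by (intro holomorphic_on_add J0 holomorphic_on_subset[OF X'(1)]) (auto simp: S_def)
    have cR: "isCont R w" and cY: "isCont Y w"
      using R Y S wS by (auto simp: continuous_on_eq_continuous_at dest!: holomorphic_on_imp_continuous_on)
    have lim: "((\<lambda>\<epsilon>::real. w + of_real \<epsilon>) \<longlongrightarrow> w) (at_right 0)" "((\<lambda>\<epsilon>::real. w - of_real \<epsilon>) \<longlongrightarrow> w) (at_right 0)"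
      by (rule tendsto_eq_intros refl | simp)+
    have "((\<lambda>\<epsilon>. R (w + of_real \<epsilon>) - (R (w - of_real \<epsilon>) - Y (w - of_real \<epsilon>))) \<longlongrightarrow> R w - (R w - Y w)) (at_right 0)"
      by (intro tendsto_intros isCont_tendsto_compose[OF cR] isCont_tendsto_compose[OF cY] lim)
    moreover have "\<forall>\<^sub>F \<epsilon> in at_right 0. R (w + of_real \<epsilon>) - (R (w - of_real \<epsilon>) - Y (w - of_real \<epsilon>))
        = V.fibre_Cauchy z (w + of_real \<epsilon>) - V.fibre_Cauchy z (w - of_real \<epsilon>)"
      using topological_tendstoD[OF lim(1) S wS] topological_tendstoD[OF lim(2) S wS] eventually_at_right_less[of 0]
    proof eventually_elim
      case (elim \<epsilon>)
      have "X' (w + of_real \<epsilon>) = V.fibre_Cauchy z (w + of_real \<epsilon>) - V.fibre_Cauchy z0 (w + of_real \<epsilon>)"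
        using elim zz by (intro X'(2)) (auto simp: S_def Rew)
      moreover have "X'' (w - of_real \<epsilon>) = V.fibre_Cauchy z1 (w - of_real \<epsilon>) - V.fibre_Cauchy z (w - of_real \<epsilon>)"
        using elim zz by (intro X''(2)) (auto simp: S_def Rew)
      moreover have "X (w - of_real \<epsilon>) = X' (w - of_real \<epsilon>) + X'' (w - of_real \<epsilon>)"
        using elim by (intro add) (auto simp: S_def)
      ultimately show ?case by (simp add: R_def Y_def)
    qed
    ultimately have "((\<lambda>\<epsilon>. V.fibre_Cauchy z (w + of_real \<epsilon>) - V.fibre_Cauchy z (w - of_real \<epsilon>)) \<longlongrightarrow> R w - (R w - Y w)) (at_right 0)"
      by (rule Lim_transform_eventually)
    from tendsto_unique[OF _ this V.fibre_Cauchy_jump[OF zcl tt, folded w_def]]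
    show ?thesis by (simp add: w_def)
  qed
  then show ?thesis using that Y unfolding S_def by blast
qed

text \<open>\<open>h\<close> is defined by choosing one point \<open>\<zeta> x\<close> of
  \<open>D\<close> on each vertical line and using the translate that carries it to
  \<open>w\<close>. The local functions \<open>Y\<close> show both that \<open>h\<close> is
  holomorphic and that every other point of \<open>D\<close> gives the same value; points of
  \<open>closure D\<close> follow by a limit.\<close>

lemma band_function:
  obtains h where "h holomorphic_on band \<inter> {w. \<alpha> < Re w \<and> Re w < \<beta>}"
    "\<And>z t. \<lbrakk>z \<in> closure D; t \<in> {a..b}; z + \<i> * of_real t \<in> band; \<alpha> < Re z; Re z < \<beta>\<rbrakk>
       \<Longrightarrow> G t z = h (z + \<i> * of_real t)"
proof -
  define \<zeta> where "\<zeta> x = (SOME z. z \<in> D \<and> Re z = x)" for x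
  have \<zeta>: "\<zeta> x \<in> D" "Re (\<zeta> x) = x" if "\<alpha> < x" "x < \<beta>" for x
    using someI_ex[of "\<lambda>z. z \<in> D \<and> Re z = x"] D_proj[OF that] unfolding \<zeta>_def by blast+
  define h where "h w = G (Im w - Im (\<zeta> (Re w))) (\<zeta> (Re w))" for w
  define S where "S = band \<inter> {w. \<alpha> < Re w \<and> Re w < \<beta>}"
  have S: "open S" unfolding S_def by (rule open_band_section)
  have loc: "\<exists>T Y. open T \<and> w \<in> T \<and> T \<subseteq> S \<and> Y holomorphic_on T \<and> (\<forall>u\<in>T. h u = Y u) \<and>
       (\<forall>z\<in>D. \<forall>t\<in>{a..b}. z + \<i> * of_real t \<in> T \<longrightarrow> G t z = Y (z + \<i> * of_real t))" if w: "w \<in> S" for w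
  proof -
    obtain x0 x1 where x: "\<alpha> < x0" "x0 < Re w" "Re w < x1" "x1 < \<beta>"
      using w dense[of \<alpha> "Re w"] dense[of "Re w" \<beta>] unfolding S_def by auto
    then have x': "x0 < \<beta>" "\<alpha> < x1" by auto
    obtain Y where Y: "Y holomorphic_on band \<inter> {w. x0 < Re w \<and> Re w < x1}"
      "\<And>z t. \<lbrakk>z \<in> D; t \<in> {a..b}; z + \<i> * of_real t \<in> band; x0 < Re z; Re z < x1\<rbrakk>
         \<Longrightarrow> Y (z + \<i> * of_real t) = - 2 * pi * G t z"
    proof (rule local_band_function[of "\<zeta> x0" "\<zeta> x1"])
    qed (use x x' \<zeta>[of x0] \<zeta>[of x1] in auto)
    define T where "T = band \<inter> {w. x0 < Re w \<and> Re w < x1}"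
    define Y' where "Y' = (\<lambda>u. Y u / of_real (- 2 * pi))"
    have T: "open T" "w \<in> T" "T \<subseteq> S"
      unfolding T_def S_def using open_band_section w x by (auto simp: S_def)
    have GY: "G t z = Y' (z + \<i> * of_real t)" if "z \<in> D" "t \<in> {a..b}" "z + \<i> * of_real t \<in> T" for z t
      using Y(2)[OF that(1,2)] that(3) by (simp add: T_def Y'_def)
    have "h u = Y' u" if u: "u \<in> T" for u
    proof -
      let ?z = "\<zeta> (Re u)"
      have z: "?z \<in> D" "Re ?z = Re u" using u x \<zeta>[of "Re u"] by (auto simp: T_def)
      have zc: "?z \<in> closure D" using z(1) closure_subset by auto
      have eq: "?z + \<i> * of_real (Im u - Im ?z) = u" using z(2) by (simp add: complex_eq_iff)
      have "Im u - Im ?z \<in> {a..b}"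
        using below[OF zc] above[OF zc] u z(2) by (auto simp: T_def band_def abs_less_iff)
      then show ?thesis using GY[OF z(1), of "Im u - Im ?z"] u unfolding h_def eq by simp
    qed
    moreover have "Y' holomorphic_on T"
      unfolding T_def Y'_def by (intro holomorphic_intros Y(1)) auto
    ultimately show ?thesis using T GY by blast
  qed
  have "h holomorphic_on S"
    unfolding holomorphic_on_open[OF S]
  proof
    fix w assume "w \<in> S"
    from loc[OF this] obtain T Y where T: "open T" "w \<in> T" "Y holomorphic_on T" "\<forall>u\<in>T. h u = Y u" by blast
    then have "h holomorphic_on T" using holomorphic_cong[of T T h Y] by simp
    then show "\<exists>f'. (h has_field_derivative f') (at w)" using T holomorphic_on_open by blast
  qed
  moreover have "G t z = h (z + \<i> * of_real t)"
    if z: "z \<in> closure D" and t: "t \<in> {a..b}" and wB: "z + \<i> * of_real t \<in> band" and zz: "\<alpha> < Re z" "Re z < \<beta>" for z t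
  proof -
    have wS: "z + \<i> * of_real t \<in> S" using wB zz by (simp add: S_def)
    obtain \<sigma> where \<sigma>: "\<And>n. \<sigma> n \<in> D" "\<sigma> \<longlonglongrightarrow> z" using z closure_sequential by blast
    have lim: "(\<lambda>n. \<sigma> n + \<i> * of_real t) \<longlonglongrightarrow> z + \<i> * of_real t" by (intro tendsto_intros \<sigma>(2))
    have ev: "\<forall>\<^sub>F n in sequentially. G t (\<sigma> n) = h (\<sigma> n + \<i> * of_real t)"
      using topological_tendstoD[OF lim S wS]
    proof eventually_elim
      case (elim n)
      from loc[OF this] obtain T Y where "\<sigma> n + \<i> * of_real t \<in> T" "\<forall>u\<in>T. h u = Y u"
        "\<forall>z\<in>D. \<forall>t\<in>{a..b}. z + \<i> * of_real t \<in> T \<longrightarrow> G t z = Y (z + \<i> * of_real t)" by blast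
      then show ?case using \<sigma>(1) t by simp
    qed
    have l1: "(\<lambda>n. G t (\<sigma> n)) \<longlonglongrightarrow> G t z"
      by (rule continuous_on_tendsto_compose[OF V.cont_G'[OF t] \<sigma>(2) z])
         (use \<sigma>(1) closure_subset in \<open>auto intro!: always_eventually\<close>)
    have l2: "(\<lambda>n. h (\<sigma> n + \<i> * of_real t)) \<longlonglongrightarrow> h (z + \<i> * of_real t)"
    proof (rule isCont_tendsto_compose[OF _ lim])
      show "isCont h (z + \<i> * of_real t)"
        using \<open>h holomorphic_on S\<close> S wS
        by (auto simp: continuous_on_eq_continuous_at dest!: holomorphic_on_imp_continuous_on)
    qed
    show ?thesis by (rule LIMSEQ_unique[OF Lim_transform_eventually[OF l1 ev] l2])
  qed
  ultimately show ?thesis using that unfolding S_def by blast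
qed

end

section \<open>Propagation away from the graph\<close>

text \<open>The product of \<open>\<psi>\<close> over finitely many rotations about \<open>c\<close> that together move every point of
  the circle into the exterior of \<open>D\<close> vanishes on the boundary of the region where it is holomorphic.\<close>

lemma zero_of_zero_on_boundary_arc:
  assumes "open D" and cont: "continuous_on U \<psi>" and hol: "\<psi> holomorphic_on U \<inter> D"
    and zero: "\<And>z. z \<in> U - D \<Longrightarrow> \<psi> z = 0"
    and e: "e \<notin> closure D" "e \<noteq> c" and U: "cball c (dist c e) \<subseteq> U"
  shows "\<psi> c = 0"
proof (cases "c \<in> D")
  case False
  moreover have "c \<in> U" using U by auto
  ultimately show ?thesis using zero by simp
next
  case True
  define \<rho> where "\<rho> = dist c e"
  have \<rho>: "\<rho> > 0" using e by (simp add: \<rho>_def)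
  obtain \<eta> where \<eta>: "\<eta> > 0" "ball e \<eta> \<subseteq> - closure D"
    using e(1) by (meson ComplI closed_closure open_Compl openE)
  \<comment> \<open>Rotation about \<open>c\<close> by \<open>\<xi> z\<close> takes \<open>z\<close>
    to \<open>e\<close>, and \<open>V z\<close> collects the points that the same rotation puts into
    the exterior disc about \<open>e\<close>.\<close>
  define \<xi> where "\<xi> z = (e - c) / (z - c)" for z
  define V where "V z = {z'. c + \<xi> z * (z' - c) \<in> ball e \<eta>}" for z
  have oV: "open (V z)" for z
  proof -
    have "V z = (\<lambda>z'. c + \<xi> z * (z' - c)) -` ball e \<eta>" by (auto simp: V_def)
    then show ?thesis by (simp only:) (intro open_vimage open_ball continuous_intros)
  qed
  have cov: "sphere c \<rho> \<subseteq> (\<Union>z\<in>sphere c \<rho>. V z)"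
  proof
    fix z assume z: "z \<in> sphere c \<rho>"
    then have "z \<noteq> c" using \<rho> by auto
    then have "z \<in> V z" using \<eta>(1) by (simp add: V_def \<xi>_def)
    then show "z \<in> (\<Union>z\<in>sphere c \<rho>. V z)" using z by blast
  qed
  obtain C where C: "C \<subseteq> sphere c \<rho>" "finite C" "sphere c \<rho> \<subseteq> (\<Union>z\<in>C. V z)"
    using compactE_image[OF compact_sphere oV cov] by metis
  define \<Xi> where "\<Xi> = \<xi> ` C"
  have fin: "finite \<Xi>" using C by (simp add: \<Xi>_def)
  have n1: "norm k = 1" if k: "k \<in> \<Xi>" for k
  proof -
    obtain z where "z \<in> C" "k = \<xi> z" using k by (auto simp: \<Xi>_def)
    moreover from this have "z \<in> sphere c \<rho>" using C(1) by blast
    ultimately show ?thesis using \<rho> by (auto simp: \<xi>_def norm_divide \<rho>_def dist_norm norm_minus_commute)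
  qed
  have rot: "c + k * (z - c) \<in> cball c \<rho>" if "k \<in> \<Xi>" "z \<in> cball c \<rho>" for k z
    using that n1[OF that(1)] by (simp add: dist_norm norm_mult norm_minus_commute)
  have rotU: "c + k * (z - c) \<in> U" if "k \<in> \<Xi>" "z \<in> cball c \<rho>" for k z
    using rot[OF that] U unfolding \<rho>_def by auto
  \<comment> \<open>The points of the disc all of whose rotates lie in \<open>D\<close>. At a
    frontier point of \<open>W\<close> some rotate is outside \<open>D\<close> and its factor in
    \<open>\<Psi>\<close> vanishes, whereas \<open>c\<close> is fixed by every rotation, so that
    \<open>\<Psi> c\<close> is a power of \<open>\<psi> c\<close>.\<close>
  define W where "W = ball c \<rho> \<inter> (\<Inter>k\<in>\<Xi>. (\<lambda>z. c + k * (z - c)) -` D)"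
  have oW: "open W"
    unfolding W_def
    by (intro open_Int open_ball open_INT fin ballI open_vimage \<open>open D\<close> continuous_intros)
  have clW: "closure W \<subseteq> cball c \<rho>"
    by (rule closure_minimal) (auto simp: W_def)
  define \<Psi> where "\<Psi> z = (\<Prod>k\<in>\<Xi>. \<psi> (c + k * (z - c)))" for z
  have "norm (\<Psi> c) \<le> 0"
  proof (rule maximum_modulus_frontier[of \<Psi> W])
    have hk: "(\<lambda>z. \<psi> (c + k * (z - c))) holomorphic_on W" if "k \<in> \<Xi>" for k
    proof -
      have "(\<psi> \<circ> (\<lambda>z. c + k * (z - c))) holomorphic_on W"
      proof (rule holomorphic_on_compose_gen[OF _ hol])
        show "(\<lambda>z. c + k * (z - c)) ` W \<subseteq> U \<inter> D"
          using rotU[OF that] that by (auto simp: W_def)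
      qed (intro holomorphic_intros)
      then show ?thesis by (simp add: o_def)
    qed
    show "\<Psi> holomorphic_on interior W"
      unfolding \<Psi>_def interior_open[OF oW] by (intro holomorphic_on_prod hk)
    show "continuous_on (closure W) \<Psi>"
      unfolding \<Psi>_def
    proof (intro continuous_on_prod)
      fix k assume "k \<in> \<Xi>"
      then show "continuous_on (closure W) (\<lambda>z. \<psi> (c + k * (z - c)))"
        using clW rotU by (intro continuous_on_compose2[OF cont]) (auto intro!: continuous_intros)
    qed
    show "bounded W" using bounded_ball bounded_subset by (fastforce simp: W_def)
    fix z assume z: "z \<in> frontier W"
    then have zc: "z \<in> cball c \<rho>" and zW: "z \<notin> W"
      using clW oW by (auto simp: frontier_def interior_open)
    have "\<exists>k\<in>\<Xi>. c + k * (z - c) \<notin> D"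
    proof (cases "z \<in> ball c \<rho>")
      case True
      then show ?thesis using zW by (auto simp: W_def)
    next
      case False
      then have "z \<in> sphere c \<rho>" using zc by auto
      then obtain y where "y \<in> C" "z \<in> V y" using C(3) by auto
      then have "c + \<xi> y * (z - c) \<in> - closure D" using \<eta> by (auto simp: V_def)
      then have "c + \<xi> y * (z - c) \<notin> D" using closure_subset by auto
      then show ?thesis using \<open>y \<in> C\<close> by (auto simp: \<Xi>_def)
    qed
    then obtain k where "k \<in> \<Xi>" "\<psi> (c + k * (z - c)) = 0" using zero rotU zc by blast
    then show "norm (\<Psi> z) \<le> 0" using fin by (auto simp: \<Psi>_def intro!: prod_zero)
  next
    show "c \<in> W" using True \<rho> by (simp add: W_def)
  qed
  then show ?thesis using fin by (auto simp: \<Psi>_def)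
qed

lemma first_exit:
  fixes \<gamma> :: "real \<Rightarrow> 'a::real_normed_vector"
  assumes "continuous_on {0..L} \<gamma>" "open D" "\<gamma> 0 \<in> D" "\<gamma> L \<notin> D" "0 \<le> L"
  obtains s where "0 < s" "s \<le> L" "\<gamma> s \<in> frontier D" "\<And>r. 0 \<le> r \<Longrightarrow> r < s \<Longrightarrow> \<gamma> r \<in> D"
proof -
  define K where "K = {0..L} \<inter> \<gamma> -` (- D)"
  have "closed K" unfolding K_def
    by (rule continuous_closed_preimage[OF assms(1)]) (use assms(2) in auto)
  have "bdd_below K" by (auto simp: K_def bdd_below_def)
  have LK: "L \<in> K" using assms by (simp add: K_def)
  define s where "s = Inf K"
  have sK: "s \<in> K" unfolding s_def
    by (rule closed_contains_Inf) (use \<open>closed K\<close> \<open>bdd_below K\<close> LK in auto)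
  have lt: "\<gamma> r \<in> D" if "0 \<le> r" "r < s" for r
  proof (rule ccontr)
    assume "\<gamma> r \<notin> D"
    then have "r \<in> K" using that sK by (auto simp: K_def)
    then show False using cInf_lower[OF _ \<open>bdd_below K\<close>] that(2) unfolding s_def by fastforce
  qed
  have s0: "0 < s" using sK assms(3) by (cases "s = 0") (auto simp: K_def)
  have "\<gamma> s \<in> closure D"
  proof -
    have "continuous_on (closure {0..<s}) \<gamma>"
      by (rule continuous_on_subset[OF assms(1)]) (use s0 sK in \<open>auto simp: K_def\<close>)
    then have "\<gamma> ` closure {0..<s} \<subseteq> closure D"
      by (rule image_closure_subset) (use lt subsetD[OF closure_subset, of _ D] in auto)
    then show ?thesis using s0 by auto
  qed
  then have "\<gamma> s \<in> frontier D" using sK assms(2) by (auto simp: K_def frontier_def interior_open)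
  then show ?thesis using that[of s] s0 sK lt by (auto simp: K_def)
qed

section \<open>Independence of the extension from the translate\<close>

text \<open>From here on the reflected domain is gone; all that is kept of it is the function
  \<open>h\<close>.\<close>

locale banded_family = vertical_family D a b f G for D a b f G +
  fixes \<alpha> \<beta> \<delta> :: real and lam :: "real \<Rightarrow> real" and h :: "complex \<Rightarrow> complex"
  assumes lam: "continuous_on UNIV lam" and \<delta>: "\<delta> > 0"
    and D_nonempty: "D \<noteq> {}"
    and D_strip: "\<And>z. z \<in> D \<Longrightarrow> \<alpha> < Re z \<and> Re z < \<beta>"
    and below: "\<And>z. z \<in> closure D \<Longrightarrow> a + Im z < lam (Re z) - \<delta>"
    and above: "\<And>z. z \<in> closure D \<Longrightarrow> lam (Re z) + \<delta> < b + Im z"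
    and h: "\<And>z t. \<lbrakk>z \<in> closure D; t \<in> {a..b}; \<bar>Im (z + \<i> * of_real t) - lam (Re z)\<bar> < \<delta>; \<alpha> < Re z; Re z < \<beta>\<rbrakk>
       \<Longrightarrow> G t z = h (z + \<i> * of_real t)"
    and exterior: "\<And>p \<rho>. p \<in> frontier D \<Longrightarrow> \<rho> > 0 \<Longrightarrow> \<exists>e\<in>ball p \<rho>. e \<notin> closure D"
    and cont_f: "continuous_on (\<Union>t\<in>{a..b}. vshift t (frontier D)) f"
begin

text \<open>\<open>z'\<close> displaced by \<open>t\<close> and
  \<open>z' + \<i> * of_real (t - t')\<close> displaced by \<open>t'\<close> are the same point of
  the plane. So the extensions from all translates near \<open>t\<close> agree near
  \<open>z + \<i> * of_real t\<close>, with one radius for points and times.\<close>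

definition flow_constant_at :: "real \<Rightarrow> complex \<Rightarrow> bool" where
  "flow_constant_at t z \<longleftrightarrow> (\<exists>r>0. \<forall>z'\<in>ball z r. \<forall>t'\<in>{a..b}. \<bar>t' - t\<bar> < r \<longrightarrow>
      G t' (z' + \<i> * of_real (t - t')) = G t z')"

lemma frontier_not_in_domain: "z \<in> frontier D \<Longrightarrow> z \<in> closure D \<and> z \<notin> D"
  using D(1) by (auto simp: frontier_def interior_open)

lemma holomorphic_translate:
  assumes "t \<in> {a..b}" "\<And>z. z \<in> S \<Longrightarrow> z + w \<in> D"
  shows "(\<lambda>z. G t (z + w)) holomorphic_on S"
proof -
  have "(G t \<circ> (\<lambda>z. z + w)) holomorphic_on S"
    by (rule holomorphic_on_compose_gen[OF _ hol_G[OF assms(1)]])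
       (use assms(2) in \<open>auto intro!: holomorphic_intros\<close>)
  then show ?thesis by (simp add: o_def)
qed

text \<open>For fixed \<open>t'\<close> both sides of the defining equation are holomorphic in
  \<open>z'\<close>. The identity theorem spreads it over a disc whose double still lies in
  \<open>D\<close>, which leaves room for the displacement, and connectedness spreads it over
  \<open>D\<close>.\<close>

lemma flow_constant_at_propagates:
  assumes t: "t \<in> {a..b}" and z: "z0 \<in> D" "z1 \<in> D" and fc: "flow_constant_at t z0"
  shows "flow_constant_at t z1"
proof -
  have "flow_constant_at t z0 \<longleftrightarrow> flow_constant_at t z1"
  proof (rule connected_equivalence_relation[OF D(2) z])
    fix x assume "x \<in> D"
    then obtain \<rho>' where \<rho>': "\<rho>' > 0" "ball x \<rho>' \<subseteq> D" using D(1) openE by blast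
    define \<rho> where "\<rho> = \<rho>' / 2"
    have \<rho>: "\<rho> > 0" "ball x (2 * \<rho>) \<subseteq> D" using \<rho>' by (auto simp: \<rho>_def)
    have imp: "flow_constant_at t y'" if y: "y \<in> ball x \<rho>" and y': "y' \<in> ball x \<rho>" and fc: "flow_constant_at t y" for y y'
    proof -
      obtain r2 where r2: "r2 > 0" "\<And>z' t'. z' \<in> ball y r2 \<Longrightarrow> t' \<in> {a..b} \<Longrightarrow> \<bar>t' - t\<bar> < r2 \<Longrightarrow>
          G t' (z' + \<i> * of_real (t - t')) = G t z'"
        using fc unfolding flow_constant_at_def by blast
      define r where "r = Min {r2, \<rho>, \<rho> - dist x y'}"
      have r: "r > 0" "r \<le> r2" "r \<le> \<rho>" "r \<le> \<rho> - dist x y'" using r2 \<rho> y' zero_le_dist[of x y'] by (auto simp: r_def simp del: zero_le_dist)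
      have "G t' (z' + \<i> * of_real (t - t')) = G t z'" if z': "z' \<in> ball y' r" and t': "t' \<in> {a..b}" "\<bar>t' - t\<bar> < r" for z' t'
      proof (rule analytic_continuation_open[of "ball x \<rho> \<inter> ball y r2" "ball x \<rho>" "\<lambda>z'. G t' (z' + \<i> * of_real (t - t'))" "G t"])
        have "y \<in> ball x \<rho> \<inter> ball y r2" using y r2 by simp
        then show "ball x \<rho> \<inter> ball y r2 \<noteq> {}" by blast
        show "(\<lambda>z'. G t' (z' + \<i> * of_real (t - t'))) holomorphic_on ball x \<rho>"
        proof (rule holomorphic_translate[OF t'(1)])
          fix z assume "z \<in> ball x \<rho>"
          moreover have "norm (\<i> * of_real (t - t') :: complex) < \<rho>"
            using t'(2) r(3) by (simp only: norm_mult norm_of_real) (simp add: abs_minus_commute)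
          ultimately have "z + \<i> * of_real (t - t') \<in> ball x (2 * \<rho>)"
            using norm_triangle_lt[of "z - x" "\<i> * of_real (t - t')" "2 * \<rho>"]
            by (simp add: dist_norm norm_minus_commute algebra_simps)
          then show "z + \<i> * of_real (t - t') \<in> D" using \<rho> by blast
        qed
        have "ball x \<rho> \<subseteq> D" using \<rho> by (auto simp: subset_iff)
        then show "G t holomorphic_on ball x \<rho>" using hol_G[OF t] holomorphic_on_subset by blast
        show "G t' (z + \<i> * of_real (t - t')) = G t z" if "z \<in> ball x \<rho> \<inter> ball y r2" for z
          using that r2(2)[of z t'] t' r by auto
        have "dist x z' \<le> dist x y' + dist y' z'" by (rule dist_triangle)
        then show "z' \<in> ball x \<rho>" using z' r(4) by simp
      qed auto
      then show ?thesis unfolding flow_constant_at_def using r(1) by blast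
    qed
    have "flow_constant_at t x = flow_constant_at t y" if "y \<in> ball x \<rho>" for y
      using imp[of x y] imp[of y x] that \<rho> by auto
    then show "\<exists>T. openin (top_of_set D) T \<and> x \<in> T \<and> (\<forall>y\<in>T. flow_constant_at t x = flow_constant_at t y)"
      using \<rho> by (intro exI[of _ "ball x \<rho>"]) (auto intro!: open_subset simp: subset_iff)
  qed auto
  then show ?thesis using fc by simp
qed

lemma flow_constant_at_band:
  assumes t: "t \<in> {a..b}" and z: "z \<in> D" and band: "\<bar>Im (z + \<i> * of_real t) - lam (Re z)\<bar> < \<delta>"
  shows "flow_constant_at t z"
proof -
  define S where "S = {w. \<bar>Im w - lam (Re w)\<bar> < \<delta>}"
  have "open S" unfolding S_def
    by (intro open_Collect_less continuous_intros continuous_on_compose2[OF lam]) auto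
  moreover have "z + \<i> * of_real t \<in> S" using band by (simp add: S_def)
  ultimately obtain r1 where r1: "r1 > 0" "ball (z + \<i> * of_real t) r1 \<subseteq> S" using openE by blast
  obtain r2 where r2: "r2 > 0" "ball z r2 \<subseteq> D" using D(1) z openE by blast
  define r where "r = min r1 (r2 / 2)"
  have r: "r > 0" using r1 r2 by (simp add: r_def)
  have "G t' (z' + \<i> * of_real (t - t')) = G t z'" if z': "z' \<in> ball z r" and t': "t' \<in> {a..b}" "\<bar>t' - t\<bar> < r" for z' t'
  proof -
    have "z' + \<i> * of_real t \<in> ball (z + \<i> * of_real t) r1" using z' by (simp add: r_def dist_norm)
    then have S: "z' + \<i> * of_real t \<in> S" using r1 by blast
    have "norm (\<i> * of_real (t - t') :: complex) < r"
      using t'(2) by (simp only: norm_mult norm_of_real) (simp add: abs_minus_commute)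
    then have "norm ((z' - z) + \<i> * of_real (t - t')) < r + r"
      using z' by (intro norm_triangle_lt add_strict_mono) (simp_all add: dist_norm norm_minus_commute)
    then have "z' + \<i> * of_real (t - t') \<in> ball z r2"
      by (simp add: r_def dist_norm norm_minus_commute algebra_simps)
    then have D': "z' + \<i> * of_real (t - t') \<in> D" using r2 by blast
    have "z' \<in> ball z r2" using z' r2 by (auto simp: r_def)
    then have "z' \<in> D" using r2 by blast
    have eq: "(z' + \<i> * of_real (t - t')) + \<i> * of_real t' = z' + \<i> * of_real t" by (simp add: algebra_simps)
    have "G t' (z' + \<i> * of_real (t - t')) = h ((z' + \<i> * of_real (t - t')) + \<i> * of_real t')"
      by (rule h) (use D' t'(1) closure_subset D_strip[OF D'] S in \<open>auto simp: S_def\<close>)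
    also have "\<dots> = G t z'"
      unfolding eq by (rule h[symmetric]) (use \<open>z' \<in> D\<close> t closure_subset D_strip[OF \<open>z' \<in> D\<close>] S in \<open>auto simp: S_def\<close>)
    finally show ?thesis .
  qed
  then show ?thesis unfolding flow_constant_at_def using r by blast
qed

text \<open>The value at a fixed point \<open>w\<close> is locally constant in time on the connected
  set \<open>K\<close>. Passing to \<open>closure K\<close> allows an end time at which
  \<open>w\<close> lies on the boundary of the translate.\<close>

lemma flow_constant:
  assumes K: "connected K" "K \<subseteq> {a..b}" and KD: "\<And>t. t \<in> K \<Longrightarrow> w - \<i> * of_real t \<in> D \<and> flow_constant_at t (w - \<i> * of_real t)"
    and s: "s \<in> K" and u: "u \<in> closure K"
  shows "G s (w - \<i> * of_real s) = G u (w - \<i> * of_real u)"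
proof -
  define g where "g t = G t (w - \<i> * of_real t)" for t
  have const: "g t = g s" if "t \<in> K" for t
  proof (rule connected_equivalence_relation[OF K(1) that s])
    fix x assume x: "x \<in> K"
    obtain r where r: "r > 0" "\<And>z' t'. z' \<in> ball (w - \<i> * of_real x) r \<Longrightarrow> t' \<in> {a..b} \<Longrightarrow> \<bar>t' - x\<bar> < r \<Longrightarrow>
          G t' (z' + \<i> * of_real (x - t')) = G x z'"
      using KD[OF x] unfolding flow_constant_at_def by blast
    have "g x = g y" if "y \<in> K \<inter> ball x r" for y
    proof -
      have "G y ((w - \<i> * of_real x) + \<i> * of_real (x - y)) = G x (w - \<i> * of_real x)"
        by (rule r(2)) (use that K r in \<open>auto simp: dist_real_def abs_minus_commute\<close>)
      then show ?thesis by (simp add: g_def algebra_simps)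
    qed
    then show "\<exists>T. openin (top_of_set K) T \<and> x \<in> T \<and> (\<forall>y\<in>T. g x = g y)"
      using r x by (intro exI[of _ "K \<inter> ball x r"]) (auto simp: openin_open_Int)
  qed auto
  have "closure K \<subseteq> {a..b}" by (rule closure_minimal) (use K in auto)
  moreover have "(\<lambda>t. w - \<i> * of_real t) ` closure K \<subseteq> closure D"
    by (rule image_closure_subset) (use KD closure_subset in \<open>auto intro!: continuous_intros\<close>)
  ultimately have "continuous_on (closure K) (\<lambda>t. (\<lambda>(t,z). G t z) (t, w - \<i> * of_real t))"
    by (intro continuous_on_compose2[OF cont_G]) (auto intro!: continuous_intros)
  then have "continuous_on (closure K) g" by (simp add: g_def)
  from continuous_constant_on_closure[OF this const u] show ?thesis by (simp add: g_def)
qed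

text \<open>A point on or below the graph is not in the translate at \<open>b\<close>, a point above
  it is not in the translate at \<open>a\<close>. Moving \<open>t\<close> towards that end, the
  point must leave \<open>D\<close> through its boundary.\<close>

lemma translates_subset:
  assumes z: "z \<in> D" and t: "t \<in> {a..b}"
  shows "z + \<i> * of_real t \<in> (\<Union>t\<in>{a..b}. vshift t (frontier D))"
proof -
  let ?w = "z + \<i> * of_real t"
  obtain \<sigma> L :: real where \<sigma>: "\<bar>\<sigma>\<bar> = 1" "0 \<le> L" "\<And>s. 0 \<le> s \<Longrightarrow> s \<le> L \<Longrightarrow> t + \<sigma> * s \<in> {a..b}"
      "?w - \<i> * of_real (t + \<sigma> * L) \<notin> D"
  proof (cases "Im ?w \<le> lam (Re ?w)")
    case True
    then have "?w - \<i> * of_real b \<notin> D"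
      using above[of "?w - \<i> * of_real b"] closure_subset \<delta> by fastforce
    then show ?thesis using that[of 1 "b - t"] t by auto
  next
    case False
    then have "?w - \<i> * of_real a \<notin> D"
      using below[of "?w - \<i> * of_real a"] closure_subset \<delta> by fastforce
    then show ?thesis using that[of "-1" "t - a"] t by auto
  qed
  obtain s where "0 < s" "s \<le> L" "?w - \<i> * of_real (t + \<sigma> * s) \<in> frontier D"
    by (rule first_exit[of L "\<lambda>s. ?w - \<i> * of_real (t + \<sigma> * s)" D])
       (use \<sigma> z D(1) in \<open>auto intro!: continuous_intros\<close>)
  then show ?thesis using \<sigma>(3)[of s] by (auto simp: vshift_mem_iff intro!: bexI[of _ "t + \<sigma> * s"])
qed

end

text \<open>Finiteness isolates the lines, so that each small disc is cut by at most one; a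
  continuous function holomorphic on both sides of a line is holomorphic across it.\<close>

lemma holomorphic_on_off_vertical_lines:
  assumes S: "open S" and V: "finite V" and cont: "continuous_on S f"
    and hol: "f holomorphic_on S \<inter> {z. Re z \<notin> V}"
  shows "f holomorphic_on S"
  unfolding holomorphic_on_open[OF S]
proof
  fix w assume "w \<in> S"
  then obtain r where r: "r > 0" "ball w r \<subseteq> S" using S openE by blast
  have "closed (V - {Re w})" by (intro finite_imp_closed finite_Diff V)
  then obtain \<epsilon> where \<epsilon>: "\<epsilon> > 0" "ball (Re w) \<epsilon> \<subseteq> - (V - {Re w})"
    by (meson Compl_iff Diff_iff insertI1 open_Compl openE)
  define \<rho> where "\<rho> = min r \<epsilon>"
  have \<rho>: "\<rho> > 0" using r \<epsilon> by (simp add: \<rho>_def)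
  have B: "z \<in> S \<inter> {z. Re z \<notin> V}" if "z \<in> ball w \<rho>" "Re z \<noteq> Re w" for z
  proof -
    have "dist (Re w) (Re z) \<le> dist w z"
      using abs_Re_le_cmod[of "w - z"] by (simp add: dist_norm)
    then have "Re z \<in> ball (Re w) \<epsilon>" "z \<in> ball w r" using that(1) by (auto simp: \<rho>_def)
    then show ?thesis using r \<epsilon> that(2) by blast
  qed
  have "f holomorphic_on ball w \<rho>"
  proof (rule holomorphic_on_paste_across_line[of "ball w \<rho>" 1 f "Re w"])
    show "f holomorphic_on ball w \<rho> \<inter> {z. 1 \<bullet> z < Re w}"
      by (rule holomorphic_on_subset[OF hol]) (use B in \<open>auto simp: inner_complex_def\<close>)
    show "f holomorphic_on ball w \<rho> \<inter> {z. Re w < 1 \<bullet> z}"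
      by (rule holomorphic_on_subset[OF hol]) (use B in \<open>auto simp: inner_complex_def\<close>)
    show "continuous_on (ball w \<rho>) f"
      by (rule continuous_on_subset[OF cont]) (use r in \<open>auto simp: \<rho>_def subset_iff\<close>)
  qed auto
  then show "\<exists>f'. (f has_field_derivative f') (at w)"
    using \<rho> holomorphic_on_open[OF open_ball] by (metis centre_in_ball)
qed

section \<open>From the band to all translates\<close>

context banded_family
begin

text \<open>If \<open>zm\<close> has been moved up from a position in the band, it is still in the
  band or above it. In the second case a point \<open>z\<close> on or below the graph gives a height
  \<open>\<phi>\<close> of the other sign, and connectedness of \<open>D\<close> yields a zero. The
  downward case is symmetric.\<close>

lemma translate_meets_band:
  assumes zm: "zm \<in> D" "\<bar>Im zm + tm - lam (Re zm)\<bar> < \<delta>" and z: "z \<in> D"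
    and or: "(tm \<le> u \<and> Im z + u \<le> lam (Re z)) \<or> (u \<le> tm \<and> lam (Re z) \<le> Im z + u)"
  shows "\<exists>z'\<in>D. \<bar>Im z' + u - lam (Re z')\<bar> < \<delta>"
proof -
  define \<phi> where "\<phi> z = Im z + u - lam (Re z)" for z
  have "continuous_on D \<phi>"
    unfolding \<phi>_def by (intro continuous_intros continuous_on_compose2[OF lam]) auto
  then have conn: "connected (\<phi> ` D)" using D(2) by (rule connected_continuous_image)
  show ?thesis
  proof (cases "\<bar>\<phi> zm\<bar> < \<delta>")
    case True
    then show ?thesis using zm(1) unfolding \<phi>_def by blast
  next
    case False
    then have "(\<phi> z \<le> 0 \<and> 0 \<le> \<phi> zm) \<or> (\<phi> zm \<le> 0 \<and> 0 \<le> \<phi> z)"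
      using or zm(2) \<delta> unfolding \<phi>_def by linarith
    then have "0 \<in> \<phi> ` D"
      using connectedD_interval[OF conn, of "\<phi> z" "\<phi> zm" 0] connectedD_interval[OF conn, of "\<phi> zm" "\<phi> z" 0]
        z zm(1) by blast
    then obtain z' where "z' \<in> D" "\<phi> z' = 0" by auto
    then show ?thesis using \<delta> by (intro bexI[of _ z']) (simp_all add: \<phi>_def)
  qed
qed

text \<open>In the band, \<open>f w\<close> and \<open>G t z\<close> both equal \<open>h w\<close>.
  Below it, move \<open>t\<close> up, and above it, move \<open>t\<close> down, until
  \<open>w\<close> reaches the boundary of a translate, where \<open>f\<close> and the extension
  agree. On the way either the time lies between \<open>tm\<close> and \<open>t\<close>, or the
  translate containing \<open>w\<close> meets the band; in both cases the extension at
  \<open>w\<close> does not change.\<close>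

lemma value_inside:
  assumes zm: "zm \<in> D" "\<bar>Im zm + tm - lam (Re zm)\<bar> < \<delta>"
    and t: "t \<in> {a..b}" and fc: "\<And>s z. s \<in> closed_segment tm t \<Longrightarrow> z \<in> D \<Longrightarrow> flow_constant_at s z"
    and z: "z \<in> D"
  shows "f (z + \<i> * of_real t) = G t z"
proof -
  define w where "w = z + \<i> * of_real t"
  have zw: "w - \<i> * of_real t = z" by (simp add: w_def)
  have fc_ext: "flow_constant_at t' z'"
    if t': "t' \<in> {a..b}" and z': "z' \<in> D"
      and or: "t' \<in> closed_segment tm t \<or> (tm \<le> t' \<and> Im z' + t' \<le> lam (Re z')) \<or> (t' \<le> tm \<and> lam (Re z') \<le> Im z' + t')" for t' z'
  proof (cases "t' \<in> closed_segment tm t")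
    case True
    then show ?thesis using fc z' by blast
  next
    case False
    then obtain z'' where "z'' \<in> D" "\<bar>Im z'' + t' - lam (Re z'')\<bar> < \<delta>"
      using translate_meets_band[OF zm z'] or by blast
    then have "flow_constant_at t' z''" using flow_constant_at_band[OF t'] by simp
    then show ?thesis using flow_constant_at_propagates[OF t' \<open>z'' \<in> D\<close> z'] by blast
  qed
  consider "\<bar>Im w - lam (Re w)\<bar> < \<delta>" | "Im w \<le> lam (Re w) - \<delta>" | "lam (Re w) + \<delta> \<le> Im w" by linarith
  then have "f w = G t (w - \<i> * of_real t)"
  proof cases
    case 1
    obtain t1 where t1: "t1 \<in> {a..b}" "w - \<i> * of_real t1 \<in> frontier D"
      using translates_subset[OF z t] unfolding w_def by (auto simp: vshift_mem_iff)
    have st: "\<alpha> < Re w" "Re w < \<beta>" using D_strip[OF z] by (auto simp: w_def)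
    have "f w = G t1 (w - \<i> * of_real t1)" using bd_G[OF t1] by simp
    also have "\<dots> = h w"
      using h[of "w - \<i> * of_real t1" t1] t1 frontier_not_in_domain[OF t1(2)] 1 st by simp
    also have "h w = G t z"
      using h[of z t] z t closure_subset 1 st unfolding w_def by fastforce
    finally show ?thesis by (simp add: zw)
  next
    case 2
    have "w - \<i> * of_real b \<notin> D" using above[of "w - \<i> * of_real b"] subsetD[OF closure_subset, of _ D] 2 \<delta> by force
    then have exit: "w - \<i> * of_real (t + (b - t)) \<notin> D" by (simp add: algebra_simps)
    have start: "w - \<i> * of_real (t + 0) \<in> D" "0 \<le> b - t" using z t zw by auto
    have cont: "continuous_on {0..b - t} (\<lambda>s. w - \<i> * of_real (t + s))" by (intro continuous_intros)
    obtain s where s: "0 < s" "s \<le> b - t" "w - \<i> * of_real (t + s) \<in> frontier D"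
        "\<And>r. 0 \<le> r \<Longrightarrow> r < s \<Longrightarrow> w - \<i> * of_real (t + r) \<in> D"
      using first_exit[OF cont D(1) start(1) exit start(2)] by blast
    have "G t (w - \<i> * of_real t) = G (t + s) (w - \<i> * of_real (t + s))"
    proof (rule flow_constant[of "{t..<t+s}"])
      fix t' assume t': "t' \<in> {t..<t+s}"
      then have zD: "w - \<i> * of_real t' \<in> D" using s(4)[of "t' - t"] by auto
      have "t' \<in> closed_segment tm t \<or> tm \<le> t'" using t' by (auto simp: closed_segment_eq_real_ivl)
      then show "w - \<i> * of_real t' \<in> D \<and> flow_constant_at t' (w - \<i> * of_real t')"
        using fc_ext[OF _ zD] t' t s(2) 2 \<delta> zD by auto
    qed (use s t in auto)
    also have "\<dots> = f w" using bd_G[OF _ s(3)] s(1,2) t by simp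
    finally show ?thesis by simp
  next
    case 3
    have "w - \<i> * of_real a \<notin> D" using below[of "w - \<i> * of_real a"] subsetD[OF closure_subset, of _ D] 3 \<delta> by force
    then have exit: "w - \<i> * of_real (t - (t - a)) \<notin> D" by (simp add: algebra_simps)
    have start: "w - \<i> * of_real (t - 0) \<in> D" "0 \<le> t - a" using z t zw by auto
    have cont: "continuous_on {0..t - a} (\<lambda>s. w - \<i> * of_real (t - s))" by (intro continuous_intros)
    obtain s where s: "0 < s" "s \<le> t - a" "w - \<i> * of_real (t - s) \<in> frontier D"
        "\<And>r. 0 \<le> r \<Longrightarrow> r < s \<Longrightarrow> w - \<i> * of_real (t - r) \<in> D"
      using first_exit[OF cont D(1) start(1) exit start(2)] by blast
    have "G t (w - \<i> * of_real t) = G (t - s) (w - \<i> * of_real (t - s))"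
    proof (rule flow_constant[of "{t-s<..t}"])
      fix t' assume t': "t' \<in> {t-s<..t}"
      then have zD: "w - \<i> * of_real t' \<in> D" using s(4)[of "t - t'"] by auto
      have "t' \<in> closed_segment tm t \<or> t' \<le> tm" using t' by (auto simp: closed_segment_eq_real_ivl)
      then show "w - \<i> * of_real t' \<in> D \<and> flow_constant_at t' (w - \<i> * of_real t')"
        using fc_ext[OF _ zD] t' t s(2) 3 \<delta> zD by auto
    qed (use s t in auto)
    also have "\<dots> = f w" using bd_G[OF _ s(3)] s(1,2) t by simp
    finally show ?thesis by simp
  qed
  then show ?thesis by (simp add: w_def)
qed

text \<open>If \<open>f = G ts\<close> on the translate at \<open>ts\<close>, then for \<open>t\<close> near \<open>ts\<close> the function
  \<open>G t z - f (z + \<i> t)\<close> vanishes on a boundary arc of \<open>D\<close>: the one around the point where a vertical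
  ray from \<open>zs\<close>, pointing away from the displacement, leaves \<open>D\<close>.\<close>

lemma agreement_near:
  assumes ts: "ts \<in> {a..b}" and eq: "\<And>z. z \<in> D \<Longrightarrow> f (z + \<i> * of_real ts) = G ts z" and zs: "zs \<in> D"
  obtains r where "r > 0" "\<And>t z. t \<in> {a..b} \<Longrightarrow> \<bar>t - ts\<bar> < r \<Longrightarrow> z \<in> ball zs r \<Longrightarrow> f (z + \<i> * of_real t) = G t z"
proof -
  obtain r' where r': "r' > 0" "ball zs r' \<subseteq> D" using D(1) zs openE by blast
  \<comment> \<open>Half the radius, so that \<open>ball zs r\<close> stays in \<open>D\<close>
    under displacements shorter than \<open>r\<close>.\<close>
  define r where "r = r' / 2"
  have r: "r > 0" "ball zs (2 * r) \<subseteq> D" using r' by (auto simp: r_def)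
  have "f (z + \<i> * of_real t) = G t z" if t: "t \<in> {a..b}" "\<bar>t - ts\<bar> < r" and z: "z \<in> ball zs r" for t z
  proof (cases "t = ts")
    case True
    have "z \<in> D" using z r by (auto simp: subset_iff)
    then show ?thesis using eq True by simp
  next
    case False
    define \<eta> where "\<eta> = t - ts"
    \<comment> \<open>The ray points against the displacement, so that adding
      \<open>\<i> * of_real \<eta>\<close> moves its exit point \<open>p\<close> back into
      \<open>D\<close>.\<close>
    define u :: complex where "u = (if \<eta> > 0 then - \<i> else \<i>)"
    have \<eta>u: "\<i> * of_real \<eta> = - of_real \<bar>\<eta>\<bar> * u" by (simp add: u_def)
    have nu: "norm u = 1" by (simp add: u_def)
    have \<eta>: "0 < \<bar>\<eta>\<bar>" "\<bar>\<eta>\<bar> < r" using False t by (auto simp: \<eta>_def)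
    obtain M where M: "\<And>z. z \<in> D \<Longrightarrow> norm z \<le> M" using D(3) bounded_iff by metis
    \<comment> \<open>Long enough that the end of the ray has modulus greater than \<open>M\<close>,
      hence lies outside \<open>D\<close>.\<close>
    define L where "L = M + norm zs + 1"
    have "M \<ge> 0" using M[OF zs] norm_ge_zero order_trans by blast
    have L: "L \<ge> 0" "zs + of_real L * u \<notin> D"
    proof -
      show "L \<ge> 0" using \<open>M \<ge> 0\<close> by (simp add: L_def)
      have "norm (of_real L * u) = L" using nu \<open>L \<ge> 0\<close> by (simp add: norm_mult)
      then have "norm (zs + of_real L * u) \<ge> L - norm zs"
        using norm_triangle_ineq2[of "of_real L * u" "- zs"] by (simp add: add.commute)
      then show "zs + of_real L * u \<notin> D" using M[of "zs + of_real L * u"] by (auto simp: L_def)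
    qed
    obtain s where s: "0 < s" "s \<le> L" "zs + of_real s * u \<in> frontier D"
        "\<And>q. 0 \<le> q \<Longrightarrow> q < s \<Longrightarrow> zs + of_real q * u \<in> D"
      by (rule first_exit[of L "\<lambda>s. zs + of_real s * u" D]) (use L zs D(1) in \<open>auto intro!: continuous_intros\<close>)
    define p where "p = zs + of_real s * u"
    have pD: "p \<notin> D" using frontier_not_in_domain[OF s(3)] by (simp add: p_def)
    have sr: "2 * r \<le> s"
    proof (rule ccontr)
      assume "\<not> 2 * r \<le> s"
      then have "p \<in> ball zs (2 * r)" using s(1) nu by (simp add: p_def dist_norm norm_mult)
      then show False using r pD by blast
    qed
    \<comment> \<open>Where the displaced extension \<open>G ts (z + \<i> * of_real \<eta>)\<close>
      is holomorphic.\<close>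
    define Dh where "Dh = (\<lambda>z. z + \<i> * of_real \<eta>) -` D"
    have oDh: "open Dh" unfolding Dh_def by (intro open_vimage D(1) continuous_intros)
    have on_ray: "zs + of_real q * u + \<i> * of_real \<eta> = zs + of_real (q - \<bar>\<eta>\<bar>) * u" for q
      by (simp add: \<eta>u algebra_simps)
    have "p \<in> Dh" using s(4)[of "s - \<bar>\<eta>\<bar>"] sr \<eta> r by (simp add: Dh_def p_def on_ray)
    then obtain \<rho> where \<rho>: "\<rho> > 0" "ball p \<rho> \<subseteq> Dh" using oDh openE by blast
    obtain e where e: "e \<in> ball p (\<rho>/4)" "e \<notin> closure D"
      using exterior[of p "\<rho>/4"] s(3) \<rho>(1) by (auto simp: p_def)
    \<comment> \<open>The centre \<open>c0\<close> on the ray must lie just inside \<open>D\<close>.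
      With \<open>e\<close> and all centres near \<open>c0\<close> within \<open>\<rho>/4\<close> of
      \<open>p\<close>, the discs about these centres with \<open>e\<close> on their circle have
      radius below \<open>\<rho>/2\<close> and stay in \<open>ball p \<rho>\<close>, hence in
      \<open>Dh\<close>.\<close>
    define \<kappa> where "\<kappa> = min (\<rho>/8) (s/2)"
    have \<kappa>: "\<kappa> > 0" "\<kappa> < \<rho>/4" "\<kappa> < s" using \<rho> s by (auto simp: \<kappa>_def)
    define c0 where "c0 = zs + of_real (s - \<kappa>) * u"
    have c0D: "c0 \<in> D" using s(4)[of "s - \<kappa>"] \<kappa> by (simp add: c0_def)
    have "p - c0 = of_real \<kappa> * u" by (simp add: p_def c0_def algebra_simps)
    then have "dist p c0 = \<kappa>" using nu \<kappa> by (simp add: dist_norm norm_mult)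
    then have "c0 \<in> D \<inter> ball p (\<rho>/4)" using c0D \<kappa> by simp
    then obtain \<eta>0 where \<eta>0: "\<eta>0 > 0" "ball c0 \<eta>0 \<subseteq> D \<inter> ball p (\<rho>/4)"
      using openE[of "D \<inter> ball p (\<rho>/4)" c0] D(1) by blast
    define g where "g z = G t z - G ts (z + \<i> * of_real \<eta>)" for z
    \<comment> \<open>Extension by zero is continuous on \<open>Dh\<close> because \<open>g\<close>
      vanishes on the part of \<open>frontier D\<close> there: \<open>f = G ts\<close> on the old
      translate, and \<open>f = G t\<close> on the new boundary.\<close>
    define \<psi> where "\<psi> z = (if z \<in> D then g z else 0)" for z
    have g_hol: "g holomorphic_on Dh \<inter> D"
      unfolding g_def
      by (intro holomorphic_on_diff holomorphic_on_subset[OF hol_G[OF t(1)]] holomorphic_translate[OF ts]) (auto simp: Dh_def)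
    have g_cont: "continuous_on (Dh \<inter> closure D) g"
      unfolding g_def
    proof (intro continuous_on_diff)
      show "continuous_on (Dh \<inter> closure D) (G t)" by (rule continuous_on_subset[OF cont_G'[OF t(1)]]) auto
      show "continuous_on (Dh \<inter> closure D) (\<lambda>z. G ts (z + \<i> * of_real \<eta>))"
        by (rule continuous_on_compose2[OF holomorphic_on_imp_continuous_on[OF hol_G[OF ts]]])
           (auto simp: Dh_def intro!: continuous_intros)
    qed
    have g_zero: "g z = 0" if "z \<in> Dh" "z \<in> frontier D" for z
    proof -
      have "f (z + \<i> * of_real t) = f ((z + \<i> * of_real \<eta>) + \<i> * of_real ts)" by (simp add: \<eta>_def algebra_simps)
      also have "\<dots> = G ts (z + \<i> * of_real \<eta>)" using that by (intro eq) (simp add: Dh_def)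
      finally show ?thesis using bd_G[OF t(1) that(2)] by (simp add: g_def)
    qed
    have \<psi>_cont: "continuous_on Dh \<psi>"
    proof -
      have "continuous_on ((Dh \<inter> closure D) \<union> (Dh - D)) (\<lambda>z. if z \<in> D then g z else 0)"
      proof (rule continuous_on_cases_local[OF _ _ g_cont])
        have "(Dh \<inter> closure D) \<union> (Dh - D) = Dh" using closure_subset by auto
        then show "closedin (top_of_set ((Dh \<inter> closure D) \<union> (Dh - D))) (Dh \<inter> closure D)"
          "closedin (top_of_set ((Dh \<inter> closure D) \<union> (Dh - D))) (Dh - D)"
          using closedin_closed_Int[of "closure D" Dh] closedin_closed_Int[of "- D" Dh] D(1)
          by (auto simp: Diff_eq)
        fix z assume "z \<in> Dh \<inter> closure D \<and> z \<notin> D \<or> z \<in> Dh - D \<and> z \<in> D"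
        then have "z \<in> Dh" "z \<in> frontier D" using D(1) by (auto simp: frontier_def interior_open)
        then show "g z = 0" by (rule g_zero)
      qed auto
      moreover have "(Dh \<inter> closure D) \<union> (Dh - D) = Dh" using closure_subset by auto
      ultimately show ?thesis unfolding \<psi>_def by simp
    qed
    have \<psi>_hol: "\<psi> holomorphic_on Dh \<inter> D"
      using g_hol by (rule holomorphic_transform) (simp add: \<psi>_def)
    have g0: "g c = 0" if c: "c \<in> ball c0 \<eta>0" for c
    proof -
      have cD: "c \<in> D" "dist p c < \<rho>/4" using c \<eta>0 by auto
      have ce: "dist c e < \<rho>/2" using dist_triangle[of c e p] cD e(1) by (simp add: dist_commute)
      have "\<psi> c = 0"
      proof (rule zero_of_zero_on_boundary_arc[OF D(1) \<psi>_cont \<psi>_hol _ e(2)])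
        show "e \<noteq> c" using e(2) cD(1) closure_subset by auto
        have "cball c (dist c e) \<subseteq> ball p \<rho>"
        proof
          fix x assume "x \<in> cball c (dist c e)"
          then show "x \<in> ball p \<rho>" using dist_triangle[of p x c] ce cD \<rho>(1) by simp
        qed
        then show "cball c (dist c e) \<subseteq> Dh" using \<rho> by blast
      qed (simp add: \<psi>_def)
      then show ?thesis using cD by (simp add: \<psi>_def)
    qed
    have inDh: "z' \<in> Dh \<inter> D" if "z' \<in> ball zs r" for z'
    proof -
      have "norm (\<i> * of_real \<eta> :: complex) < r" using \<eta> by (simp add: norm_mult)
      then have "norm ((z' - zs) + \<i> * of_real \<eta>) < r + r"
        using that by (intro norm_triangle_lt add_strict_mono) (simp_all add: dist_norm norm_minus_commute)
      then have "z' + \<i> * of_real \<eta> \<in> ball zs (2 * r)" by (simp add: dist_norm norm_minus_commute algebra_simps)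
      moreover have "z' \<in> ball zs (2 * r)" using that r by (auto simp: subset_iff)
      ultimately show ?thesis using r by (auto simp: Dh_def)
    qed
    \<comment> \<open>\<open>Dh \<inter> D\<close> need not be connected. The disc together with the
      piece of the ray up to \<open>c0\<close> puts \<open>c0\<close> and \<open>ball zs r\<close>
      into one component.\<close>
    define K where "K = ball zs r \<union> (\<lambda>q. zs + of_real q * u) ` {0..s - \<kappa>}"
    have "connected K"
      unfolding K_def
    proof (rule connected_Un)
      show "connected ((\<lambda>q. zs + of_real q * u) ` {0..s - \<kappa>})"
        by (intro connected_continuous_image continuous_intros) auto
      have "zs \<in> ball zs r \<inter> (\<lambda>q. zs + of_real q * u) ` {0..s - \<kappa>}" using r \<kappa> by (auto intro!: image_eqI[of _ _ 0])
      then show "ball zs r \<inter> (\<lambda>q. zs + of_real q * u) ` {0..s - \<kappa>} \<noteq> {}" by blast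
    qed auto
    moreover have "K \<subseteq> Dh \<inter> D"
    proof
      fix x assume "x \<in> K"
      then consider "x \<in> ball zs r" | q where "0 \<le> q" "q \<le> s - \<kappa>" "x = zs + of_real q * u" by (auto simp: K_def)
      then show "x \<in> Dh \<inter> D"
      proof cases
        case 2
        have "zs + of_real (q - \<bar>\<eta>\<bar>) * u \<in> D"
        proof (cases "q \<ge> \<bar>\<eta>\<bar>")
          case True
          then show ?thesis using s(4)[of "q - \<bar>\<eta>\<bar>"] 2 \<kappa> \<eta> by simp
        next
          case False
          then have "norm (of_real (q - \<bar>\<eta>\<bar>) * u) < 2 * r" using nu \<eta> 2 r by (simp only: norm_mult norm_of_real) simp
          then have "zs + of_real (q - \<bar>\<eta>\<bar>) * u \<in> ball zs (2 * r)" by (simp add: dist_norm norm_minus_commute)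
          then show ?thesis using r by blast
        qed
        then have "x \<in> Dh" unfolding Dh_def 2(3) vimage_def by (simp only: on_ray mem_Collect_eq)
        moreover have "x \<in> D" using s(4)[of q] 2 \<kappa> by simp
        ultimately show ?thesis by simp
      qed (use inDh in auto)
    qed
    ultimately have KC: "K \<subseteq> connected_component_set (Dh \<inter> D) zs"
      using r by (intro connected_component_maximal) (auto simp: K_def)
    define C where "C = connected_component_set (Dh \<inter> D) zs"
    have oC: "open C" unfolding C_def using oDh D(1) by (intro open_connected_component) auto
    have CD: "C \<subseteq> Dh \<inter> D" unfolding C_def by (rule connected_component_subset)
    have "c0 \<in> K" unfolding K_def c0_def using \<kappa> by (intro UnI2 imageI) auto
    then have "c0 \<in> C" using KC unfolding C_def by blast
    have "g z = 0"
    proof (rule analytic_continuation_open[of "C \<inter> ball c0 \<eta>0" C g "\<lambda>_. 0"])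
      show "C \<inter> ball c0 \<eta>0 \<noteq> {}" using \<open>c0 \<in> C\<close> \<eta>0 by auto
      show "connected C" unfolding C_def by simp
      show "g holomorphic_on C" using g_hol CD by (rule holomorphic_on_subset)
      show "z \<in> C" using KC z by (auto simp: C_def K_def)
    qed (use oC g0 in auto)
    moreover have "f (z + \<i> * of_real t) = f ((z + \<i> * of_real \<eta>) + \<i> * of_real ts)" by (simp add: \<eta>_def algebra_simps)
    moreover have "f ((z + \<i> * of_real \<eta>) + \<i> * of_real ts) = G ts (z + \<i> * of_real \<eta>)"
      using inDh[OF z] by (intro eq) (auto simp: Dh_def)
    ultimately show ?thesis by (simp add: g_def)
  qed
  then show ?thesis using that r(1) by blast
qed

text \<open>Continuation in time, starting from a translate that meets the graph. On the times
  reached, \<open>f = G\<close> by \<open>value_inside\<close>; this passes to limit times by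
  continuity, and \<open>agreement_near\<close> converts it into flow constancy at neighbouring
  times.\<close>

lemma f_eq_G:
  assumes t: "t \<in> {a..b}" and z: "z \<in> D"
  shows "f (z + \<i> * of_real t) = G t z"
proof -
  obtain zm where zm: "zm \<in> D" using D_nonempty by blast
  \<comment> \<open>The time at which \<open>zm\<close> is carried exactly onto the graph.\<close>
  define tm where "tm = lam (Re zm) - Im zm"
  have zmc: "zm \<in> closure D" using zm closure_subset by auto
  have tm: "tm \<in> {a..b}" using below[OF zmc] above[OF zmc] \<delta> by (simp add: tm_def)
  have bm: "\<bar>Im zm + tm - lam (Re zm)\<bar> < \<delta>" using \<delta> by (simp add: tm_def)
  define C where "C = {t\<in>{a..b}. \<forall>s\<in>closed_segment tm t. \<forall>z\<in>D. flow_constant_at s z}"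
  have inside: "f (z + \<i> * of_real t) = G t z" if "t \<in> C" "z \<in> D" for t z
    using value_inside[OF zm bm, of t z] that by (auto simp: C_def)
  have tmC: "tm \<in> C"
    using tm flow_constant_at_propagates[OF tm zm _ flow_constant_at_band[OF tm zm]] bm by (auto simp: C_def)
  \<comment> \<open>Starting from the closure of \<open>C\<close> instead of \<open>C\<close> gives
    openness and closedness in \<open>{a..b}\<close> together.\<close>
  have nbhd: "\<exists>r>0. \<forall>s\<in>{a..b}. \<bar>s - ts\<bar> < r \<longrightarrow> s \<in> C" if ts: "ts \<in> {a..b}" "ts \<in> closure C" for ts
  proof -
    obtain \<tau> where \<tau>: "\<And>n. \<tau> n \<in> C" "\<tau> \<longlonglongrightarrow> ts" using ts(2) closure_sequential by blast
    have eq: "f (z + \<i> * of_real ts) = G ts z" if z: "z \<in> D" for z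
    proof (rule LIMSEQ_unique)
      have ab: "\<tau> n \<in> {a..b}" for n using \<tau>(1) by (auto simp: C_def)
      show "(\<lambda>n. f (z + \<i> * of_real (\<tau> n))) \<longlonglongrightarrow> f (z + \<i> * of_real ts)"
        by (rule continuous_on_tendsto_compose[OF cont_f])
           (use translates_subset[OF z] ab ts in \<open>auto intro!: tendsto_intros \<tau> always_eventually\<close>)
      have "(\<lambda>n. G (\<tau> n) z) \<longlonglongrightarrow> G ts z"
        by (rule continuous_on_tendsto_compose[OF cont_G''])
           (use z closure_subset ab ts in \<open>auto intro!: \<tau> always_eventually\<close>)
      then show "(\<lambda>n. f (z + \<i> * of_real (\<tau> n))) \<longlonglongrightarrow> G ts z" using inside[OF \<tau>(1) z] by simp
    qed
    obtain r where r: "r > 0" "\<And>t z. t \<in> {a..b} \<Longrightarrow> \<bar>t - ts\<bar> < r \<Longrightarrow> z \<in> ball zm r \<Longrightarrow> f (z + \<i> * of_real t) = G t z"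
      using agreement_near[OF ts(1) eq zm] by metis
    have fc: "flow_constant_at s z" if s: "s \<in> {a..b}" "\<bar>s - ts\<bar> < r/2" and z: "z \<in> D" for s z
    proof -
      have "G t' (z' + \<i> * of_real (s - t')) = G s z'"
        if z': "z' \<in> ball zm (r/2)" and t': "t' \<in> {a..b}" "\<bar>t' - s\<bar> < r/2" for z' t'
      proof -
        have "norm (\<i> * of_real (s - t') :: complex) < r/2"
          using t'(2) by (simp only: norm_mult norm_of_real) (simp add: abs_minus_commute)
        then have "norm ((z' - zm) + \<i> * of_real (s - t')) < r/2 + r/2"
          using z' by (intro norm_triangle_lt add_strict_mono) (simp_all add: dist_norm norm_minus_commute)
        then have "z' + \<i> * of_real (s - t') \<in> ball zm r" by (simp add: dist_norm norm_minus_commute algebra_simps)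
        moreover have "\<bar>t' - ts\<bar> < r" using s t' by linarith
        ultimately have "f ((z' + \<i> * of_real (s - t')) + \<i> * of_real t') = G t' (z' + \<i> * of_real (s - t'))"
          by (intro r(2) t'(1))
        moreover have "(z' + \<i> * of_real (s - t')) + \<i> * of_real t' = z' + \<i> * of_real s" by (simp add: algebra_simps)
        moreover have "f (z' + \<i> * of_real s) = G s z'" using r(2)[of s z'] s z' r(1) by auto
        ultimately show ?thesis by metis
      qed
      then have "flow_constant_at s zm" unfolding flow_constant_at_def using r(1) half_gt_zero by blast
      then show ?thesis using flow_constant_at_propagates[OF s(1) zm z] by blast
    qed
    have "s \<in> C" if s: "s \<in> {a..b}" "\<bar>s - ts\<bar> < r/2" for s
    proof -
      obtain n where n: "\<bar>\<tau> n - ts\<bar> < r/2"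
        using \<tau>(2) r(1) half_gt_zero[of r] unfolding LIMSEQ_iff real_norm_def by blast
      have "flow_constant_at q z" if q: "q \<in> closed_segment tm s" and z: "z \<in> D" for q z
      proof (cases "q \<in> closed_segment tm (\<tau> n)")
        case True
        then show ?thesis using \<tau>(1) z by (auto simp: C_def)
      next
        case False
        then have "q \<in> {a..b}" "\<bar>q - ts\<bar> < r/2"
          using q n s tm unfolding abs_less_iff closed_segment_eq_real_ivl by (auto split: if_splits)
        then show ?thesis using fc z by blast
      qed
      then show ?thesis using s(1) by (auto simp: C_def)
    qed
    then show ?thesis using r(1) half_gt_zero by blast
  qed
  have "tm \<in> C \<longleftrightarrow> t \<in> C"
  proof (rule connected_equivalence_relation[OF _ tm t])
    fix x assume x: "x \<in> {a..b}"
    obtain r where r: "r > 0" "\<And>s. s \<in> {a..b} \<Longrightarrow> \<bar>s - x\<bar> < r \<Longrightarrow> x \<in> C \<longleftrightarrow> s \<in> C"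
    proof (cases "x \<in> closure C")
      case True
      then obtain r where "r > 0" "\<forall>s\<in>{a..b}. \<bar>s - x\<bar> < r \<longrightarrow> s \<in> C" using nbhd x by blast
      then show ?thesis using that x by force
    next
      case False
      then obtain r where "r > 0" "ball x r \<subseteq> - closure C" using openE[of "- closure C" x] by auto
      then have "s \<notin> C" if "\<bar>s - x\<bar> < r" for s
        using closure_subset[of C] that by (auto simp: dist_real_def abs_minus_commute subset_iff)
      then show ?thesis using that[OF \<open>r > 0\<close>] \<open>r > 0\<close> by simp
    qed
    show "\<exists>T. openin (top_of_set {a..b}) T \<and> x \<in> T \<and> (\<forall>y\<in>T. (x \<in> C) = (y \<in> C))"
    proof (intro exI[of _ "{a..b} \<inter> ball x r"] conjI ballI)
      show "openin (top_of_set {a..b}) ({a..b} \<inter> ball x r)" by (simp add: openin_open_Int)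
      show "x \<in> {a..b} \<inter> ball x r" using x r(1) by simp
      fix y assume "y \<in> {a..b} \<inter> ball x r"
      then show "(x \<in> C) = (y \<in> C)"
        by (intro r(2)) (simp_all add: dist_real_def abs_minus_commute)
    qed
  qed auto
  then show ?thesis using tmC inside z by blast
qed

lemma holomorphic_on_translates: "f holomorphic_on (\<Union>t\<in>{a..b}. vshift t D)"
proof (rule holomorphic_on_UN_open)
  fix t assume t: "t \<in> {a..b}"
  have "(G t \<circ> (\<lambda>w. w - \<i> * of_real t)) holomorphic_on vshift t D"
    by (rule holomorphic_on_compose_gen[OF _ hol_G[OF t]]) (auto intro!: holomorphic_intros)
  then show "f holomorphic_on vshift t D"
    by (rule holomorphic_transform) (use f_eq_G[OF t] in auto)
  show "open (vshift t D)"
    using open_translation[OF D(1), of "\<i> * of_real t"] by (simp add: add.commute)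
qed

section \<open>Interior points lying in no open translate\<close>

text \<open>The point \<open>w - \<i> * of_real (\<sigma> * \<eta>)\<close>, for small
  \<open>\<eta>\<close>, lies on no boundary translate. For times close to \<open>t1\<close> it is
  in the exterior by the last hypothesis; for the remaining times compactness keeps \<open>w\<close>
  at distance at least \<open>d > \<eta>\<close> from the boundary.\<close>

lemma not_in_interior_of_one_sided_contact:
  assumes t1: "t1 \<in> {a..b}" and \<sigma>: "\<bar>\<sigma>\<bar> = 1" and ext: "\<And>t. t \<in> {a..b} \<Longrightarrow> 0 \<le> \<sigma> * (t - t1)"
    and only: "\<And>t. t \<in> {a..b} \<Longrightarrow> w - \<i> * of_real t \<in> frontier D \<Longrightarrow> t = t1"
    and \<epsilon>: "\<epsilon> > 0" "\<And>s. 0 < s \<Longrightarrow> s < \<epsilon> \<Longrightarrow> w - \<i> * of_real t1 - \<i> * of_real (\<sigma> * s) \<notin> closure D"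
  shows "w \<notin> interior (\<Union>t\<in>{a..b}. vshift t (frontier D))"
proof
  assume "w \<in> interior (\<Union>t\<in>{a..b}. vshift t (frontier D))"
  then obtain r where r: "r > 0" "ball w r \<subseteq> (\<Union>t\<in>{a..b}. vshift t (frontier D))"
    by (meson interior_subset openE open_interior order_trans)
  define K where "K = (\<lambda>t. w - \<i> * of_real t) ` {t\<in>{a..b}. \<epsilon>/2 \<le> \<sigma> * (t - t1)}"
  have "compact ({a..b} \<inter> {t. \<epsilon>/2 \<le> \<sigma> * (t - t1)})"
    by (intro compact_Int_closed closed_Collect_le continuous_intros) auto
  then have "compact K"
    unfolding K_def by (intro compact_continuous_image continuous_intros) (simp add: Int_def)
  moreover have "K \<inter> frontier D = {}" using only \<epsilon>(1) by (auto simp: K_def)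
  ultimately obtain d where d: "d > 0" "\<And>x y. x \<in> K \<Longrightarrow> y \<in> frontier D \<Longrightarrow> d \<le> dist x y"
    using separate_compact_closed[of K "frontier D"] by auto
  define \<eta> where "\<eta> = Min {r/2, d/2, \<epsilon>/2}"
  have \<eta>: "\<eta> > 0" "\<eta> < r" "\<eta> < d" "\<eta> \<le> \<epsilon>/2" using r d \<epsilon> by (auto simp: \<eta>_def min_less_iff_disj)
  have n: "norm (\<i> * of_real (\<sigma> * \<eta>) :: complex) = \<eta>"
    using \<sigma> \<eta>(1) by (simp only: norm_mult norm_of_real abs_mult) simp
  then have "w - \<i> * of_real (\<sigma> * \<eta>) \<in> ball w r" using \<eta> by (simp only: mem_ball dist_norm) simp
  then obtain t where "t \<in> {a..b}" "w - \<i> * of_real (\<sigma> * \<eta>) \<in> vshift t (frontier D)"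
    using r(2) by blast
  then have t: "t \<in> {a..b}" "w - \<i> * of_real (\<sigma> * \<eta>) - \<i> * of_real t \<in> frontier D"
    by (simp_all only: vshift_mem_iff)
  show False
  proof (cases "\<epsilon>/2 \<le> \<sigma> * (t - t1)")
    case True
    then have "d \<le> dist (w - \<i> * of_real t) (w - \<i> * of_real (\<sigma> * \<eta>) - \<i> * of_real t)"
      using t by (intro d(2)) (auto simp: K_def)
    also have "\<dots> = \<eta>" using n by (simp add: dist_norm)
    finally show False using \<eta> by simp
  next
    case False
    have "\<sigma> * \<sigma> = 1" using \<sigma> by (metis abs_mult_self_eq mult_1)
    then have "\<sigma> * (\<eta> + \<sigma> * (t - t1)) = \<sigma> * \<eta> + (t - t1)"
      by (simp add: distrib_left mult.assoc[symmetric])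
    then have "w - \<i> * of_real t1 - \<i> * of_real (\<sigma> * (\<eta> + \<sigma> * (t - t1))) = w - \<i> * of_real (\<sigma> * \<eta>) - \<i> * of_real t"
      by (simp only:) (simp add: algebra_simps)
    moreover have "w - \<i> * of_real t1 - \<i> * of_real (\<sigma> * (\<eta> + \<sigma> * (t - t1))) \<notin> closure D"
      using False \<eta> ext[OF t(1)] by (intro \<epsilon>(2)) auto
    ultimately show False using frontier_not_in_domain[OF t(2)] by metis
  qed
qed

text \<open>Off the exceptional lines every interior point lies in an open translate. Otherwise, at
  a contact with the boundary a small change of \<open>t\<close> in one direction would bring the
  point inside, so the contact occurs at time \<open>a\<close> or \<open>b\<close>. It cannot occur
  at both, because those translates lie on opposite sides of the graph; a single contact contradicts
  interiority.\<close>

lemma holomorphic_on_interior: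
  assumes V: "finite V"
    and crossing: "\<And>p. p \<in> frontier D \<Longrightarrow> Re p \<notin> V \<Longrightarrow>
      \<exists>\<sigma> \<epsilon>. \<bar>\<sigma>\<bar> = 1 \<and> \<epsilon> > 0 \<and> (\<forall>s. 0 < s \<longrightarrow> s < \<epsilon> \<longrightarrow>
         p + \<i> * of_real (\<sigma> * s) \<in> D \<and> p - \<i> * of_real (\<sigma> * s) \<notin> closure D)"
  shows "f holomorphic_on interior (\<Union>t\<in>{a..b}. vshift t (frontier D))" (is "f holomorphic_on interior ?Q")
proof (rule holomorphic_on_off_vertical_lines[OF open_interior V])
  show "continuous_on (interior ?Q) f"
    by (rule continuous_on_subset[OF cont_f interior_subset])
  show "f holomorphic_on interior ?Q \<inter> {z. Re z \<notin> V}"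
  proof (rule holomorphic_on_subset[OF holomorphic_on_translates], rule subsetI, rule ccontr)
    fix w assume w: "w \<in> interior ?Q \<inter> {z. Re z \<notin> V}" and nU: "w \<notin> (\<Union>t\<in>{a..b}. vshift t D)"
    have notD: "w - \<i> * of_real t \<notin> D" if "t \<in> {a..b}" for t
      using nU that by (auto simp: vshift_mem_iff)
    have contact: "\<exists>\<sigma> \<epsilon>. \<bar>\<sigma>\<bar> = 1 \<and> \<epsilon> > 0 \<and> (\<forall>t\<in>{a..b}. 0 \<le> \<sigma> * (t - t1)) \<and>
        (\<forall>s. 0 < s \<longrightarrow> s < \<epsilon> \<longrightarrow> w - \<i> * of_real t1 - \<i> * of_real (\<sigma> * s) \<notin> closure D)"
      if t1: "t1 \<in> {a..b}" "w - \<i> * of_real t1 \<in> frontier D" for t1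
    proof -
      obtain \<sigma> \<epsilon> where \<sigma>: "\<bar>\<sigma>\<bar> = 1" "\<epsilon> > 0" and
        cr: "\<And>s. 0 < s \<Longrightarrow> s < \<epsilon> \<Longrightarrow> w - \<i> * of_real t1 + \<i> * of_real (\<sigma> * s) \<in> D \<and> w - \<i> * of_real t1 - \<i> * of_real (\<sigma> * s) \<notin> closure D"
        using crossing[OF t1(2)] w by auto
      have "0 \<le> \<sigma> * (t - t1)" if t: "t \<in> {a..b}" for t
      proof (rule ccontr)
        assume neg: "\<not> 0 \<le> \<sigma> * (t - t1)"
        define s where "s = min (\<epsilon>/2) (- \<sigma> * (t - t1))"
        have s: "0 < s" "s < \<epsilon>" "s \<le> - \<sigma> * (t - t1)" using \<sigma> neg by (auto simp: s_def min_less_iff_disj)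
        have "\<sigma> = 1 \<or> \<sigma> = -1" using \<sigma>(1) by linarith
        then have "t1 - \<sigma> * s \<in> {a..b}" using s t t1(1) by auto
        moreover have "w - \<i> * of_real t1 + \<i> * of_real (\<sigma> * s) = w - \<i> * of_real (t1 - \<sigma> * s)" by (simp add: algebra_simps)
        ultimately show False using cr[OF s(1,2)] notD by metis
      qed
      then show ?thesis using \<sigma> cr by blast
    qed
    have "w \<in> ?Q" using w interior_subset[of ?Q] by blast
    then obtain t1 where "t1 \<in> {a..b}" "w \<in> vshift t1 (frontier D)" by blast
    then have t1: "t1 \<in> {a..b}" "w - \<i> * of_real t1 \<in> frontier D" by (simp_all only: vshift_mem_iff)
    have ends: "t = a \<or> t = b" if tf: "t \<in> {a..b}" "w - \<i> * of_real t \<in> frontier D" for t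
    proof -
      obtain \<sigma> where \<sigma>: "\<bar>\<sigma>\<bar> = 1" "\<forall>t'\<in>{a..b}. 0 \<le> \<sigma> * (t' - t)" using contact[OF tf] by blast
      then have "\<sigma> = 1 \<or> \<sigma> = -1" by linarith
      then show ?thesis using \<sigma>(2) tf(1) by (auto dest: bspec[of _ _ a] bspec[of _ _ b])
    qed
    have "\<not> (w - \<i> * of_real a \<in> frontier D \<and> w - \<i> * of_real b \<in> frontier D)"
      using below[of "w - \<i> * of_real a"] above[of "w - \<i> * of_real b"] frontier_not_in_domain \<delta> by fastforce
    then have only: "t = t1" if "t \<in> {a..b}" "w - \<i> * of_real t \<in> frontier D" for t
      using ends[OF that] ends[OF t1] that(2) t1(2) by metis
    obtain \<sigma> \<epsilon> where "\<bar>\<sigma>\<bar> = 1" "\<epsilon> > 0" "\<And>t. t \<in> {a..b} \<Longrightarrow> 0 \<le> \<sigma> * (t - t1)"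
        "\<And>s. 0 < s \<Longrightarrow> s < \<epsilon> \<Longrightarrow> w - \<i> * of_real t1 - \<i> * of_real (\<sigma> * s) \<notin> closure D"
      using contact[OF t1] by blast
    then have "w \<notin> interior ?Q"
      using not_in_interior_of_one_sided_contact[OF t1(1), of \<sigma> w \<epsilon>] only by blast
    then show False using w by blast
  qed
qed

end

section \<open>Real-analytic Jordan domains\<close>

lemma connected_subset_of_disjoint_frontier:
  assumes "connected S" "S \<inter> frontier D = {}" "S \<inter> D \<noteq> {}"
  shows "S \<subseteq> D"
  using connected_Int_frontier[OF assms(1,3)] assms(2) by blast

text \<open>The unbounded complementary component of the curve is connected and misses
  \<open>frontier D\<close>, so it would lie in the bounded set \<open>D\<close> if it met it. By
  the Jordan curve theorem every boundary point is a limit of this component.\<close>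

lemma Jordan_domain_exterior:
  fixes D :: "complex set"
  assumes D: "open D" "bounded D" and g: "simple_path g" "pathfinish g = pathstart g" "path_image g = frontier D"
    and p: "p \<in> frontier D" and \<rho>: "\<rho> > 0"
  shows "\<exists>e\<in>ball p \<rho>. e \<notin> closure D"
proof -
  let ?O = "outside (path_image g)"
  have O: "open ?O" "connected ?O" "\<not> bounded ?O" "frontier ?O = frontier D" "?O \<inter> frontier D = {}"
    using Jordan_inside_outside[OF g(1,2)] outside_no_overlap[of "frontier D"] by (auto simp: g(3))
  have "?O \<inter> D = {}"
    using connected_subset_of_disjoint_frontier[OF O(2,5)] O(3) D(2) bounded_subset by blast
  then have disj: "?O \<inter> closure D = {}" using O(5) closure_Un_frontier[of D] by auto
  have "p \<in> closure ?O" using p O(4) by (auto simp: frontier_def)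
  then obtain e where "e \<in> ?O" "dist e p < \<rho>" using \<rho> by (auto simp: closure_approachable)
  then show ?thesis using disj by (intro bexI[of _ e]) (auto simp: dist_commute)
qed

text \<open>The graph cuts a box into two connected pieces missing \<open>frontier D\<close>. The
  piece containing a point of \<open>D\<close> near \<open>p\<close> lies in \<open>D\<close>; a
  nearby exterior point must then be in the other piece, which therefore avoids
  \<open>D\<close>.\<close>

lemma crossing_of_local_graph:
  fixes \<psi> :: "real \<Rightarrow> real"
  assumes "open D" and p: "p \<in> frontier D" and ext: "\<And>\<rho>. \<rho> > 0 \<Longrightarrow> \<exists>e\<in>ball p \<rho>. e \<notin> closure D"
    and \<kappa>\<eta>: "\<kappa> > 0" "\<eta> > 0" and cont: "continuous_on {Re p - \<kappa><..<Re p + \<kappa>} \<psi>"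
    and near: "\<And>x. \<bar>x - Re p\<bar> < \<kappa> \<Longrightarrow> \<bar>\<psi> x - Im p\<bar> < \<eta>" and \<psi>p: "\<psi> (Re p) = Im p"
    and graph: "\<And>z. \<lbrakk>\<bar>Re z - Re p\<bar> < \<kappa>; \<bar>Im z - Im p\<bar> < \<eta>\<rbrakk> \<Longrightarrow> z \<in> frontier D \<longleftrightarrow> Im z = \<psi> (Re z)"
  shows "\<exists>\<sigma> \<epsilon>. \<bar>\<sigma>\<bar> = 1 \<and> \<epsilon> > 0 \<and> (\<forall>s. 0 < s \<longrightarrow> s < \<epsilon> \<longrightarrow>
         p + \<i> * of_real (\<sigma> * s) \<in> D \<and> p - \<i> * of_real (\<sigma> * s) \<notin> closure D)"
proof -
  define H where "H \<sigma> = {z. \<bar>Re z - Re p\<bar> < \<kappa> \<and> \<bar>Im z - Im p\<bar> < \<eta> \<and> 0 < \<sigma> * (Im z - \<psi> (Re z))}" for \<sigma> :: real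
  have conn: "connected (H \<sigma>)" if \<sigma>: "\<sigma> = 1 \<or> \<sigma> = -1" for \<sigma>
  proof -
    \<comment> \<open>Parametrizes each piece by vertical segments from the graph to the top or
      bottom edge of the box.\<close>
    define m where "m = (\<lambda>xv. Complex (fst xv) (\<psi> (fst xv) + snd xv * (Im p + \<sigma> * \<eta> - \<psi> (fst xv))))"
    define R where "R = {Re p - \<kappa><..<Re p + \<kappa>} \<times> {0<..<1::real}"
    have "H \<sigma> = m ` R"
    proof (intro equalityI subsetI)
      fix z assume z: "z \<in> H \<sigma>"
      define v where "v = (Im z - \<psi> (Re z)) / (Im p + \<sigma> * \<eta> - \<psi> (Re z))"
      have n: "\<bar>\<psi> (Re z) - Im p\<bar> < \<eta>" using near z by (auto simp: H_def)
      have ne: "Im p + \<sigma> * \<eta> - \<psi> (Re z) \<noteq> 0" using n \<sigma> by auto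
      have "0 < v" "v < 1"
        using z n \<sigma> by (auto simp: v_def H_def divide_simps abs_less_iff)
      moreover have "z = m (Re z, v)" using ne by (simp add: m_def v_def complex_eq_iff)
      ultimately show "z \<in> m ` R" using z by (auto simp: R_def H_def abs_less_iff intro!: image_eqI[of _ m "(Re z, v)"])
    next
      fix z assume "z \<in> m ` R"
      then obtain x v where xv: "Re p - \<kappa> < x" "x < Re p + \<kappa>" "0 < v" "v < 1" "z = m (x,v)" by (auto simp: R_def)
      have n: "\<bar>\<psi> x - Im p\<bar> < \<eta>" using near[of x] xv by (auto simp: abs_less_iff)
      define d where "d = Im p + \<sigma> * \<eta> - \<psi> x"
      have d: "0 < \<sigma> * d" using \<sigma> n by (auto simp: d_def abs_less_iff)
      define y where "y = v * d"
      have z: "Re z = x" "Im z = \<psi> x + y" using xv by (auto simp: m_def d_def y_def)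
      have vd: "0 < \<sigma> * y" "\<sigma> * y < \<sigma> * d"
        using mult_pos_pos[OF xv(3) d] mult_strict_right_mono[OF xv(4) d] by (simp_all add: y_def mult.left_commute)
      have "\<bar>Im z - Im p\<bar> < \<eta>" using \<sigma> n vd by (auto simp: z d_def abs_less_iff)
      then show "z \<in> H \<sigma>" using vd(1) xv(1,2) z by (auto simp: H_def abs_less_iff)
    qed
    moreover have "connected (m ` R)"
    proof (rule connected_continuous_image)
      show "continuous_on R m"
        unfolding m_def Complex_eq
        by (intro continuous_intros continuous_on_compose2[OF cont]) (auto simp: R_def)
      show "connected R" unfolding R_def by (intro convex_connected convex_Times) auto
    qed
    ultimately show ?thesis by simp
  qed
  have disj: "H \<sigma> \<inter> frontier D = {}" for \<sigma>
    using graph by (auto simp: H_def)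
  have cover: "z \<in> H 1 \<or> z \<in> H (-1)" if z: "z \<in> ball p (min \<kappa> \<eta>)" "z \<notin> frontier D" for z
  proof -
    have "\<bar>Re z - Re p\<bar> < \<kappa>" "\<bar>Im z - Im p\<bar> < \<eta>"
      using z(1) abs_Re_le_cmod[of "z - p"] abs_Im_le_cmod[of "z - p"] by (auto simp: dist_norm norm_minus_commute)
    then show ?thesis using z(2) graph[of z] by (auto simp: H_def)
  qed
  have pos: "min \<kappa> \<eta> > 0" using \<kappa>\<eta> by simp
  have "p \<in> closure D" using p by (simp add: frontier_def)
  then obtain z where "z \<in> D" "dist z p < min \<kappa> \<eta>" using pos unfolding closure_approachable by blast
  then have z: "z \<in> D" "z \<in> ball p (min \<kappa> \<eta>)" by (simp_all add: dist_commute)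
  have "z \<notin> frontier D" using z(1) \<open>open D\<close> by (simp add: frontier_def interior_open)
  then obtain \<sigma> where \<sigma>: "\<sigma> = 1 \<or> \<sigma> = -1" "z \<in> H \<sigma>" using cover[OF z(2)] by blast
  have HD: "H \<sigma> \<subseteq> D" using connected_subset_of_disjoint_frontier[OF conn[OF \<sigma>(1)] disj] z(1) \<sigma>(2) by blast
  obtain e where e: "e \<in> ball p (min \<kappa> \<eta>)" "e \<notin> closure D" using ext[OF pos] by blast
  have "e \<notin> frontier D" using e(2) by (simp add: frontier_def)
  moreover have "e \<notin> H \<sigma>" using e(2) HD closure_subset by blast
  ultimately have eH: "e \<in> H (- \<sigma>)" using cover[OF e(1)] \<sigma>(1) by auto
  have "H (- \<sigma>) \<inter> D = {}"
    using connected_subset_of_disjoint_frontier[of "H (- \<sigma>)" D] conn[of "- \<sigma>"] disj[of "- \<sigma>"] eH e(2) \<sigma>(1) closure_subset[of D]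
    by fastforce
  then have HE: "H (- \<sigma>) \<inter> closure D = {}" using disj[of "- \<sigma>"] closure_Un_frontier[of D] by auto
  have "p + \<i> * of_real (\<sigma> * s) \<in> D \<and> p - \<i> * of_real (\<sigma> * s) \<notin> closure D" if s: "0 < s" "s < \<eta>" for s
  proof -
    have "p + \<i> * of_real (\<sigma> * s) \<in> H \<sigma>" "p - \<i> * of_real (\<sigma> * s) \<in> H (- \<sigma>)"
      using \<sigma>(1) s \<kappa>\<eta> \<psi>p by (auto simp: H_def)
    then show ?thesis using HD HE by blast
  qed
  then show ?thesis using \<sigma>(1) \<kappa>\<eta>(2) by (intro exI[of _ \<sigma>] exI[of _ \<eta>]) auto
qed

section \<open>Regular points of the periodic parametrization\<close>

lemma add_of_int_of_periodic:
  fixes g :: "real \<Rightarrow> 'a"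
  assumes per: "\<And>t. g (t + 1) = g t"
  shows "g (t + of_int k) = g t"
proof -
  have nat: "g (t + real n) = g t" for t n
    by (induction n) (use per in \<open>simp_all add: add.assoc[symmetric] add.commute[of 1]\<close>)
  show ?thesis
    using nat[of t "nat k"] nat[of "t + of_int k" "nat (-k)"] by (cases "k \<ge> 0") auto
qed

lemma periodic_simple_loop_injective:
  fixes g :: "real \<Rightarrow> complex"
  assumes per: "\<And>t::real. g (t + 1) = g t" and g: "simple_path g" and eq: "g s = g t"
  shows "s - t \<in> \<int>"
proof -
  note int = add_of_int_of_periodic[of g, OF per]
  have fr: "g (frac x) = g x" for x
    using int[of "frac x" "\<lfloor>x\<rfloor>"] by (simp add: frac_def)
  have "frac s = frac t"
  proof -
    have "loop_free g" using g by (simp add: simple_path_def)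
    moreover have "frac s \<in> {0..1}" "frac t \<in> {0..1}" "frac s < 1" "frac t < 1"
      by (auto simp: frac_lt_1 less_imp_le)
    moreover have "g (frac s) = g (frac t)" using eq by (simp add: fr)
    ultimately show ?thesis unfolding loop_free_def by fastforce
  qed
  then have "s - t = of_int (\<lfloor>s\<rfloor> - \<lfloor>t\<rfloor>)" by (simp add: frac_def)
  then show ?thesis by (metis Ints_of_int)
qed

lemma has_real_derivative_Re:
  "(g has_vector_derivative d) F \<Longrightarrow> ((\<lambda>t. Re (g t)) has_real_derivative Re d) F"
  unfolding has_real_derivative_iff_has_vector_derivative
  by (rule bounded_linear.has_vector_derivative[OF bounded_linear_Re])

text \<open>With nonzero horizontal velocity the curve is locally a graph over the real axis.
  Injectivity modulo 1 and compactness of the rest of the loop keep all other arcs away from the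
  point.\<close>

lemma crossing_at_regular_point:
  assumes D: "open D" and per: "\<And>t. g (t + 1) = g t" and g: "simple_path g" "path_image g = frontier D"
    and deriv: "\<And>t. (g has_vector_derivative g' t) (at t)" and cont': "continuous_on UNIV g'"
    and reg: "Re (g' s1) \<noteq> 0"
    and ext: "\<And>\<rho>. \<rho> > 0 \<Longrightarrow> \<exists>e\<in>ball (g s1) \<rho>. e \<notin> closure D"
  shows "\<exists>\<sigma> \<epsilon>. \<bar>\<sigma>\<bar> = 1 \<and> \<epsilon> > 0 \<and> (\<forall>s. 0 < s \<longrightarrow> s < \<epsilon> \<longrightarrow>
         g s1 + \<i> * of_real (\<sigma> * s) \<in> D \<and> g s1 - \<i> * of_real (\<sigma> * s) \<notin> closure D)"
proof -
  note int = add_of_int_of_periodic[of g, OF per]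
  have contg: "continuous_on S g" for S
    using deriv by (intro continuous_at_imp_continuous_on ballI) (metis has_vector_derivative_continuous)
  have in_frontier: "g t \<in> frontier D" for t
  proof -
    have "g t = g (frac t)" using int[of "frac t" "\<lfloor>t\<rfloor>"] by (simp add: frac_def)
    moreover have "frac t \<in> {0..1}" by (auto simp: frac_lt_1 less_imp_le)
    ultimately show ?thesis unfolding g(2)[symmetric] path_image_def by auto
  qed
  define \<tau> where "\<tau> = sgn (Re (g' s1))"
  have \<tau>: "\<tau> = 1 \<or> \<tau> = -1" using reg by (auto simp: \<tau>_def sgn_if)
  define \<rho> where "\<rho> t = Re (g t)" for t
  define p where "p = g s1"
  have "open {t. 0 < \<tau> * Re (g' t)}"
    by (intro open_Collect_less continuous_intros cont')
  moreover have "s1 \<in> {t. 0 < \<tau> * Re (g' t)}" using reg by (auto simp: \<tau>_def sgn_if)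
  ultimately obtain \<kappa>' where \<kappa>': "\<kappa>' > 0" "cball s1 \<kappa>' \<subseteq> {t. 0 < \<tau> * Re (g' t)}" using open_contains_cball by blast
  \<comment> \<open>The cap 1/4 keeps the window of monotonicity shorter than a period, so that the
    remaining parameters, which form \<open>B\<close> below, are a nonempty interval.\<close>
  define \<kappa>0 where "\<kappa>0 = min \<kappa>' (1/4)"
  have \<kappa>0: "\<kappa>0 > 0" "\<kappa>0 \<le> 1/4" using \<kappa>' by (auto simp: \<kappa>0_def)
  have mono: "\<tau> * \<rho> s < \<tau> * \<rho> t" if st: "s1 - \<kappa>0 \<le> s" "s < t" "t \<le> s1 + \<kappa>0" for s t
  proof (rule DERIV_pos_imp_increasing[OF st(2)])
    fix x assume x: "s \<le> x" "x \<le> t"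
    have "((\<lambda>t. \<tau> * \<rho> t) has_real_derivative \<tau> * Re (g' x)) (at x)"
      unfolding \<rho>_def by (intro DERIV_cmult has_real_derivative_Re deriv)
    moreover have "x \<in> cball s1 \<kappa>'" using x st by (auto simp: \<kappa>0_def dist_real_def)
    ultimately show "\<exists>y. ((\<lambda>t. \<tau> * \<rho> t) has_real_derivative y) (at x) \<and> 0 < y" using \<kappa>'(2) by blast
  qed
  define B where "B = g ` {s1 + \<kappa>0..s1 + 1 - \<kappa>0}"
  have "compact B" unfolding B_def by (intro compact_continuous_image contg) auto
  moreover have "p \<notin> B"
  proof
    assume "p \<in> B"
    then obtain s where s: "s1 + \<kappa>0 \<le> s" "s \<le> s1 + 1 - \<kappa>0" "g s = g s1" by (auto simp: B_def p_def)
    then have "s - s1 \<in> \<int>" using periodic_simple_loop_injective[OF per g(1)] by blast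
    then obtain k :: int where "s - s1 = of_int k" by (auto elim: Ints_cases)
    then have "0 < k" "k < 1" using s \<kappa>0 by linarith+
    then show False by simp
  qed
  ultimately obtain e0 where e0: "e0 > 0" "ball p e0 \<subseteq> - B"
    using openE[of "- B" p] compact_imp_closed by (metis ComplI open_Compl)
  \<comment> \<open>Half of \<open>e0\<close>, so that the whole box of half-sides at most
    \<open>\<eta>\<close> lies in \<open>ball p e0\<close> and misses \<open>B\<close>.\<close>
  define \<eta> where "\<eta> = e0 / 2"
  have \<eta>: "\<eta> > 0" using e0 by (simp add: \<eta>_def)
  obtain \<kappa>2 where \<kappa>2: "\<kappa>2 > 0" "\<And>s. \<bar>s - s1\<bar> < \<kappa>2 \<Longrightarrow> norm (g s - p) < \<eta>"
    using contg[of UNIV, unfolded continuous_on_iff, rule_format, OF UNIV_I \<eta>, of s1] by (auto simp: dist_norm p_def)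
  define \<kappa>1 where "\<kappa>1 = min \<kappa>0 (\<kappa>2/2)"
  have \<kappa>1: "0 < \<kappa>1" "\<kappa>1 \<le> \<kappa>0" "\<kappa>1 < \<kappa>2" using \<kappa>0 \<kappa>2 by (auto simp: \<kappa>1_def)
  define J where "J = {s1 - \<kappa>1..s1 + \<kappa>1}"
  \<comment> \<open>The last two entries make the projection of \<open>J\<close> cover the interval
    of radius \<open>\<kappa>\<close> about \<open>Re p\<close>; the sign \<open>\<tau>\<close>
    makes the projection increasing.\<close>
  define \<kappa> where "\<kappa> = Min {\<eta>, \<tau> * \<rho> (s1 + \<kappa>1) - \<tau> * \<rho> s1, \<tau> * \<rho> s1 - \<tau> * \<rho> (s1 - \<kappa>1)}"
  have \<kappa>: "\<kappa> > 0" "\<kappa> \<le> \<eta>" "\<kappa> \<le> \<tau> * \<rho> (s1 + \<kappa>1) - \<tau> * \<rho> s1" "\<kappa> \<le> \<tau> * \<rho> s1 - \<tau> * \<rho> (s1 - \<kappa>1)"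
    using \<eta> \<kappa>1 mono[of s1 "s1 + \<kappa>1"] mono[of "s1 - \<kappa>1" s1] by (auto simp: \<kappa>_def)
  have cont\<rho>: "continuous_on S \<rho>" for S unfolding \<rho>_def by (intro continuous_intros contg)
  have inj: "inj_on \<rho> J"
  proof (rule inj_onI, rule ccontr)
    fix s t assume st: "s \<in> J" "t \<in> J" "\<rho> s = \<rho> t" "s \<noteq> t"
    then have "s < t \<or> t < s" by auto
    then show False using mono[of s t] mono[of t s] st \<kappa>1 by (auto simp: J_def)
  qed
  have onto: "x \<in> \<rho> ` J" if x: "\<bar>x - \<rho> s1\<bar> < \<kappa>" for x
  proof -
    have "\<bar>\<tau> * x - \<tau> * \<rho> s1\<bar> < \<kappa>" using x \<tau> by auto
    then have "\<exists>s\<ge>s1 - \<kappa>1. s \<le> s1 + \<kappa>1 \<and> \<tau> * \<rho> s = \<tau> * x"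
      using \<kappa> \<kappa>1 by (intro IVT') (auto intro!: continuous_intros cont\<rho>)
    then show ?thesis using \<tau> by (auto simp: J_def)
  qed
  define \<theta> where "\<theta> = the_inv_into J \<rho>"
  have \<theta>: "\<theta> x \<in> J" "\<rho> (\<theta> x) = x" if "\<bar>x - \<rho> s1\<bar> < \<kappa>" for x
    using onto[OF that] by (simp_all add: \<theta>_def the_inv_into_into[OF inj] f_the_inv_into_f[OF inj])
  have \<theta>\<rho>: "\<theta> (\<rho> s) = s" if "s \<in> J" for s using inj that by (simp add: \<theta>_def the_inv_into_f_f)
  have Rep: "Re p = \<rho> s1" by (simp add: p_def \<rho>_def)
  define \<psi> where "\<psi> x = Im (g (\<theta> x))" for x
  show ?thesis
    unfolding p_def[symmetric]
  proof (rule crossing_of_local_graph[OF D])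
    show "p \<in> frontier D" using in_frontier by (simp add: p_def)
    show "\<exists>e\<in>ball p \<rho>. e \<notin> closure D" if "\<rho> > 0" for \<rho> using ext[OF that] by (simp add: p_def)
    have "continuous_on (\<rho> ` J) \<theta>"
      unfolding \<theta>_def by (rule continuous_on_inv_into[OF cont\<rho> _ inj]) (simp add: J_def)
    moreover have "{Re p - \<kappa><..<Re p + \<kappa>} \<subseteq> \<rho> ` J" using onto by (auto simp: Rep abs_less_iff)
    ultimately have "continuous_on {Re p - \<kappa><..<Re p + \<kappa>} \<theta>" using continuous_on_subset by blast
    then show "continuous_on {Re p - \<kappa><..<Re p + \<kappa>} \<psi>"
      unfolding \<psi>_def by (intro continuous_intros continuous_on_compose2[OF contg[of UNIV]]) auto
    show "\<bar>\<psi> x - Im p\<bar> < \<eta>" if "\<bar>x - Re p\<bar> < \<kappa>" for x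
    proof -
      have "\<bar>\<theta> x - s1\<bar> < \<kappa>2" using \<theta>(1)[of x] that \<kappa>1 by (auto simp: Rep J_def)
      then show ?thesis using \<kappa>2(2)[of "\<theta> x"] abs_Im_le_cmod[of "g (\<theta> x) - p"] by (simp add: \<psi>_def)
    qed
    show "\<psi> (Re p) = Im p" using \<theta>\<rho>[of s1] \<kappa>1 by (simp add: \<psi>_def Rep J_def) (simp add: p_def)
    fix z assume z: "\<bar>Re z - Re p\<bar> < \<kappa>" "\<bar>Im z - Im p\<bar> < \<eta>"
    show "z \<in> frontier D \<longleftrightarrow> Im z = \<psi> (Re z)"
    proof
      assume "Im z = \<psi> (Re z)"
      then have "z = g (\<theta> (Re z))" using \<theta>(2)[of "Re z"] z(1) by (simp add: complex_eq_iff \<psi>_def Rep) (simp add: \<rho>_def)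
      then show "z \<in> frontier D" using in_frontier by metis
    next
      assume "z \<in> frontier D"
      then obtain s where s: "z = g s" by (auto simp: g(2)[symmetric] path_image_def)
      \<comment> \<open>Moves the parameter into the period starting at
        \<open>s1 - \<kappa>0\<close>. There it lies in the window or in the range of
        \<open>B\<close>, and the latter is excluded since \<open>z\<close> is in
        \<open>ball p e0\<close>.\<close>
      define k where "k = \<lfloor>s - (s1 - \<kappa>0)\<rfloor>"
      define s' where "s' = s - of_int k"
      have gs': "g s' = z" using int[of s' k] s by (simp add: s'_def)
      have s': "s1 - \<kappa>0 \<le> s'" "s' < s1 - \<kappa>0 + 1" unfolding s'_def k_def by linarith+
      have "norm (z - p) \<le> \<bar>Re (z - p)\<bar> + \<bar>Im (z - p)\<bar>" by (rule cmod_le)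
      then have "z \<in> ball p e0" using z \<kappa>(2) by (simp add: dist_norm norm_minus_commute \<eta>_def)
      then have "z \<notin> B" using e0 by blast
      then have s'': "s' < s1 + \<kappa>0" using s' gs' by (force simp: B_def)
      have near: "\<bar>\<tau> * \<rho> s' - \<tau> * \<rho> s1\<bar> < \<kappa>" using z(1) gs' \<tau> by (auto simp: \<rho>_def p_def)
      have "s' \<in> J"
      proof (rule ccontr)
        assume "s' \<notin> J"
        then consider "s1 + \<kappa>1 < s'" | "s' < s1 - \<kappa>1" by (auto simp: J_def)
        then show False
        proof cases
          case 1
          then show False using mono[of "s1 + \<kappa>1" s'] s'' \<kappa>1 near \<kappa>(3) \<kappa>0 by linarith
        next
          case 2
          then show False using mono[of s' "s1 - \<kappa>1"] s' \<kappa>1 near \<kappa>(4) \<kappa>0 by linarith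
        qed
      qed
      then have "\<theta> (Re z) = s'" using \<theta>\<rho> gs' by (auto simp: \<rho>_def)
      then show "Im z = \<psi> (Re z)" using gs' by (simp add: \<psi>_def)
    qed
  qed (use \<kappa> \<eta> in auto)
qed

section \<open>Real-analytic arcs and their critical points\<close>

text \<open>Convergence of the series at the real point \<open>t0 + x\<close> forces convergence in
  the complex disc of radius \<open>x\<close>, so the same series defines a holomorphic
  extension.\<close>

lemma real_analytic_local_extension:
  assumes "real_analytic g"
  obtains r P where "r > 0" "P holomorphic_on ball (of_real t0) r" "\<And>t. \<bar>t - t0\<bar> < r \<Longrightarrow> g t = P (of_real t)"
proof -
  obtain c r where r: "r > 0" and c: "\<And>t. \<bar>t - t0\<bar> < r \<Longrightarrow> (\<lambda>n. c n * of_real (t - t0) ^ n) sums g t"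
    using assms unfolding real_analytic_def by metis
  define P where "P w = (\<Sum>n. c n * (w - of_real t0) ^ n)" for w
  have "P holomorphic_on ball (of_real t0) r"
  proof (rule power_series_holomorphic)
    fix w :: complex assume w: "w \<in> ball (of_real t0) r"
    then obtain x where x: "dist (of_real t0) w < x" "x < r" using dense[of "dist (of_real t0) w" r] by auto
    have x0: "0 < x" using x(1) zero_le_dist[of "of_real t0" w] by linarith
    have "(\<lambda>n. c n * of_real ((t0 + x) - t0) ^ n) sums g (t0 + x)" using x x0 by (intro c) auto
    then have "summable (\<lambda>n. c n * of_real x ^ n)" by (simp add: sums_iff)
    then have "summable (\<lambda>n. c n * (w - of_real t0) ^ n)"
      by (rule powser_inside) (use x x0 in \<open>simp add: dist_norm norm_minus_commute\<close>)
    then show "(\<lambda>n. c n * (w - of_real t0) ^ n) sums P w" unfolding P_def by (rule summable_sums)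
  qed
  moreover have "g t = P (of_real t)" if "\<bar>t - t0\<bar> < r" for t
    using c[OF that] unfolding P_def by (simp add: sums_iff)
  ultimately show ?thesis using that r by blast
qed

lemma has_vector_derivative_of_local_extension:
  assumes r: "P holomorphic_on ball (of_real t0) r" "\<And>t. \<bar>t - t0\<bar> < r \<Longrightarrow> g t = P (of_real t)"
    and t: "\<bar>t - t0\<bar> < r"
  shows "(g has_vector_derivative deriv P (of_real t)) (at t)"
proof -
  have "of_real t \<in> ball (of_real t0 :: complex) r" using t by (simp add: dist_commute dist_real_def)
  then have "(P has_field_derivative deriv P (of_real t)) (at (of_real t))"
    using r(1) holomorphic_derivI open_ball by blast
  then have "((\<lambda>t. P (of_real t)) has_vector_derivative deriv P (of_real t)) (at t)"
    by (rule has_vector_derivative_real_field)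
  then show ?thesis
    by (rule has_vector_derivative_transform_within_open[of _ _ _ "ball t0 r"])
       (use t r(2) in \<open>auto simp: dist_real_def abs_minus_commute\<close>)
qed

lemma real_analytic_derivative:
  assumes "real_analytic g"
  shows "(g has_vector_derivative vector_derivative g (at t)) (at t)"
    "continuous_on UNIV (\<lambda>t. vector_derivative g (at t))"
proof -
  have d: "(g has_vector_derivative vector_derivative g (at t)) (at t)" for t
  proof -
    obtain r P where "r > 0" "P holomorphic_on ball (of_real t) r" "\<And>s. \<bar>s - t\<bar> < r \<Longrightarrow> g s = P (of_real s)"
      using real_analytic_local_extension[OF assms] by metis
    then have "(g has_vector_derivative deriv P (of_real t)) (at t)"
      by (intro has_vector_derivative_of_local_extension[of P t r]) auto
    then show ?thesis by (simp add: vector_derivative_at)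
  qed
  then show "(g has_vector_derivative vector_derivative g (at t)) (at t)" .
  show "continuous_on UNIV (\<lambda>t. vector_derivative g (at t))"
  proof (rule continuous_at_imp_continuous_on, rule ballI)
    fix t0 :: real
    obtain r P where r: "r > 0" "P holomorphic_on ball (of_real t0) r" "\<And>s. \<bar>s - t0\<bar> < r \<Longrightarrow> g s = P (of_real s)"
      using real_analytic_local_extension[OF assms] by metis
    have "continuous_on (ball t0 r) (\<lambda>t. deriv P (of_real t))"
      by (rule continuous_on_compose2[OF holomorphic_on_imp_continuous_on[OF holomorphic_deriv[OF r(2) open_ball]]])
         (auto intro!: continuous_intros simp: dist_real_def)
    then have "continuous_on (ball t0 r) (\<lambda>t. vector_derivative g (at t))"
      by (rule continuous_on_eq)
         (auto intro!: vector_derivative_at[symmetric] has_vector_derivative_of_local_extension[OF r(2,3)]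
               simp: dist_real_def abs_minus_commute)
    then show "isCont (\<lambda>t. vector_derivative g (at t)) t0"
      using r(1) by (simp add: continuous_on_eq_continuous_at)
  qed
qed

text \<open>Take real parts of the coefficients. The horizontal coordinate thereby gets a
  holomorphic extension of its own, to whose derivative the identity theorem applies.\<close>

lemma real_analytic_Re:
  assumes "real_analytic g"
  shows "real_analytic (\<lambda>t. of_real (Re (g t)))"
  unfolding real_analytic_def
proof
  fix t0
  obtain c r where r: "r > 0" and c: "\<And>t. \<bar>t - t0\<bar> < r \<Longrightarrow> (\<lambda>n. c n * of_real (t - t0) ^ n) sums g t"
    using assms unfolding real_analytic_def by metis
  have s: "(\<lambda>n. of_real (Re (c n)) * of_real (t - t0) ^ n) sums (of_real (Re (g t)) :: complex)"
    if "\<bar>t - t0\<bar> < r" for t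
  proof -
    have "(\<lambda>n. of_real (Re (c n * of_real ((t - t0) ^ n)))) sums (of_real (Re (g t)) :: complex)"
      using c[OF that] by (intro sums_of_real sums_Re) (simp only: of_real_power)
    moreover have "complex_of_real (Re (c n * of_real ((t - t0) ^ n))) = of_real (Re (c n)) * of_real (t - t0) ^ n" for n
      by (subst of_real_power[symmetric])
         (simp only: times_complex.sel Re_complex_of_real Im_complex_of_real mult_zero_right diff_zero of_real_mult)
    ultimately show ?thesis by (simp only:)
  qed
  show "\<exists>c :: nat \<Rightarrow> complex. \<exists>r>0. \<forall>t. \<bar>t - t0\<bar> < r \<longrightarrow>
      (\<lambda>n. c n * of_real (t - t0) ^ n) sums of_real (Re (g t))"
    by (rule exI[of _ "\<lambda>n. of_real (Re (c n))"], rule exI[of _ r]) (intro conjI allI impI r s)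
qed

text \<open>Near an accumulation point of zeros the derivative of the local extension vanishes
  identically. The set of accumulation points is thus open as well as closed; if it were nonempty it
  would be the whole line and \<open>Re (g t)\<close> would be constant.\<close>

lemma finite_critical_points:
  assumes g: "real_analytic g" and nonconst: "Re (g x) \<noteq> Re (g y)"
  shows "finite {t\<in>{u..v}. Re (vector_derivative g (at t)) = 0}"
proof (rule ccontr)
  define Z where "Z = {t. Re (vector_derivative g (at t)) = 0}"
  assume "infinite {t\<in>{u..v}. Re (vector_derivative g (at t)) = 0}"
  then have "infinite (Z \<inter> {u..v})" by (simp add: Z_def Int_def conj_commute)
  then obtain l where l: "l islimpt Z \<inter> {u..v}"
    using compact_eq_Bolzano_Weierstrass[of "{u..v}"] by auto
  define h where "h t = (of_real (Re (g t)) :: complex)" for t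
  have hd: "(h has_vector_derivative of_real (Re (vector_derivative g (at t)))) (at t)" for t
    unfolding h_def
    by (rule bounded_linear.has_vector_derivative[OF bounded_linear_of_real])
       (rule bounded_linear.has_vector_derivative[OF bounded_linear_Re real_analytic_derivative(1)[OF g]])
  have loc: "\<exists>r>0. \<forall>t. \<bar>t - t0\<bar> < r \<longrightarrow> t \<in> Z" if t0: "t0 islimpt Z" for t0
  proof -
    obtain r P where r: "r > 0" "P holomorphic_on ball (of_real t0) r" "\<And>s. \<bar>s - t0\<bar> < r \<Longrightarrow> h s = P (of_real s)"
      using real_analytic_local_extension[OF real_analytic_Re[OF g]] unfolding h_def by metis
    have dP: "deriv P (of_real t) = of_real (Re (vector_derivative g (at t)))" if "\<bar>t - t0\<bar> < r" for t
      using has_vector_derivative_of_local_extension[OF r(2,3) that] hd vector_derivative_unique_at by blast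
    have lim: "of_real t0 islimpt (of_real ` (Z \<inter> ball t0 r) :: complex set)"
      unfolding islimpt_approachable
    proof (intro allI impI)
      fix e :: real assume "e > 0"
      then obtain t where "t \<in> Z" "t \<noteq> t0" "dist t t0 < min e r"
        using t0 r(1) unfolding islimpt_approachable by (meson min_less_iff_conj)
      then show "\<exists>x'\<in>of_real ` (Z \<inter> ball t0 r). x' \<noteq> (of_real t0 :: complex) \<and> dist x' (of_real t0) < e"
        by (intro bexI[of _ "of_real t"]) (auto simp: dist_commute)
    qed
    have "t \<in> Z" if t: "\<bar>t - t0\<bar> < r" for t
    proof -
      have "deriv P (of_real t) = 0"
      proof (rule analytic_continuation[OF holomorphic_deriv[OF r(2) open_ball] open_ball connected_ball _ _ lim])
        show "deriv P z = 0" if "z \<in> of_real ` (Z \<inter> ball t0 r)" for z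
          using that dP by (auto simp: Z_def dist_real_def abs_minus_commute)
      qed (use t r(1) in \<open>auto simp: dist_real_def abs_minus_commute\<close>)
      then show ?thesis using dP[OF t] by (simp add: Z_def)
    qed
    then show ?thesis using r(1) by blast
  qed
  define L where "L = {t. t islimpt Z}"
  have "closed L" unfolding L_def by (rule closed_limpts)
  moreover have "open L"
    unfolding open_dist
  proof
    fix t0 assume "t0 \<in> L"
    then obtain r where r: "r > 0" "\<And>t. \<bar>t - t0\<bar> < r \<Longrightarrow> t \<in> Z" using loc unfolding L_def by blast
    have "ball t0 r \<subseteq> Z" using r(2) by (auto simp: dist_real_def abs_minus_commute)
    moreover have "t islimpt ball t0 r" if "dist t t0 < r" for t
      using that by (intro open_imp_islimpt) (auto simp: dist_commute)
    ultimately have "t \<in> L" if "dist t t0 < r" for t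
      using that islimpt_subset unfolding L_def by blast
    then show "\<exists>e>0. \<forall>y. dist y t0 < e \<longrightarrow> y \<in> L" using r(1) by blast
  qed
  moreover have "l \<in> L" using l islimpt_subset unfolding L_def by blast
  ultimately have "L = UNIV" using clopen[of L] by blast
  then have Zall: "t \<in> Z" for t using loc[of t] unfolding L_def by force
  have "((\<lambda>t. Re (g t)) has_real_derivative 0) (at t)" for t
    using has_real_derivative_Re[OF real_analytic_derivative(1)[OF g, of t]] Zall[of t]
    by (simp add: Z_def)
  then have "Re (g x) = Re (g y)" by (intro DERIV_isconst_all) auto
  then show False using nonconst by simp
qed

lemma analytic_Jordan_domain_regularity:
  assumes D: "open D" "bounded D" and C: "real_analytic_simple_closed_curve (frontier D)"
    and nonconst: "z0 \<in> frontier D" "z1 \<in> frontier D" "Re z0 \<noteq> Re z1"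
  shows "\<And>p \<rho>. p \<in> frontier D \<Longrightarrow> \<rho> > 0 \<Longrightarrow> \<exists>e\<in>ball p \<rho>. e \<notin> closure D"
    and "\<exists>V. finite V \<and> (\<forall>p\<in>frontier D. Re p \<notin> V \<longrightarrow>
      (\<exists>\<sigma> \<epsilon>. \<bar>\<sigma>\<bar> = 1 \<and> \<epsilon> > 0 \<and> (\<forall>s. 0 < s \<longrightarrow> s < \<epsilon> \<longrightarrow>
         p + \<i> * of_real (\<sigma> * s) \<in> D \<and> p - \<i> * of_real (\<sigma> * s) \<notin> closure D)))"
proof -
  obtain g where g: "real_analytic g" "\<And>t. g (t + 1) = g t" "simple_path g" "pathfinish g = pathstart g"
      "path_image g = frontier D"
    using C unfolding real_analytic_simple_closed_curve_def by blast
  show ext: "\<And>p \<rho>. p \<in> frontier D \<Longrightarrow> \<rho> > 0 \<Longrightarrow> \<exists>e\<in>ball p \<rho>. e \<notin> closure D"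
    by (rule Jordan_domain_exterior[OF D g(3-5)])
  \<comment> \<open>The abscissas of the vertical tangents; by periodicity one period of parameters
    describes the whole curve.\<close>
  define V where "V = (\<lambda>t. Re (g t)) ` {t\<in>{0..1}. Re (vector_derivative g (at t)) = 0}"
  obtain x y where "z0 = g x" "z1 = g y"
    using nonconst(1,2) unfolding g(5)[symmetric] path_image_def by blast
  then have "finite V"
    unfolding V_def using nonconst(3) by (intro finite_imageI finite_critical_points[OF g(1), of x y]) simp
  moreover have "\<exists>\<sigma> \<epsilon>. \<bar>\<sigma>\<bar> = 1 \<and> \<epsilon> > 0 \<and> (\<forall>s. 0 < s \<longrightarrow> s < \<epsilon> \<longrightarrow>
         p + \<i> * of_real (\<sigma> * s) \<in> D \<and> p - \<i> * of_real (\<sigma> * s) \<notin> closure D)"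
    if p: "p \<in> frontier D" "Re p \<notin> V" for p
  proof -
    obtain t where t: "t \<in> {0..1}" "p = g t" using p(1) unfolding g(5)[symmetric] path_image_def by blast
    then have "Re (vector_derivative g (at t)) \<noteq> 0" using p(2) unfolding V_def by blast
    from crossing_at_regular_point[OF D(1) g(2,3,5) real_analytic_derivative[OF g(1)] this] ext[OF p(1)]
    show ?thesis unfolding t(2) by blast
  qed
  ultimately show "\<exists>V. finite V \<and> (\<forall>p\<in>frontier D. Re p \<notin> V \<longrightarrow>
      (\<exists>\<sigma> \<epsilon>. \<bar>\<sigma>\<bar> = 1 \<and> \<epsilon> > 0 \<and> (\<forall>s. 0 < s \<longrightarrow> s < \<epsilon> \<longrightarrow>
         p + \<i> * of_real (\<sigma> * s) \<in> D \<and> p - \<i> * of_real (\<sigma> * s) \<notin> closure D)))" by blast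
qed

section \<open>Uniform margins and the two applications\<close>

lemma compact_positive_margin:
  fixes \<phi> :: "'a::topological_space \<Rightarrow> real"
  assumes "compact K" "continuous_on K \<phi>" "\<And>x. x \<in> K \<Longrightarrow> \<phi> x > 0"
  obtains \<delta> where "\<delta> > 0" "\<And>x. x \<in> K \<Longrightarrow> \<phi> x > \<delta>"
proof (cases "K = {}")
  case False
  then obtain x where "x \<in> K" "\<And>y. y \<in> K \<Longrightarrow> \<phi> x \<le> \<phi> y"
    using continuous_attains_inf[OF assms(1) _ assms(2)] by blast
  then show ?thesis using assms(3)[of x] that[of "\<phi> x / 2"] by fastforce
qed (use that[of 1] in auto)

lemma bounded_on_translates:
  assumes "bounded D" "continuous_on (\<Union>t\<in>{a..b}. vshift t (frontier D)) f"
  obtains F where "\<And>z t. z \<in> frontier D \<Longrightarrow> t \<in> {a..b} \<Longrightarrow> norm (f (z + \<i> * of_real t)) \<le> F"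
proof -
  have "compact ((\<lambda>zt. fst zt + \<i> * of_real (snd zt)) ` (frontier D \<times> {a..b}))"
    using assms(1) by (intro compact_continuous_image continuous_intros compact_Times compact_frontier_bounded) auto
  moreover have "(\<lambda>zt. fst zt + \<i> * of_real (snd zt)) ` (frontier D \<times> {a..b}) = (\<Union>t\<in>{a..b}. vshift t (frontier D))"
    by force
  ultimately have "bounded (f ` (\<Union>t\<in>{a..b}. vshift t (frontier D)))"
    using assms(2) by (intro compact_imp_bounded compact_continuous_image) auto
  then obtain F where "\<And>w. w \<in> (\<Union>t\<in>{a..b}. vshift t (frontier D)) \<Longrightarrow> norm (f w) \<le> F"
    unfolding bounded_iff by blast
  then show ?thesis by (intro that[of F]) blast
qed

text \<open>Used twice, for \<open>D\<close> and for its reflection with the intervals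
  \<open>{a..b}\<close> and \<open>{c..d}\<close> exchanged. The curve enters only by
  \<open>exterior\<close> and \<open>crossing\<close>, which transfer under conjugation.\<close>

lemma holomorphic_on_interior_of_translates:
  fixes D :: "complex set" and lam :: "real \<Rightarrow> real"
  assumes D: "open D" "connected D" "bounded D"
    and \<alpha>\<beta>: "\<alpha> < \<beta>" and proj: "Re ` frontier D = {\<alpha>..\<beta>}"
    and lam: "continuous_on UNIV lam"
    and below: "\<And>z. z \<in> closure D \<Longrightarrow> a + Im z < lam (Re z)" "\<And>z. z \<in> closure D \<Longrightarrow> c - Im z < lam (Re z)"
    and above: "\<And>z. z \<in> closure D \<Longrightarrow> lam (Re z) < b + Im z" "\<And>z. z \<in> closure D \<Longrightarrow> lam (Re z) < d - Im z"
    and strip: "\<And>z. z \<in> closure D \<Longrightarrow> \<alpha> \<le> Re z \<and> Re z \<le> \<beta>"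
    and cont: "continuous_on (\<Union>t\<in>{a..b}. vshift t (frontier D)) f"
      "continuous_on (\<Union>s\<in>{c..d}. vshift s (frontier (cnj ` D))) f"
    and ext: "\<And>t. t \<in> {a..b} \<Longrightarrow> holomorphic_extension_to f t D"
      "\<And>s. s \<in> {c..d} \<Longrightarrow> holomorphic_extension_to f s (cnj ` D)"
    and exterior: "\<And>p \<rho>. p \<in> frontier D \<Longrightarrow> \<rho> > 0 \<Longrightarrow> \<exists>e\<in>ball p \<rho>. e \<notin> closure D"
    and V: "finite V"
    and crossing: "\<And>p. p \<in> frontier D \<Longrightarrow> Re p \<notin> V \<Longrightarrow>
      \<exists>\<sigma> \<epsilon>. \<bar>\<sigma>\<bar> = 1 \<and> \<epsilon> > 0 \<and> (\<forall>s. 0 < s \<longrightarrow> s < \<epsilon> \<longrightarrow>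
         p + \<i> * of_real (\<sigma> * s) \<in> D \<and> p - \<i> * of_real (\<sigma> * s) \<notin> closure D)"
  shows "f holomorphic_on interior (\<Union>t\<in>{a..b}. vshift t (frontier D))"
proof -
  have D': "open (cnj ` D)" "connected (cnj ` D)" "bounded (cnj ` D)"
    using D by (auto simp: open_cnj_image intro!: connected_continuous_image continuous_intros
        bounded_linear_image bounded_linear_cnj)
  obtain G where "continuous_on ({a..b} \<times> closure D) (\<lambda>(t,z). G t z)"
    "\<And>t. t \<in> {a..b} \<Longrightarrow> G t holomorphic_on D"
    "\<And>t z. t \<in> {a..b} \<Longrightarrow> z \<in> frontier D \<Longrightarrow> G t z = f (z + \<i> * of_real t)"
    using exists_extension_family[OF D(1,3) ext(1) cont(1)] by blast
  then interpret V: vertical_family D a b f G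
    using D by unfold_locales auto
  obtain Gs where "continuous_on ({c..d} \<times> closure (cnj ` D)) (\<lambda>(t,z). Gs t z)"
    "\<And>t. t \<in> {c..d} \<Longrightarrow> Gs t holomorphic_on (cnj ` D)"
    "\<And>t z. t \<in> {c..d} \<Longrightarrow> z \<in> frontier (cnj ` D) \<Longrightarrow> Gs t z = f (z + \<i> * of_real t)"
    using exists_extension_family[OF D'(1,3) ext(2) cont(2)] by blast
  then interpret W: vertical_family "cnj ` D" c d f Gs
    using D' by unfold_locales auto
  have cD: "compact (closure D)" using D(3) by (simp add: compact_closure)
  have lamRe: "continuous_on S (\<lambda>z. lam (Re z))" for S
    by (intro continuous_on_compose2[OF lam] continuous_intros) auto
  obtain \<delta>1 where \<delta>1: "\<delta>1 > 0" "\<And>z. z \<in> closure D \<Longrightarrow> lam (Re z) - (a + Im z) > \<delta>1"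
    by (rule compact_positive_margin[OF cD, of "\<lambda>z. lam (Re z) - (a + Im z)"]) (use below in \<open>auto intro!: continuous_intros lamRe\<close>)
  obtain \<delta>2 where \<delta>2: "\<delta>2 > 0" "\<And>z. z \<in> closure D \<Longrightarrow> lam (Re z) - (c - Im z) > \<delta>2"
    by (rule compact_positive_margin[OF cD, of "\<lambda>z. lam (Re z) - (c - Im z)"]) (use below in \<open>auto intro!: continuous_intros lamRe\<close>)
  obtain \<delta>3 where \<delta>3: "\<delta>3 > 0" "\<And>z. z \<in> closure D \<Longrightarrow> b + Im z - lam (Re z) > \<delta>3"
    by (rule compact_positive_margin[OF cD, of "\<lambda>z. b + Im z - lam (Re z)"]) (use above in \<open>auto intro!: continuous_intros lamRe\<close>)
  obtain \<delta>4 where \<delta>4: "\<delta>4 > 0" "\<And>z. z \<in> closure D \<Longrightarrow> d - Im z - lam (Re z) > \<delta>4"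
    by (rule compact_positive_margin[OF cD, of "\<lambda>z. d - Im z - lam (Re z)"]) (use above in \<open>auto intro!: continuous_intros lamRe\<close>)
  define \<delta> where "\<delta> = Min {\<delta>1, \<delta>2, \<delta>3, \<delta>4}"
  have \<delta>: "\<delta> > 0" "\<delta> \<le> \<delta>1" "\<delta> \<le> \<delta>2" "\<delta> \<le> \<delta>3" "\<delta> \<le> \<delta>4" using \<delta>1 \<delta>2 \<delta>3 \<delta>4 by (auto simp: \<delta>_def)
  have D_strip: "\<alpha> < Re z \<and> Re z < \<beta>" if zD: "z \<in> D" for z
  proof -
    obtain r where r: "r > 0" "cball z r \<subseteq> D" using D(1) zD open_contains_cball by blast
    have "z + of_real r \<in> cball z r" "z - of_real r \<in> cball z r" using r(1) by (simp_all add: dist_norm)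
    then have "z + of_real r \<in> closure D" "z - of_real r \<in> closure D"
      using r(2) closure_subset[of D] by blast+
    then show ?thesis using strip[of "z + of_real r"] strip[of "z - of_real r"] r(1) by simp
  qed
  \<comment> \<open>Boundary points over \<open>\<alpha>\<close> and \<open>\<beta>\<close> are
    limits of \<open>D\<close>, so the connected projection of \<open>D\<close> fills the open
    interval.\<close>
  have D_proj: "\<exists>z\<in>D. Re z = x" if x: "\<alpha> < x" "x < \<beta>" for x
  proof -
    have app: "\<exists>z\<in>D. \<bar>Re z - y\<bar> < e" if y: "y \<in> {\<alpha>..\<beta>}" and e: "e > 0" for y e
    proof -
      obtain q where q: "q \<in> frontier D" "Re q = y" using y unfolding proj[symmetric] by blast
      then have "q \<in> closure D" by (simp add: frontier_def)
      then obtain z where "z \<in> D" "dist z q < e" using e unfolding closure_approachable by blast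
      then show ?thesis using q(2) abs_Re_le_cmod[of "z - q"] by (intro bexI[of _ z]) (auto simp: dist_norm)
    qed
    obtain z1 where z1: "z1 \<in> D" "\<bar>Re z1 - \<alpha>\<bar> < x - \<alpha>" using app[of \<alpha> "x - \<alpha>"] x by auto
    obtain z2 where z2: "z2 \<in> D" "\<bar>Re z2 - \<beta>\<bar> < \<beta> - x" using app[of \<beta> "\<beta> - x"] x by auto
    have "connected (Re ` D)" using D(2) by (intro connected_continuous_image continuous_intros)
    then have "x \<in> Re ` D"
      by (rule connectedD_interval[of _ "Re z1" "Re z2"]) (use z1 z2 in auto)
    then show ?thesis by blast
  qed
  obtain F1 where F1: "\<And>z t. z \<in> frontier D \<Longrightarrow> t \<in> {a..b} \<Longrightarrow> norm (f (z + \<i> * of_real t)) \<le> F1"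
    using bounded_on_translates[OF D(3) cont(1)] by blast
  obtain F2 where F2: "\<And>z t. z \<in> frontier (cnj ` D) \<Longrightarrow> t \<in> {c..d} \<Longrightarrow> norm (f (z + \<i> * of_real t)) \<le> F2"
    using bounded_on_translates[OF D'(3) cont(2)] by blast
  interpret R: reflected_families D a b c d f G Gs \<alpha> \<beta> \<delta> "max F1 F2" lam
  proof
    show "norm (f (z + \<i> * of_real t)) \<le> max F1 F2" if "z \<in> frontier D" "t \<in> {a..b}" for z t
      using F1[OF that] by simp
    show "norm (f (cnj z + \<i> * of_real t)) \<le> max F1 F2" if "z \<in> frontier D" "t \<in> {c..d}" for z t
      using F2[of "cnj z" t] that D(1) by (simp add: frontier_cnj_image le_max_iff_disj)
  qed (use lam \<delta> D_strip D_proj \<alpha>\<beta> \<delta>1(2) \<delta>2(2) \<delta>3(2) \<delta>4(2) in \<open>fastforce+\<close>)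
  obtain h where h: "\<And>z t. \<lbrakk>z \<in> closure D; t \<in> {a..b}; z + \<i> * of_real t \<in> R.band; \<alpha> < Re z; Re z < \<beta>\<rbrakk>
       \<Longrightarrow> G t z = h (z + \<i> * of_real t)"
    using R.band_function by metis
  interpret B: banded_family D a b f G \<alpha> \<beta> \<delta> lam h
  proof
    show "G t z = h (z + \<i> * of_real t)"
      if "z \<in> closure D" "t \<in> {a..b}" "\<bar>Im (z + \<i> * of_real t) - lam (Re z)\<bar> < \<delta>" "\<alpha> < Re z" "Re z < \<beta>" for z t
      using that by (intro h) (auto simp: R.band_def)
  qed (use lam \<delta>(1) D_strip R.D_nonempty R.below R.above exterior cont(1) in auto)
  show ?thesis by (rule B.holomorphic_on_interior[OF V crossing])
qed

theorem theorem2p2: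
  fixes D Dstar Q1 Q2 :: "complex set"
    and \<alpha> \<beta> a b c d :: real
    and lam :: "real \<Rightarrow> real"
    and f :: "complex \<Rightarrow> complex"
  assumes "open D" and "connected D" and "bounded D"
    and "real_analytic_simple_closed_curve (frontier D)"
    and "Dstar = cnj ` D"
    and "\<alpha> < \<beta>"
    and "(\<Union>t. vshift t (frontier D)) = {z. \<alpha> \<le> Re z \<and> Re z \<le> \<beta>}"
    and "continuous_on {\<alpha>..\<beta>} lam"
    and "vshift a (closure D) \<subseteq> {Complex t s | t s. s < lam t \<and> \<alpha> \<le> t \<and> t \<le> \<beta>}"
    and "vshift c (closure Dstar) \<subseteq> {Complex t s | t s. s < lam t \<and> \<alpha> \<le> t \<and> t \<le> \<beta>}"
    and "vshift b (closure D) \<subseteq> {Complex t s | t s. s > lam t \<and> \<alpha> \<le> t \<and> t \<le> \<beta>}"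
    and "vshift d (closure Dstar) \<subseteq> {Complex t s | t s. s > lam t \<and> \<alpha> \<le> t \<and> t \<le> \<beta>}"
    and "Q1 = (\<Union>t\<in>{a..b}. vshift t (frontier D))"
    and "Q2 = (\<Union>s\<in>{c..d}. vshift s (frontier Dstar))"
    and "continuous_on (Q1 \<union> Q2) f"
    and "\<And>t. a \<le> t \<Longrightarrow> t \<le> b \<Longrightarrow> holomorphic_extension_to f t D"
    and "\<And>s. c \<le> s \<Longrightarrow> s \<le> d \<Longrightarrow> holomorphic_extension_to f s Dstar"
  shows "f holomorphic_on (interior Q1 \<union> interior Q2)"
proof -
  \<comment> \<open>Constant continuation beyond \<open>\<alpha>\<close> and \<open>\<beta>\<close>,
    which lets the band extend outside the strip.\<close>
  define lam' where "lam' x = lam (max \<alpha> (min \<beta> x))" for x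
  have lam': "continuous_on UNIV lam'"
    unfolding lam'_def
    by (rule continuous_on_compose2[OF assms(8)]) (use assms(6) in \<open>auto intro!: continuous_intros\<close>)
  have lam'_eq: "lam' x = lam x" if "\<alpha> \<le> x" "x \<le> \<beta>" for x using that by (simp add: lam'_def)
  have a: "a + Im z < lam' (Re z)" and strip: "\<alpha> \<le> Re z \<and> Re z \<le> \<beta>" if "z \<in> closure D" for z
  proof -
    have "z + \<i> * of_real a \<in> {Complex t s | t s. s < lam t \<and> \<alpha> \<le> t \<and> t \<le> \<beta>}"
      using assms(9) that by blast
    then show "a + Im z < lam' (Re z)" "\<alpha> \<le> Re z \<and> Re z \<le> \<beta>"
      by (auto simp: complex_eq_iff lam'_eq add.commute)
  qed
  have b: "lam' (Re z) < b + Im z" if "z \<in> closure D" for z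
  proof -
    have "z + \<i> * of_real b \<in> {Complex t s | t s. s > lam t \<and> \<alpha> \<le> t \<and> t \<le> \<beta>}"
      using assms(11) that by blast
    then show ?thesis by (auto simp: complex_eq_iff lam'_eq add.commute)
  qed
  have c: "c - Im z < lam' (Re z)" if "z \<in> closure D" for z
  proof -
    have "cnj z + \<i> * of_real c \<in> {Complex t s | t s. s < lam t \<and> \<alpha> \<le> t \<and> t \<le> \<beta>}"
      using assms(10) that unfolding assms(5) closure_cnj_image by blast
    then show ?thesis by (auto simp: complex_eq_iff lam'_eq)
  qed
  have d: "lam' (Re z) < d - Im z" if "z \<in> closure D" for z
  proof -
    have "cnj z + \<i> * of_real d \<in> {Complex t s | t s. s > lam t \<and> \<alpha> \<le> t \<and> t \<le> \<beta>}"
      using assms(12) that unfolding assms(5) closure_cnj_image by blast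
    then show ?thesis by (auto simp: complex_eq_iff lam'_eq)
  qed
  have proj: "Re ` frontier D = {\<alpha>..\<beta>}"
  proof (intro equalityI subsetI)
    fix x assume "x \<in> Re ` frontier D"
    then show "x \<in> {\<alpha>..\<beta>}" using strip by (auto simp: frontier_def)
  next
    fix x assume "x \<in> {\<alpha>..\<beta>}"
    then have "of_real x \<in> (\<Union>t. vshift t (frontier D))" unfolding assms(7) by simp
    then obtain t where "of_real x \<in> vshift t (frontier D)" by blast
    then show "x \<in> Re ` frontier D" by (auto simp: vshift_mem_iff intro!: image_eqI[of _ Re "of_real x - \<i> * of_real t"])
  qed
  have "\<alpha> \<in> Re ` frontier D" "\<beta> \<in> Re ` frontier D" unfolding proj using assms(6) by auto
  then obtain z0 z1 where z: "z0 \<in> frontier D" "z1 \<in> frontier D" "Re z0 \<noteq> Re z1" using assms(6) by force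
  note reg = analytic_Jordan_domain_regularity[OF assms(1,3,4) z]
  obtain V where V: "finite V" "\<And>p. p \<in> frontier D \<Longrightarrow> Re p \<notin> V \<Longrightarrow>
      \<exists>\<sigma> \<epsilon>. \<bar>\<sigma>\<bar> = 1 \<and> \<epsilon> > 0 \<and> (\<forall>s. 0 < s \<longrightarrow> s < \<epsilon> \<longrightarrow>
         p + \<i> * of_real (\<sigma> * s) \<in> D \<and> p - \<i> * of_real (\<sigma> * s) \<notin> closure D)"
    using reg(2) by blast
  have cont: "continuous_on Q1 f" "continuous_on Q2 f"
    using continuous_on_subset[OF assms(15)] by auto
  have cc: "cnj ` cnj ` D = D" by (simp add: image_image)
  have fr: "frontier Dstar = cnj ` frontier D" unfolding assms(5) by (rule frontier_cnj_image[OF assms(1)])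
  have cl: "closure Dstar = cnj ` closure D" unfolding assms(5) by (rule closure_cnj_image)
  have "f holomorphic_on interior Q1"
    unfolding assms(13)
  proof (rule holomorphic_on_interior_of_translates[OF assms(1-3,6) proj lam' a c b d strip _ _ _ _ reg(1) V])
    show "continuous_on (\<Union>t\<in>{a..b}. vshift t (frontier D)) f"
      "continuous_on (\<Union>s\<in>{c..d}. vshift s (frontier (cnj ` D))) f"
      using cont unfolding assms(5,13,14) by auto
  qed (use assms(16,17) in \<open>auto simp: assms(5)\<close>)
  moreover have "f holomorphic_on interior Q2"
    unfolding assms(14)
  \<comment> \<open>The reflection of \<open>Dstar\<close> is \<open>D\<close>, so the two families
    exchange roles. Conjugation preserves real parts, hence the same \<open>V\<close>, and reverses
    the inward vertical direction, hence \<open>- \<sigma>\<close> below.\<close>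
  proof (rule holomorphic_on_interior_of_translates[where a = c and b = d and c = a and d = b and V = V and \<alpha> = \<alpha> and \<beta> = \<beta> and lam = lam'])
    show "open Dstar" "connected Dstar" "bounded Dstar"
      using assms(1-3) by (auto simp: assms(5) open_cnj_image intro!: connected_continuous_image continuous_intros
        bounded_linear_image bounded_linear_cnj)
    show "Re ` frontier Dstar = {\<alpha>..\<beta>}" unfolding fr using proj by (simp add: image_image)
    show "continuous_on (\<Union>t\<in>{c..d}. vshift t (frontier Dstar)) f"
      "continuous_on (\<Union>s\<in>{a..b}. vshift s (frontier (cnj ` Dstar))) f"
      using cont unfolding assms(5,13,14) cc by auto
    show "\<exists>e\<in>ball p \<rho>. e \<notin> closure Dstar" if p: "p \<in> frontier Dstar" "\<rho> > 0" for p \<rho>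
    proof -
      obtain q where q: "q \<in> frontier D" "p = cnj q" using p(1) unfolding fr by blast
      obtain e where "e \<in> ball q \<rho>" "e \<notin> closure D" using reg(1)[OF q(1) p(2)] by blast
      moreover have "dist (cnj q) (cnj e) = dist q e"
        unfolding dist_norm complex_cnj_diff[symmetric] complex_mod_cnj ..
      ultimately show ?thesis unfolding cl q(2) by (intro bexI[of _ "cnj e"]) auto
    qed
    show "\<exists>\<sigma> \<epsilon>. \<bar>\<sigma>\<bar> = 1 \<and> \<epsilon> > 0 \<and> (\<forall>s. 0 < s \<longrightarrow> s < \<epsilon> \<longrightarrow>
         p + \<i> * of_real (\<sigma> * s) \<in> Dstar \<and> p - \<i> * of_real (\<sigma> * s) \<notin> closure Dstar)"
      if p: "p \<in> frontier Dstar" "Re p \<notin> V" for p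
    proof -
      obtain q where q: "q \<in> frontier D" "p = cnj q" using p(1) unfolding fr by blast
      obtain \<sigma> \<epsilon> where \<sigma>: "\<bar>\<sigma>\<bar> = 1" "\<epsilon> > 0" "\<And>s. 0 < s \<Longrightarrow> s < \<epsilon> \<Longrightarrow>
         q + \<i> * of_real (\<sigma> * s) \<in> D \<and> q - \<i> * of_real (\<sigma> * s) \<notin> closure D"
        using V(2)[OF q(1)] p(2) q(2) by auto
      have "p + \<i> * of_real (- \<sigma> * s) \<in> Dstar \<and> p - \<i> * of_real (- \<sigma> * s) \<notin> closure Dstar"
        if s: "0 < s" "s < \<epsilon>" for s
      proof -
        have eq: "p + \<i> * of_real (- \<sigma> * s) = cnj (q + \<i> * of_real (\<sigma> * s))"
          "p - \<i> * of_real (- \<sigma> * s) = cnj (q - \<i> * of_real (\<sigma> * s))"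
          by (simp_all add: q(2))
        have "cnj w \<in> Dstar \<longleftrightarrow> w \<in> D" for w unfolding assms(5) by auto
        moreover have "cnj w \<in> closure Dstar \<longleftrightarrow> w \<in> closure D" for w unfolding cl by auto
        ultimately show ?thesis using \<sigma>(3)[OF s] unfolding eq by blast
      qed
      then show ?thesis using \<sigma>(1,2) by (intro exI[of _ "- \<sigma>"] exI[of _ \<epsilon>]) auto
    qed
  qed (use assms(6,16,17) lam' a b c d strip V(1) in \<open>auto simp: closure_cnj_image assms(5) image_image\<close>)
  ultimately show ?thesis by (intro holomorphic_on_Un open_interior)
qed

end
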